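(* For real numbers $p,q>0$, $L_p$ embeds quasisymmetrically into $L_q$ if and only if $p\le q$ or $q\le p\le 2$.
   Context: For $0<p<\infty$, $L_p$ denotes $L_p([0,1])$ with Lebesgue measure (real-valued functions modulo almost everywhere equality), equipped with the metric $d(f,g)=\left(\int_0^1|f-g|^p\right)^{1/p}$ if $p\ge 1$ and $d(f,g)=\int_0^1|f-g|^p$ if $0<p<1$. Let $(M,d_M)$ and $(N,d_N)$ be metric spaces. An embedding (injective map) $f:M\to N$ is a quasisymmetric embedding with modulus $\eta:(0,\infty)\to(0,\infty)$ if $\eta$ is increasing, $\lim_{t\to 0}\eta(t)=0$, and for every distinct $x,y,z\in M$, $$\frac{d_N(f(x),f(y))}{d_N(f(x),f(z))}\le \eta\left(\frac{d_M(x,y)}{d_M(x,z)}\right).$$ $M$ embeds quasisymmetrically into $N$ if there is a quasisymmetric embedding $f:M\to N$ with some such modulus $\eta$. *)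

theory Defs
  imports "HOL-Analysis.Analysis"
begin

section \<open>The metric space \<open>L_p([0,1])\<close>\<close>

definition Lp_functions :: "real \<Rightarrow> (real \<Rightarrow> real) set" where
  "Lp_functions p =
    {f \<in> borel_measurable (lebesgue_on {0..1}).
       integrable (lebesgue_on {0..1}) (\<lambda>x. \<bar>f x\<bar> powr p)}"

definition Lp_eq :: "real \<Rightarrow> ((real \<Rightarrow> real) \<times> (real \<Rightarrow> real)) set" where
  "Lp_eq p = {(f, g). f \<in> Lp_functions p \<and> g \<in> Lp_functions p \<and>
                      (AE x in lebesgue_on {0..1}. f x = g x)}"

definition Lp_dist_fun :: "real \<Rightarrow> (real \<Rightarrow> real) \<Rightarrow> (real \<Rightarrow> real) \<Rightarrow> real" where
  "Lp_dist_fun p f g =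
    (if 1 \<le> p then (LINT x|lebesgue_on {0..1}. \<bar>f x - g x\<bar> powr p) powr (1 / p)
     else (LINT x|lebesgue_on {0..1}. \<bar>f x - g x\<bar> powr p))"

text \<open>
  The points are classes of functions. The distance does not depend on the chosen representatives,
  see \<open>mdist_Lp_class\<close>; that it is a metric for \<open>p > 0\<close>, so that \<^const>\<open>metric\<close> may be
  applied, is \<open>Metric_space_Lp\<close>.
\<close>

definition Lp_dist :: "real \<Rightarrow> (real \<Rightarrow> real) set \<Rightarrow> (real \<Rightarrow> real) set \<Rightarrow> real" where
  "Lp_dist p F G = Lp_dist_fun p (SOME f. f \<in> F) (SOME g. g \<in> G)"

definition Lp :: "real \<Rightarrow> (real \<Rightarrow> real) set metric" where
  "Lp p = metric (Lp_functions p // Lp_eq p, Lp_dist p)"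


section \<open>Quasisymmetric embeddings\<close>

text \<open>
  Only the values of a modulus on \<open>(0,\<infinity>)\<close> matter. Whether it is required to increase strictly or
  weakly does not affect embeddability, since \<open>\<lambda>t. \<eta> t + t\<close> may replace \<open>\<eta>\<close>.
\<close>

definition qs_modulus :: "(real \<Rightarrow> real) \<Rightarrow> bool" where
  "qs_modulus \<eta> \<longleftrightarrow>
     (\<forall>t>0. \<eta> t > 0) \<and> strict_mono_on {0<..} \<eta> \<and> (\<eta> \<longlongrightarrow> 0) (at_right 0)"

definition quasisymmetric_embedding ::
  "(real \<Rightarrow> real) \<Rightarrow> 'a metric \<Rightarrow> 'b metric \<Rightarrow> ('a \<Rightarrow> 'b) \<Rightarrow> bool" where
  "quasisymmetric_embedding \<eta> M N f \<longleftrightarrow>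
     f \<in> mspace M \<rightarrow> mspace N \<and> inj_on f (mspace M) \<and> qs_modulus \<eta> \<and>
     (\<forall>x\<in>mspace M. \<forall>y\<in>mspace M. \<forall>z\<in>mspace M. x \<noteq> y \<and> y \<noteq> z \<and> x \<noteq> z \<longrightarrow>
        mdist N (f x) (f y) / mdist N (f x) (f z) \<le> \<eta> (mdist M x y / mdist M x z))"

definition embeds_quasisymmetrically :: "'a metric \<Rightarrow> 'b metric \<Rightarrow> bool" where
  "embeds_quasisymmetrically M N \<longleftrightarrow> (\<exists>\<eta> f. quasisymmetric_embedding \<eta> M N f)"


section \<open>Well-definedness of the metric\<close>

lemma powr_add_le_add_powr:
  fixes x y p :: real
  assumes "0 < p" "p \<le> 1" "0 \<le> x" "0 \<le> y"
  shows "(x + y) powr p \<le> x powr p + y powr p"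
proof (cases "x + y = 0")
  case False
  with assms have s: "x + y > 0" by linarith
  have aux: "u / (x + y) \<le> (u / (x + y)) powr p" if "0 \<le> u" "u \<le> x + y" for u
    using powr_mono'[of p 1 "u / (x + y)"] that s assms by simp
  have "1 = x / (x + y) + y / (x + y)"
    using s by (simp add: add_divide_distrib[symmetric])
  also have "\<dots> \<le> (x / (x + y)) powr p + (y / (x + y)) powr p"
    using aux[of x] aux[of y] assms by simp
  also have "\<dots> = (x powr p + y powr p) / (x + y) powr p"
    using assms s by (simp add: powr_divide add_divide_distrib)
  finally show ?thesis
    using s by (simp add: le_divide_eq split: if_splits)
qed (use assms in auto)

lemma powr_convex_nonneg:
  fixes x y p t :: real
  assumes p: "1 \<le> p" and t: "0 < t" "t < 1" and xy: "0 \<le> x" "0 \<le> y"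
  shows "(t * x + (1 - t) * y) powr p \<le> t * x powr p + (1 - t) * y powr p"
proof -
  have sc: "(s * z) powr p \<le> s * z powr p" if "0 < s" "s < 1" "0 \<le> z" for s z :: real
    using powr_mono'[of 1 p s] that p by (simp add: powr_mult mult_right_mono)
  consider "x = 0" | "y = 0" | "0 < x" "0 < y" using xy by linarith
  then show ?thesis
  proof cases
    case 1 then show ?thesis using sc[of "1 - t" y] t xy p by simp
  next
    case 2 then show ?thesis using sc[of t x] t xy p by simp
  next
    case 3 then show ?thesis
      using convex_onD[OF powr_convex[OF p], of "1 - t" x y] t by simp
  qed
qed

lemma Lp_functions_add:
  assumes p: "0 < p" and f: "f \<in> Lp_functions p" and g: "g \<in> Lp_functions p"
  shows "(\<lambda>x. f x + g x) \<in> Lp_functions p"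
proof -
  let ?M = "lebesgue_on {0..1::real}"
  have [measurable]: "f \<in> borel_measurable ?M" "g \<in> borel_measurable ?M"
    and int: "integrable ?M (\<lambda>x. \<bar>f x\<bar> powr p)" "integrable ?M (\<lambda>x. \<bar>g x\<bar> powr p)"
    using f g by (auto simp: Lp_functions_def)
  have bd: "\<bar>a + b\<bar> powr p \<le> 2 powr p * (\<bar>a\<bar> powr p + \<bar>b\<bar> powr p)" for a b :: real
  proof -
    have "\<bar>a + b\<bar> powr p \<le> (2 * max \<bar>a\<bar> \<bar>b\<bar>) powr p"
      using p by (intro powr_mono2) auto
    also have "\<dots> = 2 powr p * max \<bar>a\<bar> \<bar>b\<bar> powr p" by (simp add: powr_mult)
    also have "\<dots> \<le> 2 powr p * (\<bar>a\<bar> powr p + \<bar>b\<bar> powr p)"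
      by (intro mult_left_mono) (auto simp: max_def)
    finally show ?thesis .
  qed
  have "integrable ?M (\<lambda>x. \<bar>f x + g x\<bar> powr p)"
    by (rule Bochner_Integration.integrable_bound
        [of _ "\<lambda>x. 2 powr p * (\<bar>f x\<bar> powr p + \<bar>g x\<bar> powr p)"])
      (use int bd in \<open>auto intro!: AE_I2\<close>)
  then show ?thesis by (auto simp: Lp_functions_def)
qed

lemma Lp_functions_diff:
  assumes "0 < p" "f \<in> Lp_functions p" "g \<in> Lp_functions p"
  shows "(\<lambda>x. f x - g x) \<in> Lp_functions p"
proof -
  have "(\<lambda>x. - g x) \<in> Lp_functions p" using assms(3) by (auto simp: Lp_functions_def)
  from Lp_functions_add[OF assms(1,2) this] show ?thesis by simp
qed

lemma Lp_minkowski: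
  assumes p: "1 \<le> p" and f: "f \<in> Lp_functions p" and g: "g \<in> Lp_functions p"
  shows "(LINT x|lebesgue_on {0..1}. \<bar>f x + g x\<bar> powr p) powr (1 / p)
    \<le> (LINT x|lebesgue_on {0..1}. \<bar>f x\<bar> powr p) powr (1 / p) +
       (LINT x|lebesgue_on {0..1}. \<bar>g x\<bar> powr p) powr (1 / p)"
    (is "?H powr _ \<le> ?F powr _ + ?G powr _")
proof (rule field_le_epsilon)
  fix e :: real assume e: "0 < e"
  let ?M = "lebesgue_on {0..1::real}"
  define a where "a = ?F powr (1 / p) + e / 2"
  define b where "b = ?G powr (1 / p) + e / 2"
  define t where "t = a / (a + b)"
  have ab: "a > 0" "b > 0" using e by (auto simp: a_def b_def add_nonneg_pos)
  have t: "0 < t" "t < 1" "1 - t = b / (a + b)" using ab by (auto simp: t_def field_simps)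
  have int: "integrable ?M (\<lambda>x. \<bar>f x\<bar> powr p)" "integrable ?M (\<lambda>x. \<bar>g x\<bar> powr p)"
    "integrable ?M (\<lambda>x. \<bar>f x + g x\<bar> powr p)"
    using f g Lp_functions_add[OF _ f g] p by (auto simp: Lp_functions_def)
  have le: "I / c powr p \<le> 1" if "0 \<le> I" "c = I powr (1 / p) + e / 2" for I c :: real
  proof -
    have "I = (I powr (1 / p)) powr p" using that p by (simp add: powr_powr)
    also have "\<dots> \<le> c powr p" using that p e by (intro powr_mono2) auto
    finally show ?thesis by (simp add: divide_le_eq_1)
  qed
  have pw: "\<bar>f x + g x\<bar> powr p \<le>
      (a + b) powr p * (t * (\<bar>f x\<bar> powr p / a powr p) + (1 - t) * (\<bar>g x\<bar> powr p / b powr p))"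
    for x
  proof -
    have "\<bar>f x + g x\<bar> powr p \<le> (\<bar>f x\<bar> + \<bar>g x\<bar>) powr p"
      using p by (intro powr_mono2) auto
    also have "\<bar>f x\<bar> + \<bar>g x\<bar> = (a + b) * (t * (\<bar>f x\<bar> / a) + (1 - t) * (\<bar>g x\<bar> / b))"
      using ab unfolding t(3) unfolding t_def by (simp add: distrib_left)
    also have "\<dots> powr p = (a + b) powr p * (t * (\<bar>f x\<bar> / a) + (1 - t) * (\<bar>g x\<bar> / b)) powr p"
      by (rule powr_mult)
    also have "\<dots> \<le> (a + b) powr p * (t * (\<bar>f x\<bar> / a) powr p + (1 - t) * (\<bar>g x\<bar> / b) powr p)"
      using ab t p by (intro mult_left_mono powr_convex_nonneg) auto
    finally show ?thesis using ab by (simp add: powr_divide)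
  qed
  have "?H \<le> (LINT x|?M. (a + b) powr p *
      (t * (\<bar>f x\<bar> powr p / a powr p) + (1 - t) * (\<bar>g x\<bar> powr p / b powr p)))"
    by (rule integral_mono) (use int pw in auto)
  also have "\<dots> = (a + b) powr p * (t * (?F / a powr p) + (1 - t) * (?G / b powr p))"
    using int by simp
  also have "\<dots> \<le> (a + b) powr p * (t * 1 + (1 - t) * 1)"
    using t le[of ?F a] le[of ?G b]
    by (intro mult_left_mono add_mono) (auto simp: a_def b_def)
  finally have "?H \<le> (a + b) powr p" by simp
  then have "?H powr (1 / p) \<le> ((a + b) powr p) powr (1 / p)"
    using p by (intro powr_mono2) auto
  also have "\<dots> = a + b" using p ab by (simp add: powr_powr)
  finally show "?H powr (1 / p) \<le> ?F powr (1 / p) + ?G powr (1 / p) + e"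
    by (simp add: a_def b_def)
qed

lemma Lp_dist_fun_triangle:
  assumes p: "0 < p"
    and f: "f \<in> Lp_functions p" and g: "g \<in> Lp_functions p" and h: "h \<in> Lp_functions p"
  shows "Lp_dist_fun p f h \<le> Lp_dist_fun p f g + Lp_dist_fun p g h"
proof (cases "1 \<le> p")
  case True
  then show ?thesis
    using Lp_minkowski[OF True Lp_functions_diff[OF p f g] Lp_functions_diff[OF p g h]]
    by (simp add: Lp_dist_fun_def)
next
  case False
  let ?M = "lebesgue_on {0..1::real}"
  have int: "integrable ?M (\<lambda>x. \<bar>f x - h x\<bar> powr p)" "integrable ?M (\<lambda>x. \<bar>f x - g x\<bar> powr p)"
    "integrable ?M (\<lambda>x. \<bar>g x - h x\<bar> powr p)"
    using Lp_functions_diff[OF p] f g h by (auto simp: Lp_functions_def)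
  have pw: "\<bar>f x - h x\<bar> powr p \<le> \<bar>f x - g x\<bar> powr p + \<bar>g x - h x\<bar> powr p" for x
  proof -
    have "\<bar>f x - h x\<bar> powr p \<le> (\<bar>f x - g x\<bar> + \<bar>g x - h x\<bar>) powr p"
      using p by (intro powr_mono2) auto
    also have "\<dots> \<le> \<bar>f x - g x\<bar> powr p + \<bar>g x - h x\<bar> powr p"
      using p False by (intro powr_add_le_add_powr) auto
    finally show ?thesis .
  qed
  have "(LINT x|?M. \<bar>f x - h x\<bar> powr p)
      \<le> (LINT x|?M. \<bar>f x - g x\<bar> powr p + \<bar>g x - h x\<bar> powr p)"
    by (rule integral_mono) (use int pw in auto)
  then show ?thesis using int False by (simp add: Lp_dist_fun_def)
qed

lemma Lp_dist_fun_commute: "Lp_dist_fun p f g = Lp_dist_fun p g f"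
  by (simp add: Lp_dist_fun_def abs_minus_commute)

lemma Lp_dist_fun_nonneg: "0 \<le> Lp_dist_fun p f g"
  by (simp add: Lp_dist_fun_def)

lemma Lp_dist_fun_eq_0_iff:
  assumes p: "0 < p" and f: "f \<in> Lp_functions p" and g: "g \<in> Lp_functions p"
  shows "Lp_dist_fun p f g = 0 \<longleftrightarrow> (f, g) \<in> Lp_eq p"
proof -
  let ?M = "lebesgue_on {0..1::real}"
  have "integrable ?M (\<lambda>x. \<bar>f x - g x\<bar> powr p)"
    using Lp_functions_diff[OF p f g] by (simp add: Lp_functions_def)
  then have "(LINT x|?M. \<bar>f x - g x\<bar> powr p) = 0 \<longleftrightarrow> (AE x in ?M. \<bar>f x - g x\<bar> powr p = 0)"
    by (intro integral_nonneg_eq_0_iff_AE) auto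
  then show ?thesis using f g by (simp add: Lp_dist_fun_def Lp_eq_def)
qed

lemma equiv_Lp_eq: "equiv (Lp_functions p) (Lp_eq p)"
proof (rule equivI)
  show "Lp_eq p \<subseteq> Lp_functions p \<times> Lp_functions p" by (auto simp: Lp_eq_def)
  show "refl_on (Lp_functions p) (Lp_eq p)" by (auto simp: refl_on_def Lp_eq_def)
  show "sym (Lp_eq p)" by (auto simp: sym_def Lp_eq_def elim: AE_mp)
  show "trans (Lp_eq p)"
  proof (rule transI)
    fix f g h assume fg: "(f, g) \<in> Lp_eq p" and gh: "(g, h) \<in> Lp_eq p"
    then have "AE x in lebesgue_on {0..1}. f x = g x" "AE x in lebesgue_on {0..1}. g x = h x"
      by (auto simp: Lp_eq_def)
    then have "AE x in lebesgue_on {0..1}. f x = h x" by eventually_elim simp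
    with fg gh show "(f, h) \<in> Lp_eq p" by (auto simp: Lp_eq_def)
  qed
qed

lemma Lp_dist_fun_cong:
  assumes ff: "(f, f') \<in> Lp_eq p" and gg: "(g, g') \<in> Lp_eq p"
  shows "Lp_dist_fun p f g = Lp_dist_fun p f' g'"
proof -
  let ?M = "lebesgue_on {0..1::real}"
  have [measurable]: "f \<in> borel_measurable ?M" "g \<in> borel_measurable ?M"
    "f' \<in> borel_measurable ?M" "g' \<in> borel_measurable ?M"
    and ae: "AE x in ?M. f x = f' x" "AE x in ?M. g x = g' x"
    using assms by (auto simp: Lp_eq_def Lp_functions_def)
  have "AE x in ?M. \<bar>f x - g x\<bar> powr p = \<bar>f' x - g' x\<bar> powr p"
    using ae by eventually_elim simp
  then have "(LINT x|?M. \<bar>f x - g x\<bar> powr p) = (LINT x|?M. \<bar>f' x - g' x\<bar> powr p)"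
    by (intro integral_cong_AE) measurable
  then show ?thesis by (simp add: Lp_dist_fun_def)
qed

lemma Lp_dist_class:
  assumes F: "F \<in> Lp_functions p // Lp_eq p" and G: "G \<in> Lp_functions p // Lp_eq p"
    and f: "f \<in> F" and g: "g \<in> G"
  shows "Lp_dist p F G = Lp_dist_fun p f g"
proof -
  have "(SOME f. f \<in> F) \<in> F" using f by (rule someI[where P = "\<lambda>f. f \<in> F"])
  moreover have "(SOME g. g \<in> G) \<in> G" using g by (rule someI[where P = "\<lambda>g. g \<in> G"])
  ultimately show ?thesis unfolding Lp_dist_def
    using quotient_eq_iff[OF equiv_Lp_eq F F _ f] quotient_eq_iff[OF equiv_Lp_eq G G _ g]
    by (intro Lp_dist_fun_cong) auto
qed

theorem Metric_space_Lp:
  assumes p: "0 < p"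
  shows "Metric_space (Lp_functions p // Lp_eq p) (Lp_dist p)"
proof
  let ?Q = "Lp_functions p // Lp_eq p"
  have rep: "\<exists>f. f \<in> F \<and> f \<in> Lp_functions p" if F: "F \<in> ?Q" for F
    using in_quotient_imp_non_empty[OF equiv_Lp_eq F]
      in_quotient_imp_subset[OF equiv_Lp_eq F] by blast
  show "0 \<le> Lp_dist p F G" for F G
    by (simp add: Lp_dist_def Lp_dist_fun_nonneg)
  show "Lp_dist p F G = Lp_dist p G F" for F G
    by (simp add: Lp_dist_def Lp_dist_fun_commute)
  show "Lp_dist p F G = 0 \<longleftrightarrow> F = G" if F: "F \<in> ?Q" and G: "G \<in> ?Q" for F G
  proof -
    obtain f g where f: "f \<in> F" "f \<in> Lp_functions p" and g: "g \<in> G" "g \<in> Lp_functions p"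
      using rep[OF F] rep[OF G] by blast
    show ?thesis
      using Lp_dist_class[OF F G f(1) g(1)] Lp_dist_fun_eq_0_iff[OF p f(2) g(2)]
        quotient_eq_iff[OF equiv_Lp_eq F G f(1) g(1)] by simp
  qed
  show "Lp_dist p F H \<le> Lp_dist p F G + Lp_dist p G H"
    if F: "F \<in> ?Q" and G: "G \<in> ?Q" and H: "H \<in> ?Q" for F G H
  proof -
    obtain f g h where f: "f \<in> F" "f \<in> Lp_functions p" and g: "g \<in> G" "g \<in> Lp_functions p"
      and h: "h \<in> H" "h \<in> Lp_functions p"
      using rep[OF F] rep[OF G] rep[OF H] by blast
    show ?thesis
      using Lp_dist_fun_triangle[OF p f(2) g(2) h(2)]
      by (simp add: Lp_dist_class[OF F H f(1) h(1)] Lp_dist_class[OF F G f(1) g(1)]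
          Lp_dist_class[OF G H g(1) h(1)])
  qed
qed

lemma mspace_Lp: "0 < p \<Longrightarrow> mspace (Lp p) = Lp_functions p // Lp_eq p"
  unfolding Lp_def by (rule Metric_space.mspace_metric[OF Metric_space_Lp])

lemma mdist_Lp: "0 < p \<Longrightarrow> mdist (Lp p) = Lp_dist p"
  unfolding Lp_def by (rule Metric_space.mdist_metric[OF Metric_space_Lp])

lemma mdist_Lp_class:
  assumes "0 < p" "F \<in> mspace (Lp p)" "G \<in> mspace (Lp p)" "f \<in> F" "g \<in> G"
  shows "mdist (Lp p) F G = Lp_dist_fun p f g"
  using assms by (simp add: mspace_Lp mdist_Lp Lp_dist_class)

end

theory Submission
  imports Defs "HOL-Library.Nat_Bijection" "HOL-Library.Discrete_Functions"
begin

text \<open>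
  Three facts give the theorem, since quasisymmetric embeddings can be composed
  (\<open>embeds_quasisymmetrically_trans\<close>).

  For \<open>p < q\<close>, the line with the metric \<open>\<bar>u - v\<bar>\<^sup>p\<^sup>/\<^sup>q\<close> embeds in \<open>\<ell>_q\<close> with bounded
  distortion, by the weighted waves \<open>2\<^sup>-\<^sup>p\<^sup>n\<^sup>/\<^sup>q (cos (2\<^sup>n u) - 1)\<close> and \<open>2\<^sup>-\<^sup>p\<^sup>n\<^sup>/\<^sup>q sin (2\<^sup>n u)\<close> for all
  integers \<open>n\<close>. Applying this to the values of functions gives a map from \<open>L_p\<close> to \<open>L_q\<close> for which
  \<open>\<integral>\<bar>\<Phi> f - \<Phi> g\<bar>\<^sup>q\<close> is comparable to \<open>\<integral>\<bar>f - g\<bar>\<^sup>p\<close> (\<open>Lp_embeds_Lq_of_less\<close>).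

  For \<open>q \<le> 2\<close>, the space \<open>L_2\<close> is isometric to a subspace of \<open>\<ell>_2\<close> by the Haar
  coefficients (\<open>haar_parseval\<close>), and \<open>\<ell>_2\<close> embeds in \<open>L_q\<close> by Rademacher series, by the
  inequality of Khintchine (\<open>rademacher_series_distance\<close>). If \<open>q \<le> p \<le> 2\<close>, then \<open>L_p\<close> embeds in
  \<open>L_2\<close> and hence in \<open>L_q\<close>.

  For \<open>2 \<le> q < p\<close> there is no embedding of \<open>L_p\<close> in \<open>L_q\<close> (\<open>Lp_not_embeds_Lq\<close>). The obstruction is
  the metric cotype \<open>q\<close> inequality of Mendel and Naor on the discrete torus \<open>(\<int>/m)\<^sup>n\<close> with \<open>m\<close> of
  order \<open>n\<^sup>1\<^sup>/\<^sup>q\<close>. For real-valued functions it follows from the inequality of Bessel on the cube of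
  signs (\<open>metric_cotype_real\<close>), and integration extends it to \<open>L_q\<close>. The torus
  placed coordinatewise in \<open>L_p\<close> violates it under every quasisymmetric embedding. If \<open>q < 2 < p\<close>, an
  embedding of \<open>L_p\<close> in \<open>L_q\<close> would give one in \<open>L_2\<close>, because \<open>L_q\<close> embeds in \<open>L_2\<close>.
\<close>

section \<open>Borel representatives and the integral of a power\<close>

text \<open>
  Every class in \<open>L_p\<close> contains a Borel function defined on the whole line, so that all
  integrals may be taken over Lebesgue--Borel measure on the unit interval.
\<close>

abbreviation unit_measure :: "real measure" where
  "unit_measure \<equiv> restrict_space lborel {0..1}"

text \<open>
  \<open>mass p f\<close> is \<open>\<integral>\<bar>f\<bar>\<^sup>p\<close> over the unit interval,
  before any root is taken. The distinction between \<open>p \<ge> 1\<close> and \<open>p < 1\<close> in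
  the metric is confined to \<open>dist_exponent\<close> below.
\<close>

definition mass :: "real \<Rightarrow> (real \<Rightarrow> real) \<Rightarrow> ennreal" where
  "mass p f = (\<integral>\<^sup>+x. ennreal (\<bar>f x\<bar> powr p) \<partial>unit_measure)"

lemma borel_imp_unit [measurable (raw)]:
  "f \<in> borel_measurable borel \<Longrightarrow> f \<in> borel_measurable unit_measure"
  by (intro measurable_restrict_space1) simp

lemma nn_integral_unit_measure:
  "(\<integral>\<^sup>+x. h x \<partial>unit_measure) = (\<integral>\<^sup>+x. h x * indicator {0..1} x \<partial>lborel)"
  by (intro nn_integral_restrict_space) auto

lemma emeasure_unit_measure [simp]: "emeasure unit_measure (space unit_measure) = 1"
  by (subst emeasure_restrict_space) (auto simp: space_restrict_space)

lemma finite_measure_unit: "finite_measure unit_measure"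
  by (rule finite_measureI, subst emeasure_unit_measure) simp

lemma nn_integral_unit_const [simp]: "(\<integral>\<^sup>+x. c \<partial>unit_measure) = c"
  by (subst nn_integral_const, subst emeasure_unit_measure) simp

lemma AE_unit_measure: "AE s in unit_measure. 0 < s \<and> s < 1"
proof -
  have "AE s in lborel. s \<in> {0..1} \<longrightarrow> 0 < s \<and> s < (1::real)"
    using AE_lborel_singleton[of "0::real"] AE_lborel_singleton[of "1::real"] by eventually_elim auto
  then show ?thesis by (subst AE_restrict_space_iff) simp_all
qed

lemma borel_representative:
  assumes "f \<in> Lp_functions p"
  shows "\<exists>g. (f, g) \<in> Lp_eq p \<and> g \<in> borel_measurable borel"
proof -
  let ?h = "\<lambda>x. f x * indicator {0..1} x"
  have f: "f \<in> borel_measurable (lebesgue_on {0..1})"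
    and int: "integrable (lebesgue_on {0..1}) (\<lambda>x. \<bar>f x\<bar> powr p)"
    using assms by (auto simp: Lp_functions_def)
  have "?h \<in> borel_measurable lebesgue"
    using f by (subst (asm) borel_measurable_restrict_space_iff) (auto simp: mult.commute)
  then obtain g where g: "g \<in> borel_measurable lborel" "AE x in lborel. ?h x = g x"
    using completion_ex_borel_measurable_real[of ?h lborel] by blast
  have "AE x in lebesgue. ?h x = g x"
    using g(2) by (rule AE_completion)
  then have ae: "AE x in lebesgue_on {0..1}. f x = g x"
    by (subst AE_restrict_space_iff) (auto elim!: eventually_mono)
  have gm: "g \<in> borel_measurable (lebesgue_on {0..1})"
    using g(1) by (intro measurable_restrict_space1 measurable_completion) simp
  have "integrable (lebesgue_on {0..1}) (\<lambda>x. \<bar>g x\<bar> powr p)"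
    using int
  proof (rule integrable_cong_AE_imp)
    show "(\<lambda>x. \<bar>g x\<bar> powr p) \<in> borel_measurable (lebesgue_on {0..1})"
      using gm by measurable
    show "AE x in lebesgue_on {0..1}. \<bar>f x\<bar> powr p = \<bar>g x\<bar> powr p"
      using ae by eventually_elim simp
  qed
  then show ?thesis
    using assms gm g(1) ae by (intro exI[of _ g]) (auto simp: Lp_eq_def Lp_functions_def)
qed

lemma nn_integral_lebesgue_on_unit:
  assumes [measurable]: "h \<in> borel_measurable borel"
  shows "(\<integral>\<^sup>+x. h x \<partial>lebesgue_on {0..1}) = (\<integral>\<^sup>+x. h x \<partial>unit_measure)"
  by (simp add: nn_integral_restrict_space nn_integral_completion)

lemma Lp_functions_borel_iff:
  assumes [measurable]: "f \<in> borel_measurable borel"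
  shows "f \<in> Lp_functions p \<longleftrightarrow> mass p f < \<infinity>"
proof -
  have m: "f \<in> borel_measurable (lebesgue_on {0..1})"
    by (intro measurable_restrict_space1 measurable_completion) simp
  then have [measurable]: "(\<lambda>x. \<bar>f x\<bar> powr p) \<in> borel_measurable (lebesgue_on {0..1})"
    by measurable
  show ?thesis
    using m nn_integral_lebesgue_on_unit[of "\<lambda>x. ennreal (\<bar>f x\<bar> powr p)"]
    by (simp add: Lp_functions_def mass_def integrable_iff_bounded)
qed

lemma LINT_eq_mass:
  assumes [measurable]: "f \<in> borel_measurable borel"
  shows "(LINT x|lebesgue_on {0..1}. \<bar>f x\<bar> powr p) = enn2real (mass p f)"
proof -
  have m: "f \<in> borel_measurable (lebesgue_on {0..1})"
    by (intro measurable_restrict_space1 measurable_completion) simp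
  show ?thesis
    using m nn_integral_lebesgue_on_unit[of "\<lambda>x. ennreal (\<bar>f x\<bar> powr p)"]
    by (subst integral_eq_nn_integral) (auto simp: mass_def)
qed

text \<open>
  The power of \<open>mass p (f - g)\<close> that is the distance of \<open>f\<close> and
  \<open>g\<close> in \<open>L_p\<close>.
\<close>

definition dist_exponent :: "real \<Rightarrow> real" where
  "dist_exponent p = (if 1 \<le> p then 1 / p else 1)"

lemma dist_exponent_pos: "p > 0 \<Longrightarrow> dist_exponent p > 0"
  by (simp add: dist_exponent_def)

lemma Lp_dist_fun_borel:
  assumes "f \<in> borel_measurable borel" "g \<in> borel_measurable borel"
  shows "Lp_dist_fun p f g = enn2real (mass p (\<lambda>x. f x - g x)) powr dist_exponent p"
  using LINT_eq_mass[of "\<lambda>x. f x - g x" p] assms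
  by (simp add: Lp_dist_fun_def dist_exponent_def)

text \<open>
  A chosen Borel representative of a class.
\<close>

definition borel_rep :: "(real \<Rightarrow> real) set \<Rightarrow> real \<Rightarrow> real" where
  "borel_rep F = (SOME f. f \<in> F \<and> f \<in> borel_measurable borel)"

lemma borel_rep:
  assumes p: "p > 0" and F: "F \<in> mspace (Lp p)"
  shows "borel_rep F \<in> F" "borel_rep F \<in> borel_measurable borel" "mass p (borel_rep F) < \<infinity>"
proof -
  have F': "F \<in> Lp_functions p // Lp_eq p" using F p by (simp add: mspace_Lp)
  then obtain f where f: "f \<in> Lp_functions p" "F = Lp_eq p `` {f}"
    by (auto simp: quotient_def)
  obtain g where "(f, g) \<in> Lp_eq p" "g \<in> borel_measurable borel"
    using borel_representative[OF f(1)] by (elim exE conjE)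
  then have "g \<in> F \<and> g \<in> borel_measurable borel" using f(2) by simp
  then have *: "borel_rep F \<in> F \<and> borel_rep F \<in> borel_measurable borel"
    unfolding borel_rep_def
    by (rule someI[where P = "\<lambda>f. f \<in> F \<and> f \<in> borel_measurable borel"])
  then show "borel_rep F \<in> F" "borel_rep F \<in> borel_measurable borel" by auto
  have "borel_rep F \<in> Lp_functions p"
    using * in_quotient_imp_subset[OF equiv_Lp_eq F'] by (elim conjE) (rule subsetD)
  then show "mass p (borel_rep F) < \<infinity>"
    using Lp_functions_borel_iff * by simp
qed

lemma mdist_borel_rep:
  assumes p: "p > 0" and F: "F \<in> mspace (Lp p)" and G: "G \<in> mspace (Lp p)"
  shows "mdist (Lp p) F G
    = enn2real (mass p (\<lambda>x. borel_rep F x - borel_rep G x)) powr dist_exponent p"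
  using mdist_Lp_class[OF p F G borel_rep(1)[OF p F] borel_rep(1)[OF p G]]
    Lp_dist_fun_borel borel_rep(2)[OF p F] borel_rep(2)[OF p G] by simp

text \<open>
  The class in \<open>L_p\<close> of a function.
\<close>

definition Lp_class :: "real \<Rightarrow> (real \<Rightarrow> real) \<Rightarrow> (real \<Rightarrow> real) set" where
  "Lp_class p f = Lp_eq p `` {f}"

lemma Lp_class:
  assumes "p > 0" "f \<in> borel_measurable borel" "mass p f < \<infinity>"
  shows "Lp_class p f \<in> mspace (Lp p)" "f \<in> Lp_class p f"
proof -
  have "f \<in> Lp_functions p" using assms Lp_functions_borel_iff by blast
  then show "Lp_class p f \<in> mspace (Lp p)" "f \<in> Lp_class p f"
    using assms equiv_class_self[OF equiv_Lp_eq]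
    by (simp_all add: mspace_Lp Lp_class_def quotientI)
qed

lemma mdist_Lp_class_borel:
  assumes "p > 0" "f \<in> borel_measurable borel" "mass p f < \<infinity>"
    "g \<in> borel_measurable borel" "mass p g < \<infinity>"
  shows "mdist (Lp p) (Lp_class p f) (Lp_class p g)
    = enn2real (mass p (\<lambda>x. f x - g x)) powr dist_exponent p"
  using mdist_Lp_class[OF assms(1) Lp_class(1)[OF assms(1-3)] Lp_class(1)[OF assms(1,4,5)]
      Lp_class(2)[OF assms(1-3)] Lp_class(2)[OF assms(1,4,5)]] Lp_dist_fun_borel assms by simp

lemma mass_diff_finite:
  assumes p: "p > 0" and f: "f \<in> borel_measurable borel" "mass p f < \<infinity>"
    and g: "g \<in> borel_measurable borel" "mass p g < \<infinity>"
  shows "mass p (\<lambda>x. f x - g x) < \<infinity>"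
  using Lp_functions_diff[OF p, of f g] f g
  by (simp add: Lp_functions_borel_iff)

section \<open>Power-law distortion and composition of embeddings\<close>

lemma embeds_quasisymmetricallyI:
  assumes "f \<in> mspace M \<rightarrow> mspace N" "inj_on f (mspace M)" "qs_modulus \<eta>"
    "\<And>x y z. x \<in> mspace M \<Longrightarrow> y \<in> mspace M \<Longrightarrow> z \<in> mspace M \<Longrightarrow>
      x \<noteq> y \<Longrightarrow> y \<noteq> z \<Longrightarrow> x \<noteq> z \<Longrightarrow>
      mdist N (f x) (f y) / mdist N (f x) (f z) \<le> \<eta> (mdist M x y / mdist M x z)"
  shows "embeds_quasisymmetrically M N"
  unfolding embeds_quasisymmetrically_def quasisymmetric_embedding_def
  by (intro exI[of _ \<eta>] exI[of _ f] conjI ballI impI assms; (elim conjE)?) 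

lemma embeds_quasisymmetricallyE:
  assumes "embeds_quasisymmetrically M N"
  obtains \<eta> f where "f \<in> mspace M \<rightarrow> mspace N" "inj_on f (mspace M)" "qs_modulus \<eta>"
    "\<And>x y z. x \<in> mspace M \<Longrightarrow> y \<in> mspace M \<Longrightarrow> z \<in> mspace M \<Longrightarrow>
      x \<noteq> y \<Longrightarrow> y \<noteq> z \<Longrightarrow> x \<noteq> z \<Longrightarrow>
      mdist N (f x) (f y) / mdist N (f x) (f z) \<le> \<eta> (mdist M x y / mdist M x z)"
proof -
  from assms obtain \<eta> f where "quasisymmetric_embedding \<eta> M N f"
    unfolding embeds_quasisymmetrically_def by (elim exE)
  then show thesis
    unfolding quasisymmetric_embedding_def by (elim conjE, intro that[of f \<eta>]) simp_all
qed

text \<open>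
  A map that changes distances by a power law, up to constants, is a quasisymmetric embedding: the
  modulus is \<open>t \<mapsto> (C / c) t\<^sup>a\<close>.
\<close>

lemma embeds_quasisymmetrically_snowflake:
  fixes \<Phi> :: "'a \<Rightarrow> 'b"
  assumes maps: "\<Phi> \<in> mspace M \<rightarrow> mspace N" and c: "c > 0" and C: "C > 0" and a: "a > 0"
    and bd: "\<And>x y. x \<in> mspace M \<Longrightarrow> y \<in> mspace M \<Longrightarrow>
      c * mdist M x y powr a \<le> mdist N (\<Phi> x) (\<Phi> y) \<and>
      mdist N (\<Phi> x) (\<Phi> y) \<le> C * mdist M x y powr a"
  shows "embeds_quasisymmetrically M N"
proof -
  define \<eta> :: "real \<Rightarrow> real" where "\<eta> t = C / c * t powr a" for t
  have pos: "mdist M x y > 0" if "x \<in> mspace M" "y \<in> mspace M" "x \<noteq> y" for x y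
    using that by (intro Metric_space.mdist_pos_less[OF Metric_space_mspace_mdist])
  have "inj_on \<Phi> (mspace M)"
  proof (rule inj_onI, rule ccontr)
    fix x y assume xy: "x \<in> mspace M" "y \<in> mspace M" "\<Phi> x = \<Phi> y" "x \<noteq> y"
    have "0 < c * mdist M x y powr a" using c pos[OF xy(1,2,4)] by simp
    also have "\<dots> \<le> mdist N (\<Phi> x) (\<Phi> y)" using bd xy by blast
    also have "\<dots> = 0" using xy maps by (auto simp: Pi_iff)
    finally show False by simp
  qed
  moreover have "qs_modulus \<eta>"
    unfolding qs_modulus_def
  proof (intro conjI allI impI)
    show "\<eta> t > 0" if "t > 0" for t using that c C by (simp add: \<eta>_def)
    show "strict_mono_on {0<..} \<eta>"
    proof (rule strict_mono_onI)
      fix r s :: real assume rs: "r \<in> {0<..}" "r < s"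
      then have "r powr a < s powr a" using a by (intro powr_less_mono2) auto
      then show "\<eta> r < \<eta> s" using c C unfolding \<eta>_def by (intro mult_strict_left_mono) auto
    qed
    have "((\<lambda>t. C / c * t powr a) \<longlongrightarrow> C / c * 0 powr a) (at_right 0)"
      using a by (intro tendsto_mult tendsto_const tendsto_powr' tendsto_ident_at)
        (auto simp: eventually_at_filter)
    then show "(\<eta> \<longlongrightarrow> 0) (at_right 0)" using a by (simp add: \<eta>_def[abs_def])
  qed
  moreover have "mdist N (\<Phi> x) (\<Phi> y) / mdist N (\<Phi> x) (\<Phi> z) \<le> \<eta> (mdist M x y / mdist M x z)"
    if xyz: "x \<in> mspace M" "y \<in> mspace M" "z \<in> mspace M" and "x \<noteq> y" "y \<noteq> z" and "x \<noteq> z"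
    for x y z
  proof -
    have "mdist N (\<Phi> x) (\<Phi> y) / mdist N (\<Phi> x) (\<Phi> z)
        \<le> (C * mdist M x y powr a) / (c * mdist M x z powr a)"
      using bd[OF xyz(1,2)] bd[OF xyz(1,3)] c C pos[OF xyz(1,3) \<open>x \<noteq> z\<close>]
      by (intro frac_le) auto
    then show ?thesis by (simp add: \<eta>_def powr_divide)
  qed
  ultimately show ?thesis
    by (rule embeds_quasisymmetricallyI[OF maps])
qed

lemma embeds_quasisymmetrically_refl: "embeds_quasisymmetrically M M"
  by (rule embeds_quasisymmetrically_snowflake[of id _ _ 1 1 1]) auto

lemma embeds_quasisymmetrically_trans:
  assumes "embeds_quasisymmetrically L M" "embeds_quasisymmetrically M N"
  shows "embeds_quasisymmetrically L N"
proof -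
  obtain \<eta> f where f: "f \<in> mspace L \<rightarrow> mspace M" "inj_on f (mspace L)" "qs_modulus \<eta>"
    and f': "\<And>x y z. x \<in> mspace L \<Longrightarrow> y \<in> mspace L \<Longrightarrow> z \<in> mspace L \<Longrightarrow>
      x \<noteq> y \<Longrightarrow> y \<noteq> z \<Longrightarrow> x \<noteq> z \<Longrightarrow>
      mdist M (f x) (f y) / mdist M (f x) (f z) \<le> \<eta> (mdist L x y / mdist L x z)"
    using assms(1) by (rule embeds_quasisymmetricallyE) blast
  obtain \<theta> g where g: "g \<in> mspace M \<rightarrow> mspace N" "inj_on g (mspace M)" "qs_modulus \<theta>"
    and g': "\<And>x y z. x \<in> mspace M \<Longrightarrow> y \<in> mspace M \<Longrightarrow> z \<in> mspace M \<Longrightarrow>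
      x \<noteq> y \<Longrightarrow> y \<noteq> z \<Longrightarrow> x \<noteq> z \<Longrightarrow>
      mdist N (g x) (g y) / mdist N (g x) (g z) \<le> \<theta> (mdist M x y / mdist M x z)"
    using assms(2) by (rule embeds_quasisymmetricallyE) blast
  have "qs_modulus (\<theta> \<circ> \<eta>)"
    unfolding qs_modulus_def
  proof (intro conjI allI impI)
    show "(\<theta> \<circ> \<eta>) t > 0" if "t > 0" for t
      using that f(3) g(3) by (simp add: qs_modulus_def)
    show "strict_mono_on {0<..} (\<theta> \<circ> \<eta>)"
      using f(3) g(3) by (auto simp: qs_modulus_def strict_mono_on_def)
    have "filterlim \<eta> (at_right 0) (at_right 0)"
      using f(3) unfolding filterlim_at qs_modulus_def
      by (auto simp: eventually_at_filter less_imp_neq[THEN not_sym])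
    moreover have "(\<theta> \<longlongrightarrow> 0) (at_right 0)" using g(3) by (simp add: qs_modulus_def)
    ultimately show "((\<theta> \<circ> \<eta>) \<longlongrightarrow> 0) (at_right 0)"
      unfolding comp_def by (rule filterlim_compose[rotated])
  qed
  moreover have "mdist N (g (f x)) (g (f y)) / mdist N (g (f x)) (g (f z))
      \<le> \<theta> (\<eta> (mdist L x y / mdist L x z))"
    if xyz: "x \<in> mspace L" "y \<in> mspace L" "z \<in> mspace L" "x \<noteq> y" "y \<noteq> z" "x \<noteq> z" for x y z
  proof -
    have m: "f x \<in> mspace M" "f y \<in> mspace M" "f z \<in> mspace M" using f(1) xyz by auto
    have d: "f x \<noteq> f y" "f y \<noteq> f z" "f x \<noteq> f z" using f(2) xyz by (auto dest: inj_onD)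
    let ?r = "mdist M (f x) (f y) / mdist M (f x) (f z)"
    have r: "0 < ?r" "?r \<le> \<eta> (mdist L x y / mdist L x z)"
      using m d f'[OF xyz] by (auto intro!: divide_pos_pos simp: Metric_space.mdist_pos_less[OF Metric_space_mspace_mdist])
    have "\<theta> ?r \<le> \<theta> (\<eta> (mdist L x y / mdist L x z))"
      using g(3) r by (intro strict_mono_on_leD[of "{0<..}" \<theta>]) (simp_all add: qs_modulus_def)
    with g'[OF m d] show ?thesis by linarith
  qed
  moreover have "inj_on (g \<circ> f) (mspace L)"
    using f(1,2) g(2) by (intro comp_inj_on) (auto intro: inj_on_subset)
  moreover have "g \<circ> f \<in> mspace L \<rightarrow> mspace N" using f(1) g(1) by auto
  ultimately show ?thesis
    by (intro embeds_quasisymmetricallyI[of "g \<circ> f" _ _ "\<theta> \<circ> \<eta>"]) simp_all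
qed

text \<open>
  The form of the previous criterion used below: a map between functions for which
  \<open>\<integral>\<bar>\<Phi> f - \<Phi> g\<bar>\<^sup>q\<close> is comparable to a power of
  \<open>\<integral>\<bar>f - g\<bar>\<^sup>p\<close>. It need not respect almost everywhere equality,
  since it is applied to one chosen representative of each class.
\<close>

lemma Lp_embeds_criterion:
  assumes p: "p > 0" and q: "q > 0" and c: "c > 0" and C: "C > 0" and s: "s > 0"
    and meas: "\<And>f. f \<in> borel_measurable borel \<Longrightarrow> mass p f < \<infinity> \<Longrightarrow>
      \<Phi> f \<in> borel_measurable borel \<and> mass q (\<Phi> f) < \<infinity>"
    and bd: "\<And>f g. f \<in> borel_measurable borel \<Longrightarrow> mass p f < \<infinity> \<Longrightarrow>
      g \<in> borel_measurable borel \<Longrightarrow> mass p g < \<infinity> \<Longrightarrow>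
      c * enn2real (mass p (\<lambda>x. f x - g x)) powr s \<le> enn2real (mass q (\<lambda>x. \<Phi> f x - \<Phi> g x)) \<and>
      enn2real (mass q (\<lambda>x. \<Phi> f x - \<Phi> g x)) \<le> C * enn2real (mass p (\<lambda>x. f x - g x)) powr s"
  shows "embeds_quasisymmetrically (Lp p) (Lp q)"
proof (rule embeds_quasisymmetrically_snowflake)
  let ?\<Psi> = "\<lambda>F. Lp_class q (\<Phi> (borel_rep F))"
  let ?a = "dist_exponent p" and ?b = "dist_exponent q"
  have ab: "?a > 0" "?b > 0" using p q dist_exponent_pos by auto
  show "?\<Psi> \<in> mspace (Lp p) \<rightarrow> mspace (Lp q)"
  proof
    fix F assume "F \<in> mspace (Lp p)"
    from borel_rep(2,3)[OF p this] have "\<Phi> (borel_rep F) \<in> borel_measurable borel \<and>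
      mass q (\<Phi> (borel_rep F)) < \<infinity>" by (rule meas)
    then show "?\<Psi> F \<in> mspace (Lp q)" using Lp_class(1)[OF q] by blast
  qed
  show "c powr ?b > 0" "C powr ?b > 0" "s * ?b / ?a > 0" using c C s ab by auto
  fix F G assume FG: "F \<in> mspace (Lp p)" "G \<in> mspace (Lp p)"
  note F = borel_rep[OF p FG(1)] and G = borel_rep[OF p FG(2)]
  define R where "R = enn2real (mass p (\<lambda>x. borel_rep F x - borel_rep G x))"
  define S where "S = enn2real (mass q (\<lambda>x. \<Phi> (borel_rep F) x - \<Phi> (borel_rep G) x))"
  have RS: "c * R powr s \<le> S" "S \<le> C * R powr s" "R \<ge> 0" "S \<ge> 0"
    using bd[OF F(2,3) G(2,3)] by (auto simp: R_def S_def)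
  have R: "(R powr ?a) powr (s * ?b / ?a) = (R powr s) powr ?b"
    using ab by (simp add: powr_powr)
  have "(c * R powr s) powr ?b \<le> S powr ?b" "S powr ?b \<le> (C * R powr s) powr ?b"
    using RS c ab by (auto intro!: powr_mono2)
  moreover have "mdist (Lp p) F G = R powr ?a" unfolding R_def by (rule mdist_borel_rep[OF p FG])
  moreover have "mdist (Lp q) (?\<Psi> F) (?\<Psi> G) = S powr ?b"
    unfolding S_def using meas[OF F(2,3)] meas[OF G(2,3)]
    by (intro mdist_Lp_class_borel[OF q]) blast+
  ultimately show "c powr ?b * mdist (Lp p) F G powr (s * ?b / ?a)
      \<le> mdist (Lp q) (?\<Psi> F) (?\<Psi> G) \<and>
    mdist (Lp q) (?\<Psi> F) (?\<Psi> G) \<le> C powr ?b * mdist (Lp p) F G powr (s * ?b / ?a)"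
    by (simp add: R powr_mult)
qed

section \<open>Affine pieces of the unit interval\<close>

lemma nn_integral_unit_affine:
  fixes h :: "real \<Rightarrow> ennreal"
  assumes [measurable]: "h \<in> borel_measurable borel" and c: "c > 0"
  shows "(\<integral>\<^sup>+x. h x * indicator {t..t + c} x \<partial>lborel)
    = ennreal c * (\<integral>\<^sup>+y. h (t + c * y) \<partial>unit_measure)"
proof -
  have "(\<integral>\<^sup>+x. h x * indicator {t..t + c} x \<partial>lborel)
      = ennreal \<bar>c\<bar> * (\<integral>\<^sup>+y. h (t + c * y) * indicator {t..t + c} (t + c * y) \<partial>lborel)"
    using c by (intro nn_integral_real_affine) auto
  also have "(\<lambda>y. indicator {t..t + c} (t + c * y) :: ennreal) = indicator {0..1}"
    using c by (auto simp: indicator_def fun_eq_iff zero_le_mult_iff)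
  finally show ?thesis using c by (simp add: nn_integral_unit_measure fun_eq_iff)
qed

lemma nn_integral_unit_halves:
  fixes h :: "real \<Rightarrow> ennreal"
  assumes [measurable]: "h \<in> borel_measurable borel"
  shows "(\<integral>\<^sup>+x. h x \<partial>unit_measure)
    = ennreal (1/2) * ((\<integral>\<^sup>+y. h (y / 2) \<partial>unit_measure) + (\<integral>\<^sup>+y. h ((y + 1) / 2) \<partial>unit_measure))"
proof -
  have "(\<integral>\<^sup>+x. h x \<partial>unit_measure) = (\<integral>\<^sup>+x. h x * indicator {0..0+1/2} x + h x * indicator {1/2..1/2+1/2} x \<partial>lborel)"
    unfolding nn_integral_unit_measure
    by (intro nn_integral_cong_AE, use AE_lborel_singleton[of "1/2"] in eventually_elim)
      (auto simp: indicator_def)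
  also have "\<dots> = (\<integral>\<^sup>+x. h x * indicator {0..0+1/2} x \<partial>lborel) + (\<integral>\<^sup>+x. h x * indicator {1/2..1/2+1/2} x \<partial>lborel)"
    by (intro nn_integral_add) auto
  also have "\<dots> = ennreal (1/2) * (\<integral>\<^sup>+y. h (0 + 1/2 * y) \<partial>unit_measure) + ennreal (1/2) * (\<integral>\<^sup>+y. h (1/2 + 1/2 * y) \<partial>unit_measure)"
    by (subst (1 2) nn_integral_unit_affine) auto
  finally show ?thesis
    by (simp add: distrib_left add_divide_distrib add.commute)
qed

section \<open>A snowflake of the real line in \<open>\<ell>_q\<close>\<close>

lemma real_le_2_abs_int_decode: "real k \<le> 2 * \<bar>real_of_int (int_decode k)\<bar>"
proof -
  have "int (int_encode i) \<le> 2 * \<bar>i\<bar>" for i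
    by (auto simp: int_encode_def sum_encode_def)
  from this[of "int_decode k"] have "int k \<le> 2 * \<bar>int_decode k\<bar>" by simp
  then show ?thesis by linarith
qed

text \<open>
  The weight \<open>2\<^sup>-\<^sup>p\<^sup>n\<close> times the \<open>q\<close>-th power of a bound for
  the oscillation, over a distance \<open>w\<close>, of a cosine or sine of frequency
  \<open>2\<^sup>n\<close>.
\<close>

definition dyadic_term :: "real \<Rightarrow> real \<Rightarrow> real \<Rightarrow> int \<Rightarrow> real" where
  "dyadic_term p q w n = 2 powr (- p * n) * min 2 (2 powr n * w) powr q"

lemma dyadic_term_nonneg: "0 \<le> dyadic_term p q w n"
  by (simp add: dyadic_term_def)

text \<open>
  The sum over all integers \<open>n\<close> of these terms is, as a function of \<open>w\<close>,
  multiplied by \<open>2\<^sup>p\<close> when \<open>w\<close> is doubled, because doubling shifts the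
  index. So it is at most \<open>C w\<^sup>p\<close> as soon as it is finite at \<open>w = 1\<close>;
  there the conditions \<open>p > 0\<close> and \<open>p < q\<close> give geometric decay in both
  directions.
\<close>

lemma dyadic_sum_le:
  assumes p: "0 < p" "p < q"
  obtains C where "C > 0"
    "\<And>w. w \<ge> 0 \<Longrightarrow> (\<Sum>k. ennreal (dyadic_term p q w (int_decode k))) \<le> ennreal (C * w powr p)"
proof -
  define S where "S w = (\<integral>\<^sup>+n. ennreal (dyadic_term p q w n) \<partial>count_space UNIV)" for w
  have S: "(\<Sum>k. ennreal (dyadic_term p q w (int_decode k))) = S w" for w
    unfolding S_def
    using nn_integral_bij_count_space[OF bij_int_decode, of "\<lambda>n. ennreal (dyadic_term p q w n)"]
    by (simp add: nn_integral_count_space_nat)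
  define m where "m = min p (q - p)"
  have m: "m > 0" "m \<le> p" "m \<le> q - p" using p by (auto simp: m_def)
  define r where "r = 2 powr (- m / 2)"
  have r: "0 < r" "r < 1" using m powr_less_mono[of "- m / 2" 0 2] by (auto simp: r_def)
  \<comment> \<open>decay at the rate \<open>p\<close> for high frequencies and \<open>q - p\<close> for low ones\<close>
  have t1: "dyadic_term p q 1 n \<le> 2 powr q * 2 powr (- m * \<bar>real_of_int n\<bar>)" for n
  proof (cases "n \<ge> 0")
    case True
    have "2 powr (- p * n) \<le> 2 powr (- m * \<bar>real_of_int n\<bar>)"
      using True m by (intro powr_mono) (auto simp: mult_right_mono)
    moreover have "min 2 (2 powr real_of_int n * 1) powr q \<le> 2 powr q"
      using p by (intro powr_mono2) auto
    ultimately show ?thesis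
      unfolding dyadic_term_def by (subst (2) mult.commute) (intro mult_mono, auto)
  next
    case False
    have "min 2 (2 powr real_of_int n * 1) powr q \<le> (2 powr n) powr q"
      using p by (intro powr_mono2) auto
    then have "dyadic_term p q 1 n \<le> 2 powr (- p * n) * (2 powr n) powr q"
      unfolding dyadic_term_def by (intro mult_left_mono) auto
    also have "\<dots> = 2 powr ((q - p) * n)"
      by (simp add: powr_powr powr_add[symmetric] algebra_simps)
    also have "\<dots> \<le> 2 powr (- m * \<bar>real_of_int n\<bar>)"
      using False m by (intro powr_mono) (auto simp: mult_right_mono_neg)
    also have "\<dots> \<le> 2 powr q * 2 powr (- m * \<bar>real_of_int n\<bar>)"
      using p ge_one_powr_ge_zero[of 2 q] by simp
    finally show ?thesis .
  qed
  have t2: "dyadic_term p q 1 (int_decode k) \<le> 2 powr q * r ^ k" for k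
  proof -
    have "2 powr (- m * \<bar>real_of_int (int_decode k)\<bar>) \<le> 2 powr ((- m / 2) * real k)"
      using real_le_2_abs_int_decode[of k] m by (intro powr_mono) (auto simp: field_simps)
    also have "\<dots> = r ^ k"
      using powr_realpow[OF r(1), of k] by (subst powr_powr[symmetric]) (simp add: r_def)
    finally show ?thesis
      using t1[of "int_decode k"] by (meson mult_left_mono order_trans powr_ge_zero)
  qed
  define K where "K = 2 powr q * (1 / (1 - r))"
  have K: "K > 0" using r by (simp add: K_def)
  have "(\<lambda>k. 2 powr q * r ^ k) sums K"
    unfolding K_def using r by (intro sums_mult geometric_sums) auto
  then have "(\<Sum>k. ennreal (2 powr q * r ^ k)) = ennreal K"
    using r by (intro suminf_ennreal_eq) auto
  then have S1: "S 1 \<le> ennreal K"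
    unfolding S[symmetric] using t2 by (metis (no_types, lifting) ennreal_leI suminf_le summableI)
  \<comment> \<open>shift of the summation index\<close>
  have Spow: "S (2 powr N) = ennreal (2 powr (p * N)) * S 1" for N :: int
  proof -
    have "dyadic_term p q (2 powr N) n = 2 powr (p * N) * dyadic_term p q 1 (n + N)" for n
      by (simp add: dyadic_term_def powr_add[symmetric] algebra_simps)
    then have "S (2 powr N)
        = ennreal (2 powr (p * N)) * (\<integral>\<^sup>+n. ennreal (dyadic_term p q 1 (n + N)) \<partial>count_space UNIV)"
      unfolding S_def
      by (simp add: ennreal_mult nn_integral_cmult dyadic_term_nonneg)
    also have "(\<integral>\<^sup>+n. ennreal (dyadic_term p q 1 (n + N)) \<partial>count_space UNIV) = S 1"
      unfolding S_def
      by (rule nn_integral_bij_count_space) (rule bij_betw_byWitness[of _ "\<lambda>n. n - N"], auto)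
    finally show ?thesis .
  qed
  show ?thesis
  proof (rule that)
    show "2 powr p * K > 0" using K by simp
    fix w :: real assume "w \<ge> 0"
    show "(\<Sum>k. ennreal (dyadic_term p q w (int_decode k))) \<le> ennreal (2 powr p * K * w powr p)"
    proof (cases "w = 0")
      case True then show ?thesis by (simp add: dyadic_term_def)
    next
      case False
      then have w: "w > 0" using \<open>w \<ge> 0\<close> by simp
      define N where "N = \<lceil>log 2 w\<rceil>"
      have lw: "2 powr (log 2 w) = w" using w by simp
      have "2 powr (log 2 w) \<le> 2 powr N" unfolding N_def by (intro powr_mono) auto
      then have N1: "w \<le> 2 powr N" using lw by simp
      have "2 powr (N - 1) \<le> 2 powr (log 2 w)"
        unfolding N_def by (rule powr_mono, (simp; linarith), simp)
      then have N2: "2 powr N \<le> 2 * w" using lw by (simp add: powr_diff)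
      have "dyadic_term p q w n \<le> dyadic_term p q (2 powr N) n" for n
        unfolding dyadic_term_def using w N1 p
        by (intro mult_left_mono powr_mono2 min.mono) auto
      then have "S w \<le> S (2 powr N)"
        unfolding S_def by (intro nn_integral_mono ennreal_leI) auto
      also have "\<dots> \<le> ennreal (2 powr (p * N)) * ennreal K"
        unfolding Spow by (intro mult_left_mono S1) auto
      also have "\<dots> = ennreal (2 powr (p * N) * K)" using K by (simp add: ennreal_mult)
      also have "2 powr (p * N) = (2 powr N) powr p" by (simp add: powr_powr mult.commute)
      also have "\<dots> * K \<le> (2 * w) powr p * K"
        using N2 p K by (intro mult_right_mono powr_mono2) auto
      finally show ?thesis
        unfolding S by (simp add: powr_mult ennreal_leI algebra_simps)
    qed
  qed
qed

text \<open>
  The coordinates of the snowflake embedding of the line: cosine and sine at the frequencies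
  \<open>2\<^sup>n\<close>. The constant 1 is subtracted so that 0 is mapped to 0.
\<close>

definition cos_wave :: "real \<Rightarrow> real \<Rightarrow> int \<Rightarrow> real \<Rightarrow> real" where
  "cos_wave p q n u = 2 powr (- p * n / q) * (cos (2 powr n * u) - 1)"

definition sin_wave :: "real \<Rightarrow> real \<Rightarrow> int \<Rightarrow> real \<Rightarrow> real" where
  "sin_wave p q n u = 2 powr (- p * n / q) * sin (2 powr n * u)"

text \<open>
  The contribution of the frequency \<open>2\<^sup>n\<close> to the \<open>q\<close>-th power of the
  \<open>\<ell>_q\<close>-distance between the images of \<open>u\<close> and \<open>v\<close>.
\<close>

definition wave_gap :: "real \<Rightarrow> real \<Rightarrow> real \<Rightarrow> real \<Rightarrow> int \<Rightarrow> real" where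
  "wave_gap p q u v n = \<bar>cos_wave p q n u - cos_wave p q n v\<bar> powr q
     + \<bar>sin_wave p q n u - sin_wave p q n v\<bar> powr q"

lemma abs_cos_diff_le: "\<bar>cos a - cos b\<bar> \<le> \<bar>a - b\<bar>" for a b :: real
proof -
  have "\<bar>cos a - cos b\<bar> = 2 * \<bar>sin ((a + b) / 2)\<bar> * \<bar>sin ((b - a) / 2)\<bar>"
    by (simp add: cos_diff_cos abs_mult)
  also have "\<dots> \<le> 2 * 1 * \<bar>(b - a) / 2\<bar>"
    by (intro mult_mono abs_sin_x_le_abs_x) auto
  finally show ?thesis by simp
qed

lemma abs_sin_diff_le: "\<bar>sin a - sin b\<bar> \<le> \<bar>a - b\<bar>" for a b :: real
  using abs_cos_diff_le[of "pi / 2 - a" "pi / 2 - b"] by (simp add: cos_diff)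

lemma wave_gap_eq:
  assumes "q > 0"
  shows "wave_gap p q u v n = 2 powr (- p * n) *
    (\<bar>cos (2 powr n * u) - cos (2 powr n * v)\<bar> powr q
      + \<bar>sin (2 powr n * u) - sin (2 powr n * v)\<bar> powr q)"
proof -
  have *: "\<bar>2 powr (- p * n / q) * a - 2 powr (- p * n / q) * b\<bar> powr q
      = 2 powr (- p * n) * \<bar>a - b\<bar> powr q" for a b
  proof -
    have "\<bar>2 powr (- p * n / q) * a - 2 powr (- p * n / q) * b\<bar> = 2 powr (- p * n / q) * \<bar>a - b\<bar>"
      by (simp add: right_diff_distrib[symmetric] abs_mult)
    then show ?thesis using assms by (simp add: powr_mult powr_powr)
  qed
  show ?thesis
    unfolding wave_gap_def cos_wave_def sin_wave_def * by (simp add: distrib_left)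
qed

text \<open>
  The image of the line with the metric \<open>\<bar>u - v\<bar>\<^sup>p\<^sup>/\<^sup>q\<close> under
  this map is bi-Lipschitz in \<open>\<ell>_q\<close>. For the lower bound a single frequency suffices,
  the one with \<open>1 \<le> 2\<^sup>n \<bar>u - v\<bar> \<le> 2\<close>: the two points of the circle
  then have angular distance in \<open>[1, 2]\<close>.
\<close>

lemma wave_gap_sum_bounds:
  assumes p: "0 < p" "p < q"
  obtains c C where "c > 0" "C > 0"
    "\<And>u v. ennreal (c * \<bar>u - v\<bar> powr p) \<le> (\<Sum>k. ennreal (wave_gap p q u v (int_decode k)))"
    "\<And>u v. (\<Sum>k. ennreal (wave_gap p q u v (int_decode k))) \<le> ennreal (C * \<bar>u - v\<bar> powr p)"
proof -
  have q: "q > 0" using p by simp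
  obtain C where C: "C > 0" and Cs: "\<And>w. w \<ge> 0 \<Longrightarrow>
      (\<Sum>k. ennreal (dyadic_term p q w (int_decode k))) \<le> ennreal (C * w powr p)"
    using dyadic_sum_le[OF p] by blast
  define d where "d = sqrt (1 - cos 1)"
  have "cos (1::real) < cos 0" using pi_gt3 by (intro cos_monotone_0_pi) auto
  then have d: "d > 0" "d\<^sup>2 = 1 - cos 1" by (auto simp: d_def)
  have up: "wave_gap p q u v n \<le> 2 * dyadic_term p q \<bar>u - v\<bar> n" for u v n
  proof -
    let ?a = "2 powr n * u" and ?b = "2 powr n * v"
    have ab: "\<bar>?a - ?b\<bar> = 2 powr n * \<bar>u - v\<bar>"
      by (simp add: right_diff_distrib[symmetric] abs_mult)
    have "\<bar>cos ?a - cos ?b\<bar> \<le> 2" "\<bar>sin ?a - sin ?b\<bar> \<le> 2"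
      using abs_cos_le_one[of ?a] abs_cos_le_one[of ?b] abs_sin_le_one[of ?a] abs_sin_le_one[of ?b]
      by linarith+
    then have "\<bar>cos ?a - cos ?b\<bar> powr q \<le> min 2 (2 powr n * \<bar>u - v\<bar>) powr q"
      "\<bar>sin ?a - sin ?b\<bar> powr q \<le> min 2 (2 powr n * \<bar>u - v\<bar>) powr q"
      using abs_cos_diff_le[of ?a ?b] abs_sin_diff_le[of ?a ?b] q ab by (auto intro!: powr_mono2)
    then have "\<bar>cos ?a - cos ?b\<bar> powr q + \<bar>sin ?a - sin ?b\<bar> powr q
        \<le> 2 * min 2 (2 powr n * \<bar>u - v\<bar>) powr q" by linarith
    then show ?thesis
      unfolding wave_gap_eq[OF q] dyadic_term_def
      by (metis mult.left_commute mult_left_mono powr_ge_zero)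
  qed
  have low: "\<exists>n. (d powr q * 2 powr (- p)) * \<bar>u - v\<bar> powr p \<le> wave_gap p q u v n" if "u \<noteq> v" for u v
  proof -
    define w where "w = \<bar>u - v\<bar>"
    have w: "w > 0" using that by (simp add: w_def)
    define n where "n = - \<lfloor>log 2 w\<rfloor>"
    have lw: "2 powr (log 2 w) = w" using w by simp
    have n1: "1 \<le> 2 powr n * w" 
    proof -
      have "2 powr 0 \<le> 2 powr (n + log 2 w)" unfolding n_def by (rule powr_mono, (simp; linarith), simp)
      then show ?thesis using lw by (simp add: powr_add)
    qed
    have n2: "2 powr n * w \<le> 2"
    proof -
      have "2 powr (n + log 2 w) \<le> 2 powr 1" unfolding n_def by (rule powr_mono, (simp; linarith), simp)
      then show ?thesis using lw by (simp add: powr_add)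
    qed
    let ?a = "2 powr n * u" and ?b = "2 powr n * v"
    have ab: "\<bar>?a - ?b\<bar> = 2 powr n * w"
      by (simp add: right_diff_distrib[symmetric] abs_mult w_def)
    have "cos \<bar>?a - ?b\<bar> \<le> cos 1"
      unfolding ab using n1 n2 pi_gt3 by (intro cos_monotone_0_pi_le) auto
    then have "2 * d\<^sup>2 \<le> 2 - 2 * cos (?a - ?b)" by (simp add: d(2))
    also have "\<dots> = (cos ?a - cos ?b)\<^sup>2 + (sin ?a - sin ?b)\<^sup>2"
      using sin_cos_squared_add[of ?a] sin_cos_squared_add[of ?b]
      unfolding cos_diff power2_diff by (simp add: algebra_simps)
    finally have "d\<^sup>2 \<le> \<bar>cos ?a - cos ?b\<bar>\<^sup>2 \<or> d\<^sup>2 \<le> \<bar>sin ?a - sin ?b\<bar>\<^sup>2" by auto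
    then have "d \<le> \<bar>cos ?a - cos ?b\<bar> \<or> d \<le> \<bar>sin ?a - sin ?b\<bar>"
      by (elim disj_forward power2_le_imp_le) simp_all
    then have "d powr q \<le> \<bar>cos ?a - cos ?b\<bar> powr q \<or> d powr q \<le> \<bar>sin ?a - sin ?b\<bar> powr q"
      using d q by (elim disj_forward; intro powr_mono2) simp_all
    then have "d powr q \<le> \<bar>cos ?a - cos ?b\<bar> powr q + \<bar>sin ?a - sin ?b\<bar> powr q"
      using powr_ge_zero[of "\<bar>cos ?a - cos ?b\<bar>" q] powr_ge_zero[of "\<bar>sin ?a - sin ?b\<bar>" q]
      by linarith
    then have "2 powr (- p * n) * d powr q \<le> wave_gap p q u v n"
      unfolding wave_gap_eq[OF q] by (intro mult_left_mono) auto
    moreover have "2 powr (- p) * w powr p \<le> 2 powr (- p * n)"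
    proof -
      have "w \<le> 2 powr (1 - n)" using n2 by (simp add: powr_diff field_simps)
      then have "w powr p \<le> (2 powr (1 - n)) powr p" using w p by (intro powr_mono2) auto
      then have "2 powr (- p) * w powr p \<le> 2 powr (- p) * (2 powr (1 - n)) powr p"
        by (intro mult_left_mono) auto
      also have "\<dots> = 2 powr (- p * n)"
        by (simp add: powr_powr powr_add[symmetric] algebra_simps)
      finally show ?thesis .
    qed
    then have "d powr q * (2 powr (- p) * w powr p) \<le> d powr q * 2 powr (- p * n)"
      by (intro mult_left_mono) auto
    ultimately have "d powr q * (2 powr (- p) * w powr p) \<le> wave_gap p q u v n"
      by (simp add: mult.commute)
    then show ?thesis by (auto simp: w_def mult.assoc)
  qed
  show ?thesis
  proof (rule that)
    show "d powr q * 2 powr (- p) > 0" "2 * C > 0" using d C by auto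
    fix u v
    show "ennreal (d powr q * 2 powr (- p) * \<bar>u - v\<bar> powr p)
      \<le> (\<Sum>k. ennreal (wave_gap p q u v (int_decode k)))"
    proof (cases "u = v")
      case False
      then obtain n where n: "(d powr q * 2 powr (- p)) * \<bar>u - v\<bar> powr p \<le> wave_gap p q u v n"
        using low by blast
      obtain k where k: "n = int_decode k" using surj_int_decode by auto
      have "ennreal (wave_gap p q u v n) \<le> (\<Sum>k. ennreal (wave_gap p q u v (int_decode k)))"
        unfolding k
        using sum_le_suminf[of "\<lambda>k. ennreal (wave_gap p q u v (int_decode k))" "{k}"] by simp
      with n show ?thesis by (meson ennreal_leI order_trans)
    qed simp
    have "(\<Sum>k. ennreal (wave_gap p q u v (int_decode k)))
        \<le> (\<Sum>k. ennreal 2 * ennreal (dyadic_term p q \<bar>u - v\<bar> (int_decode k)))"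
    proof (intro suminf_le summableI)
      show "ennreal (wave_gap p q u v (int_decode k))
          \<le> ennreal 2 * ennreal (dyadic_term p q \<bar>u - v\<bar> (int_decode k))" for k
        by (subst ennreal_mult'[symmetric]) (auto intro!: ennreal_leI up)
    qed
    also have "\<dots> = ennreal 2 * (\<Sum>k. ennreal (dyadic_term p q \<bar>u - v\<bar> (int_decode k)))"
      by (rule ennreal_suminf_cmult)
    also have "\<dots> \<le> ennreal 2 * ennreal (C * \<bar>u - v\<bar> powr p)"
      by (intro mult_left_mono Cs) auto
    also have "\<dots> = ennreal (2 * C * \<bar>u - v\<bar> powr p)"
      using C by (subst ennreal_mult'[symmetric]) (auto simp: mult.assoc)
    finally show "(\<Sum>k. ennreal (wave_gap p q u v (int_decode k))) \<le> ennreal (2 * C * \<bar>u - v\<bar> powr p)" .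
  qed
qed

section \<open>Sequences of functions as one function on the unit interval\<close>

text \<open>
  Two functions on the unit interval, rescaled to its two halves.
\<close>

definition join :: "(real \<Rightarrow> real) \<Rightarrow> (real \<Rightarrow> real) \<Rightarrow> real \<Rightarrow> real" where
  "join f g x = (if x < 1/2 then f (2 * x) else g (2 * x - 1))"

lemma join_measurable [measurable (raw)]:
  assumes [measurable]: "f \<in> borel_measurable borel" "g \<in> borel_measurable borel"
  shows "join f g \<in> borel_measurable borel"
  unfolding join_def by measurable

lemma mass_join_diff:
  assumes [measurable]: "f \<in> borel_measurable borel" "g \<in> borel_measurable borel"
    "f' \<in> borel_measurable borel" "g' \<in> borel_measurable borel"
  shows "mass q (\<lambda>x. join f g x - join f' g' x)
    = ennreal (1/2) * (mass q (\<lambda>x. f x - f' x) + mass q (\<lambda>x. g x - g' x))"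
proof -
  let ?h = "\<lambda>x. ennreal (\<bar>join f g x - join f' g' x\<bar> powr q)"
  have "(\<integral>\<^sup>+y. ?h (y / 2) \<partial>unit_measure) = mass q (\<lambda>x. f x - f' x)"
    unfolding mass_def using AE_unit_measure
    by (intro nn_integral_cong_AE, eventually_elim) (auto simp: join_def)
  moreover have "(\<integral>\<^sup>+y. ?h ((y + 1) / 2) \<partial>unit_measure) = mass q (\<lambda>x. g x - g' x)"
    unfolding mass_def using AE_unit_measure
    by (intro nn_integral_cong_AE, eventually_elim) (auto simp: join_def field_simps)
  ultimately show ?thesis
    unfolding mass_def[of q "\<lambda>x. join f g x - join f' g' x"] by (subst nn_integral_unit_halves) auto
qed

text \<open>
  The index \<open>k\<close> of the piece \<open>(2\<^sup>-\<^sup>k\<^sup>-\<^sup>1,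
  2\<^sup>-\<^sup>k]\<close> of \<open>(0, 1]\<close> that contains the point.
\<close>

definition block :: "real \<Rightarrow> nat" where
  "block x = nat \<lfloor>- log 2 x\<rfloor>"

lemma block_eq:
  assumes "2 powr (- real (Suc k)) < x" "x \<le> 2 powr (- real k)"
  shows "block x = k"
proof -
  have x: "0 < x" using assms(1) by (rule le_less_trans[rotated]) simp
  have "- real (Suc k) < log 2 x" "log 2 x \<le> - real k"
    using assms x by (simp_all add: less_log_iff log_le_iff del: of_nat_Suc)
  then have "\<lfloor>- log 2 x\<rfloor> = int k" by (intro floor_unique) auto
  then show ?thesis by (simp add: block_def)
qed

lemma block_interval:
  assumes "0 < x" "x \<le> 1"
  shows "2 powr (- real (Suc (block x))) < x" "x \<le> 2 powr (- real (block x))"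
proof -
  have "0 \<le> - log 2 x" using assms by (simp add: log_le_zero_cancel_iff)
  then have b: "real (block x) \<le> - log 2 x" "- log 2 x < real (block x) + 1"
    unfolding block_def by linarith+
  show "2 powr (- real (Suc (block x))) < x" 
    using b assms by (subst less_log_iff[symmetric]) auto
  show "x \<le> 2 powr (- real (block x))"
    using b assms by (subst log_le_iff[symmetric]) auto
qed

text \<open>
  A sequence of functions, the \<open>k\<close>-th rescaled to the \<open>k\<close>-th piece. The factor
  compensates the length \<open>2\<^sup>-\<^sup>k\<^sup>-\<^sup>1\<close> of the piece, so that
  \<open>q\<close>-th powers of \<open>L_q\<close>-norms add up.
\<close>

definition glue :: "real \<Rightarrow> (nat \<Rightarrow> real \<Rightarrow> real) \<Rightarrow> real \<Rightarrow> real" where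
  "glue q h x = 2 powr (real (Suc (block x)) / q) * h (block x) (2 ^ Suc (block x) * x - 1)"

lemma block_measurable [measurable]: "block \<in> measurable borel (count_space UNIV)"
  unfolding block_def by measurable

lemma glue_measurable [measurable (raw)]:
  assumes [measurable]: "\<And>k. h k \<in> borel_measurable borel"
  shows "glue q h \<in> borel_measurable borel"
proof -
  have "(\<lambda>x. (\<lambda>k x. 2 powr (real (Suc k) / q) * h k (2 ^ Suc k * x - 1)) (block x) x)
      \<in> borel_measurable borel"
    by (rule measurable_compose_countable) measurable
  then show ?thesis by (simp add: glue_def[abs_def])
qed

lemma mass_glue_diff:
  assumes q: "q > 0"
    and [measurable]: "\<And>k. h k \<in> borel_measurable borel" "\<And>k. h' k \<in> borel_measurable borel"
  shows "mass q (\<lambda>x. glue q h x - glue q h' x) = (\<Sum>k. mass q (\<lambda>x. h k x - h' k x))"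
proof -
  define G where "G x = ennreal (\<bar>glue q h x - glue q h' x\<bar> powr q)" for x
  have G [measurable]: "G \<in> borel_measurable borel" unfolding G_def by measurable
  define P where "P k = {2 powr (- real (Suc k))<..2 powr (- real k)}" for k :: nat
  have disj: "disjoint_family P"
  proof -
    have "block x = k" if "x \<in> P k" for x k
      using that block_eq unfolding P_def by (metis greaterThanAtMost_iff)
    then show ?thesis unfolding disjoint_family_on_def by blast
  qed
  have un: "(\<Union>k. P k) = {0<..1}"
  proof (intro equalityI subsetI)
    fix x assume "x \<in> (\<Union>k. P k)"
    then obtain k where k: "2 powr (- real (Suc k)) < x" "x \<le> 2 powr (- real k)"
      by (auto simp: P_def)
    have "2 powr (- real k) \<le> 2 powr (0::real)" by (intro powr_mono) auto
    moreover have "0 < x" using k(1) by (rule le_less_trans[rotated]) simp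
    ultimately show "x \<in> {0<..1}" using k by auto
  next
    fix x :: real assume "x \<in> {0<..1}"
    then show "x \<in> (\<Union>k. P k)" using block_interval[of x] by (auto simp: P_def)
  qed
  have piece: "(\<integral>\<^sup>+x\<in>P k. G x \<partial>lborel) = mass q (\<lambda>x. h k x - h' k x)" for k
  proof -
    define c where "c = 2 powr (- real (Suc k))"
    have c: "c > 0" "c + c = 2 powr (- real k)" "2 ^ Suc k * c = 1"
      by (simp_all add: c_def powr_minus powr_realpow field_simps del: of_nat_Suc)
    have "(\<integral>\<^sup>+x\<in>P k. G x \<partial>lborel) = (\<integral>\<^sup>+x\<in>{c..c+c}. G x \<partial>lborel)"
      unfolding P_def c_def[symmetric] c(2)[symmetric]
      by (intro nn_integral_cong_AE, use AE_lborel_singleton[of c] in eventually_elim)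
        (auto simp: indicator_def)
    also have "\<dots> = ennreal c * (\<integral>\<^sup>+y. G (c + c * y) \<partial>unit_measure)"
      using c by (intro nn_integral_unit_affine) auto
    also have "(\<integral>\<^sup>+y. G (c + c * y) \<partial>unit_measure)
        = (\<integral>\<^sup>+y. ennreal (1 / c) * ennreal (\<bar>h k y - h' k y\<bar> powr q) \<partial>unit_measure)"
    proof (rule nn_integral_cong_AE)
      show "AE y in unit_measure.
          G (c + c * y) = ennreal (1 / c) * ennreal (\<bar>h k y - h' k y\<bar> powr q)"
        using AE_unit_measure
      proof eventually_elim
        case (elim y)
        have "c * y \<le> c * 1" "0 < c * y" using elim c by (auto intro!: mult_left_mono)
        then have b: "block (c + c * y) = k"
          by (intro block_eq) (unfold c_def[symmetric] c(2)[symmetric], simp_all)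
        have e: "2 ^ Suc k * (c + c * y) - 1 = y"
          using c(3) by (simp add: distrib_left mult.assoc[symmetric] del: power_Suc)
        have "\<bar>2 powr (real (Suc k) / q) * a - 2 powr (real (Suc k) / q) * b\<bar> powr q
            = 1 / c * \<bar>a - b\<bar> powr q" for a b
          using q by (simp add: right_diff_distrib[symmetric] abs_mult powr_mult powr_powr c_def
              powr_minus inverse_eq_divide del: of_nat_Suc)
        then show ?case
          unfolding G_def glue_def b e using c by (subst ennreal_mult[symmetric]) auto
      qed
    qed
    also have "\<dots> = ennreal (1 / c) * mass q (\<lambda>x. h k x - h' k x)"
      unfolding mass_def by (intro nn_integral_cmult) measurable
    also have "ennreal c * \<dots> = mass q (\<lambda>x. h k x - h' k x)"
      using c by (simp add: mult.assoc[symmetric] ennreal_mult[symmetric])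
    finally show ?thesis .
  qed
  have "mass q (\<lambda>x. glue q h x - glue q h' x) = (\<integral>\<^sup>+x\<in>(\<Union>k. P k). G x \<partial>lborel)"
    unfolding mass_def nn_integral_unit_measure un G_def
    by (intro nn_integral_cong_AE, use AE_lborel_singleton[of "0::real"] in eventually_elim)
      (auto simp: indicator_def)
  also have "\<dots> = (\<Sum>k. \<integral>\<^sup>+x\<in>P k. G x \<partial>lborel)"
  proof (rule nn_integral_disjoint_family[OF _ _ disj])
    show "P k \<in> sets lborel" for k by (simp add: P_def)
  qed simp
  finally show ?thesis by (simp add: piece)
qed

text \<open>
  The snowflake embedding of the line is applied to each value of a function, and its coordinates are
  laid out along the unit interval.
\<close>

theorem Lp_embeds_Lq_of_less:
  assumes p: "0 < p" "p < q"
  shows "embeds_quasisymmetrically (Lp p) (Lp q)"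
proof -
  have q: "q > 0" using p by simp
  obtain c C where c: "c > 0" and C: "C > 0"
    and lo: "\<And>u v. ennreal (c * \<bar>u - v\<bar> powr p) \<le> (\<Sum>k. ennreal (wave_gap p q u v (int_decode k)))"
    and hi: "\<And>u v. (\<Sum>k. ennreal (wave_gap p q u v (int_decode k))) \<le> ennreal (C * \<bar>u - v\<bar> powr p)"
    using wave_gap_sum_bounds[OF p] by blast
  define H where "H f k = join (\<lambda>x. cos_wave p q (int_decode k) (f x))
    (\<lambda>x. sin_wave p q (int_decode k) (f x))" for f :: "real \<Rightarrow> real" and k
  define \<Phi> where "\<Phi> f = glue q (H f)" for f
  have cm [measurable]: "cos_wave p q n \<in> borel_measurable borel" "sin_wave p q n \<in> borel_measurable borel" for n
    unfolding cos_wave_def sin_wave_def by measurable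
  have [measurable]: "H f k \<in> borel_measurable borel" if [measurable]: "f \<in> borel_measurable borel" for f k
    unfolding H_def by measurable
  have \<Phi>m: "\<Phi> f \<in> borel_measurable borel" if [measurable]: "f \<in> borel_measurable borel" for f
    unfolding \<Phi>_def by measurable
  have eq: "mass q (\<lambda>x. \<Phi> f x - \<Phi> g x)
      = ennreal (1/2) * (\<integral>\<^sup>+x. (\<Sum>k. ennreal (wave_gap p q (f x) (g x) (int_decode k))) \<partial>unit_measure)"
    if [measurable]: "f \<in> borel_measurable borel" "g \<in> borel_measurable borel" for f g
  proof -
    have [measurable]: "(\<lambda>x. wave_gap p q (f x) (g x) n) \<in> borel_measurable borel" for n
      unfolding wave_gap_def by measurable
    have H: "mass q (\<lambda>x. H f k x - H g k x)
        = ennreal (1/2) * (\<integral>\<^sup>+x. ennreal (wave_gap p q (f x) (g x) (int_decode k)) \<partial>unit_measure)" for k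
      unfolding H_def
      by (subst mass_join_diff) (auto simp: mass_def wave_gap_def nn_integral_add)
    have "mass q (\<lambda>x. \<Phi> f x - \<Phi> g x) = (\<Sum>k. mass q (\<lambda>x. H f k x - H g k x))"
      unfolding \<Phi>_def by (rule mass_glue_diff[OF q]) measurable
    also have "\<dots> = ennreal (1/2) *
        (\<Sum>k. \<integral>\<^sup>+x. ennreal (wave_gap p q (f x) (g x) (int_decode k)) \<partial>unit_measure)"
      unfolding H by (rule ennreal_suminf_cmult)
    also have "(\<Sum>k. \<integral>\<^sup>+x. ennreal (wave_gap p q (f x) (g x) (int_decode k)) \<partial>unit_measure)
        = (\<integral>\<^sup>+x. (\<Sum>k. ennreal (wave_gap p q (f x) (g x) (int_decode k))) \<partial>unit_measure)"
      by (rule nn_integral_suminf[symmetric]) measurable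
    finally show ?thesis .
  qed
  have bounds: "ennreal (c / 2) * mass p (\<lambda>x. f x - g x) \<le> mass q (\<lambda>x. \<Phi> f x - \<Phi> g x)"
    "mass q (\<lambda>x. \<Phi> f x - \<Phi> g x) \<le> ennreal (C / 2) * mass p (\<lambda>x. f x - g x)"
    if [measurable]: "f \<in> borel_measurable borel" "g \<in> borel_measurable borel" for f g
  proof -
    have half: "ennreal (1/2) * (\<integral>\<^sup>+x. ennreal (a * \<bar>f x - g x\<bar> powr p) \<partial>unit_measure)
        = ennreal (a / 2) * mass p (\<lambda>x. f x - g x)" if "a > 0" for a
    proof -
      have "(\<integral>\<^sup>+x. ennreal (a * \<bar>f x - g x\<bar> powr p) \<partial>unit_measure)
          = ennreal a * mass p (\<lambda>x. f x - g x)"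
        unfolding mass_def using that by (subst nn_integral_cmult[symmetric]) (auto simp: ennreal_mult)
      moreover have "ennreal (a / 2) = ennreal (1/2) * ennreal a"
        using that by (subst ennreal_mult[symmetric]) auto
      ultimately show ?thesis by (simp only: mult.assoc)
    qed
    have "ennreal (c / 2) * mass p (\<lambda>x. f x - g x)
        = ennreal (1/2) * (\<integral>\<^sup>+x. ennreal (c * \<bar>f x - g x\<bar> powr p) \<partial>unit_measure)"
      using half[OF c] by simp
    also have "\<dots> \<le> mass q (\<lambda>x. \<Phi> f x - \<Phi> g x)"
      unfolding eq[OF that] by (intro mult_left_mono nn_integral_mono lo) auto
    finally show "ennreal (c / 2) * mass p (\<lambda>x. f x - g x) \<le> mass q (\<lambda>x. \<Phi> f x - \<Phi> g x)" .
    have "mass q (\<lambda>x. \<Phi> f x - \<Phi> g x)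
        \<le> ennreal (1/2) * (\<integral>\<^sup>+x. ennreal (C * \<bar>f x - g x\<bar> powr p) \<partial>unit_measure)"
      unfolding eq[OF that] by (intro mult_left_mono nn_integral_mono hi) auto
    also have "\<dots> = ennreal (C / 2) * mass p (\<lambda>x. f x - g x)"
      by (rule half[OF C])
    finally show "mass q (\<lambda>x. \<Phi> f x - \<Phi> g x) \<le> ennreal (C / 2) * mass p (\<lambda>x. f x - g x)" .
  qed
  have \<Phi>0: "\<Phi> (\<lambda>x. 0) = (\<lambda>x. 0)"
    by (simp add: \<Phi>_def H_def glue_def join_def cos_wave_def sin_wave_def fun_eq_iff)
  show ?thesis
  proof (rule Lp_embeds_criterion[OF p(1) q])
    show "c / 2 > 0" "C / 2 > 0" "(1::real) > 0" using c C by auto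
    fix f assume f: "f \<in> borel_measurable borel" "mass p f < \<infinity>"
    have "mass q (\<Phi> f) \<le> ennreal (C / 2) * mass p f"
      using bounds(2)[OF f(1), of "\<lambda>x. 0"] by (simp add: \<Phi>0)
    also have "\<dots> < \<infinity>" using f(2) by (simp add: ennreal_mult_less_top)
    finally show "\<Phi> f \<in> borel_measurable borel \<and> mass q (\<Phi> f) < \<infinity>" using \<Phi>m f(1) by simp
    fix g assume g: "g \<in> borel_measurable borel" "mass p g < \<infinity>"
    have fin: "mass p (\<lambda>x. f x - g x) < \<infinity>" by (rule mass_diff_finite[OF p(1) f g])
    then obtain r where r: "mass p (\<lambda>x. f x - g x) = ennreal r" "r \<ge> 0"
      by (cases "mass p (\<lambda>x. f x - g x)") auto
    have b: "ennreal (c / 2 * r) \<le> mass q (\<lambda>x. \<Phi> f x - \<Phi> g x)"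
      "mass q (\<lambda>x. \<Phi> f x - \<Phi> g x) \<le> ennreal (C / 2 * r)"
      using bounds[OF f(1) g(1)] r c C ennreal_mult[of "c / 2" r] ennreal_mult[of "C / 2" r]
      by simp_all
    obtain s where s: "mass q (\<lambda>x. \<Phi> f x - \<Phi> g x) = ennreal s" "s \<ge> 0"
      using b(2) by (cases "mass q (\<lambda>x. \<Phi> f x - \<Phi> g x)") (auto simp: top_unique)
    show "c / 2 * enn2real (mass p (\<lambda>x. f x - g x)) powr 1 \<le> enn2real (mass q (\<lambda>x. \<Phi> f x - \<Phi> g x)) \<and>
        enn2real (mass q (\<lambda>x. \<Phi> f x - \<Phi> g x)) \<le> C / 2 * enn2real (mass p (\<lambda>x. f x - g x)) powr 1"
      using b r s c C by (auto simp: ennreal_le_iff)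
  qed
qed

section \<open>Comparison of different powers\<close>

lemma mass_2: "mass 2 f = (\<integral>\<^sup>+x. ennreal ((f x)\<^sup>2) \<partial>unit_measure)"
  by (simp add: mass_def)

lemma mass_add_le:
  assumes q: "q > 0" and [measurable]: "f \<in> borel_measurable borel" "g \<in> borel_measurable borel"
  shows "mass q (\<lambda>x. f x + g x) \<le> ennreal (2 powr q) * (mass q f + mass q g)"
proof -
  have bd: "\<bar>a + b\<bar> powr q \<le> 2 powr q * (\<bar>a\<bar> powr q + \<bar>b\<bar> powr q)" for a b :: real
  proof -
    have "\<bar>a + b\<bar> powr q \<le> (2 * max \<bar>a\<bar> \<bar>b\<bar>) powr q"
      using q by (intro powr_mono2) auto
    also have "\<dots> = 2 powr q * max \<bar>a\<bar> \<bar>b\<bar> powr q" by (simp add: powr_mult)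
    also have "\<dots> \<le> 2 powr q * (\<bar>a\<bar> powr q + \<bar>b\<bar> powr q)"
      by (intro mult_left_mono) (auto simp: max_def)
    finally show ?thesis .
  qed
  have "mass q (\<lambda>x. f x + g x)
      \<le> (\<integral>\<^sup>+x. ennreal (2 powr q) * (ennreal (\<bar>f x\<bar> powr q) + ennreal (\<bar>g x\<bar> powr q)) \<partial>unit_measure)"
    unfolding mass_def
  proof (rule nn_integral_mono)
    fix x
    show "ennreal (\<bar>f x + g x\<bar> powr q)
        \<le> ennreal (2 powr q) * (ennreal (\<bar>f x\<bar> powr q) + ennreal (\<bar>g x\<bar> powr q))"
      using bd[of "f x" "g x"] by (simp add: ennreal_plus[symmetric] ennreal_mult[symmetric] ennreal_leI del: ennreal_plus)
  qed
  also have "\<dots> = ennreal (2 powr q) * (mass q f + mass q g)"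
    unfolding mass_def by (simp add: nn_integral_cmult nn_integral_add)
  finally show ?thesis .
qed

lemma mass_diff_le:
  assumes q: "q > 0" and fg: "f \<in> borel_measurable borel" "g \<in> borel_measurable borel"
  shows "mass q (\<lambda>x. f x - g x) \<le> ennreal (2 powr q) * (mass q f + mass q g)"
  using mass_add_le[OF q fg(1), of "\<lambda>x. - g x"] fg(2) by (simp add: mass_def)

text \<open>
  For \<open>0 < q \<le> 2\<close> and every \<open>\<lambda> > 0\<close> one has
  \<open>\<bar>t\<bar>\<^sup>q \<le> \<lambda>\<^sup>q + \<lambda>\<^sup>q\<^sup>-\<^sup>2
  t\<^sup>2\<close>, and below \<open>t\<^sup>2 \<le> \<lambda>\<^sup>2\<^sup>-\<^sup>q
  \<bar>t\<bar>\<^sup>q + \<lambda>\<^sup>-\<^sup>2 t\<^sup>4\<close>; with a suitable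
  \<open>\<lambda>\<close> these take the place of the inequality of Hoelder.
\<close>

lemma mass_interpolation_upper:
  assumes q: "0 < q" "q \<le> 2" and l: "l > 0" and [measurable]: "f \<in> borel_measurable borel"
  shows "mass q f \<le> ennreal (l powr q) + ennreal (l powr (q - 2)) * mass 2 f"
proof -
  have bd: "\<bar>t\<bar> powr q \<le> l powr q + l powr (q - 2) * \<bar>t\<bar> powr 2" for t :: real
  proof (cases "\<bar>t\<bar> \<le> l")
    case True
    then have "\<bar>t\<bar> powr q \<le> l powr q" using q by (intro powr_mono2) auto
    moreover have "0 \<le> l powr (q - 2) * \<bar>t\<bar> powr 2" by simp
    ultimately show ?thesis by linarith
  next
    case False
    then have t: "\<bar>t\<bar> > 0" using l by linarith
    have "\<bar>t\<bar> powr q = \<bar>t\<bar> powr (q - 2) * \<bar>t\<bar> powr 2" using t by (simp only: powr_add[symmetric]) simp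
    also have "\<dots> \<le> l powr (q - 2) * \<bar>t\<bar> powr 2"
      using False l q by (intro mult_right_mono powr_mono2') auto
    finally show ?thesis using powr_ge_zero[of l q] by linarith
  qed
  have "mass q f
      \<le> (\<integral>\<^sup>+x. ennreal (l powr q) + ennreal (l powr (q - 2)) * ennreal (\<bar>f x\<bar> powr 2) \<partial>unit_measure)"
    unfolding mass_def
  proof (rule nn_integral_mono)
    fix x
    show "ennreal (\<bar>f x\<bar> powr q)
        \<le> ennreal (l powr q) + ennreal (l powr (q - 2)) * ennreal (\<bar>f x\<bar> powr 2)"
      using bd[of "f x"] by (simp only: ennreal_plus[symmetric] ennreal_mult[symmetric] ennreal_leI
          powr_ge_zero mult_nonneg_nonneg)
  qed
  also have "\<dots> = ennreal (l powr q) + ennreal (l powr (q - 2)) * mass 2 f"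
    unfolding mass_def
    by (subst nn_integral_add, measurable, subst nn_integral_unit_const, subst nn_integral_cmult, measurable)
  finally show ?thesis .
qed

lemma mass_interpolation_lower:
  assumes q: "0 < q" "q \<le> 2" and l: "l > 0" and [measurable]: "f \<in> borel_measurable borel"
  shows "mass 2 f \<le> ennreal (l powr (2 - q)) * mass q f + ennreal (l powr (-2)) * mass 4 f"
proof -
  have bd: "\<bar>t\<bar> powr 2 \<le> l powr (2 - q) * \<bar>t\<bar> powr q + l powr (-2) * \<bar>t\<bar> powr 4" for t :: real
  proof (cases "\<bar>t\<bar> \<le> l")
    case True
    have "\<bar>t\<bar> powr 2 = \<bar>t\<bar> powr (2 - q) * \<bar>t\<bar> powr q"
      by (cases "t = 0") (simp, simp only: powr_add[symmetric], simp)
    also have "\<dots> \<le> l powr (2 - q) * \<bar>t\<bar> powr q"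
      using True q by (intro mult_right_mono powr_mono2) auto
    finally show ?thesis
      by (smt (verit) mult_nonneg_nonneg powr_ge_zero)
  next
    case False
    then have t: "\<bar>t\<bar> > 0" using l by linarith
    have "\<bar>t\<bar> powr 2 = \<bar>t\<bar> powr (-2) * \<bar>t\<bar> powr 4" using t by (simp only: powr_add[symmetric]) simp
    also have "\<dots> \<le> l powr (-2) * \<bar>t\<bar> powr 4"
      using False l by (intro mult_right_mono powr_mono2') auto
    finally show ?thesis by (smt (verit) mult_nonneg_nonneg powr_ge_zero)
  qed
  have "mass 2 f
      \<le> (\<integral>\<^sup>+x. ennreal (l powr (2 - q)) * ennreal (\<bar>f x\<bar> powr q)
            + ennreal (l powr (-2)) * ennreal (\<bar>f x\<bar> powr 4) \<partial>unit_measure)"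
    unfolding mass_def
  proof (rule nn_integral_mono)
    fix x
    show "ennreal (\<bar>f x\<bar> powr 2)
        \<le> ennreal (l powr (2 - q)) * ennreal (\<bar>f x\<bar> powr q)
            + ennreal (l powr (-2)) * ennreal (\<bar>f x\<bar> powr 4)"
      using bd[of "f x"] by (simp only: ennreal_plus[symmetric] ennreal_mult[symmetric] ennreal_leI
          powr_ge_zero mult_nonneg_nonneg)
  qed
  also have "\<dots> = ennreal (l powr (2 - q)) * mass q f + ennreal (l powr (-2)) * mass 4 f"
    unfolding mass_def by (simp add: nn_integral_cmult nn_integral_add)
  finally show ?thesis .
qed

section \<open>Rademacher sums\<close>

text \<open>
  The \<open>k\<close>-th Rademacher function is \<open>1\<close> or \<open>-1\<close> according to the
  binary digit of \<open>s\<close> with weight \<open>2\<^sup>-\<^sup>k\<^sup>-\<^sup>1\<close>.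
\<close>

definition rademacher :: "nat \<Rightarrow> real \<Rightarrow> real" where
  "rademacher k s = (if even \<lfloor>2 ^ Suc k * s\<rfloor> then 1 else - 1)"

definition rademacher_sum :: "nat \<Rightarrow> (nat \<Rightarrow> real) \<Rightarrow> real \<Rightarrow> real" where
  "rademacher_sum n a s = (\<Sum>k<n. a k * rademacher k s)"

lemma rademacher_measurable [measurable]: "rademacher k \<in> borel_measurable borel"
  unfolding rademacher_def by measurable

lemma rademacher_sum_measurable [measurable]: "rademacher_sum n a \<in> borel_measurable borel"
  unfolding rademacher_sum_def by measurable

lemma rademacher_half:
  assumes "0 \<le> y" "y < 1"
  shows "rademacher 0 (y / 2) = 1" "rademacher 0 ((y + 1) / 2) = - 1"
    "rademacher (Suc k) (y / 2) = rademacher k y" "rademacher (Suc k) ((y + 1) / 2) = rademacher k y"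
proof -
  have f: "\<lfloor>y\<rfloor> = 0" "\<lfloor>y + 1\<rfloor> = 1" using assms by linarith+
  show "rademacher 0 (y / 2) = 1" "rademacher 0 ((y + 1) / 2) = - 1"
  proof -
    have e: "2 ^ Suc 0 * (y / 2) = y" "2 ^ Suc 0 * ((y + 1) / 2) = y + 1" by (simp_all add: field_simps)
    show "rademacher 0 (y / 2) = 1" "rademacher 0 ((y + 1) / 2) = - 1"
      unfolding rademacher_def e f by simp_all
  qed
  have "2 ^ Suc (Suc k) * (y / 2) = 2 ^ Suc k * y" by simp
  then show "rademacher (Suc k) (y / 2) = rademacher k y" by (simp only: rademacher_def)
  have e: "2 ^ Suc (Suc k) * ((y + 1) / 2) = 2 ^ Suc k * y + of_int (2 ^ Suc k)"
    by (simp add: field_simps)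
  show "rademacher (Suc k) ((y + 1) / 2) = rademacher k y"
    unfolding rademacher_def e floor_add_int[symmetric] by simp
qed

lemma rademacher_sum_half:
  assumes "0 \<le> y" "y < 1"
  shows "rademacher_sum (Suc n) a (y / 2) = a 0 + rademacher_sum n (\<lambda>k. a (Suc k)) y"
    "rademacher_sum (Suc n) a ((y + 1) / 2) = - a 0 + rademacher_sum n (\<lambda>k. a (Suc k)) y"
  unfolding rademacher_sum_def sum.lessThan_Suc_shift by (simp_all add: rademacher_half[OF assms])

text \<open>
  The first digit of a point selects a half of the interval, and the remaining digits are those of the
  rescaled point. This recursion replaces independence in the computation of the moments.
\<close>

lemma nn_integral_rademacher_sum:
  fixes h :: "real \<Rightarrow> ennreal"
  assumes [measurable]: "h \<in> borel_measurable borel"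
  shows "(\<integral>\<^sup>+s. h (rademacher_sum (Suc n) a s) \<partial>unit_measure) =
    ennreal (1/2) * (\<integral>\<^sup>+s. h (a 0 + rademacher_sum n (\<lambda>k. a (Suc k)) s)
      + h (- a 0 + rademacher_sum n (\<lambda>k. a (Suc k)) s) \<partial>unit_measure)"
proof -
  have ae: "AE y in unit_measure. 0 \<le> y \<and> y < 1"
    using AE_unit_measure by eventually_elim auto
  have "(\<integral>\<^sup>+y. h (rademacher_sum (Suc n) a (y / 2)) \<partial>unit_measure)
      = (\<integral>\<^sup>+s. h (a 0 + rademacher_sum n (\<lambda>k. a (Suc k)) s) \<partial>unit_measure)"
    by (rule nn_integral_cong_AE, use ae in eventually_elim) (simp only: rademacher_sum_half)
  moreover have "(\<integral>\<^sup>+y. h (rademacher_sum (Suc n) a ((y + 1) / 2)) \<partial>unit_measure)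
      = (\<integral>\<^sup>+s. h (- a 0 + rademacher_sum n (\<lambda>k. a (Suc k)) s) \<partial>unit_measure)"
    by (rule nn_integral_cong_AE, use ae in eventually_elim) (simp only: rademacher_sum_half)
  ultimately show ?thesis
    by (subst nn_integral_unit_halves, measurable) (simp add: nn_integral_add)
qed

lemma mass_2_rademacher_sum: "mass 2 (rademacher_sum n a) = ennreal (\<Sum>k<n. (a k)\<^sup>2)"
proof (induction n arbitrary: a)
  case 0
  then show ?case by (simp add: mass_def rademacher_sum_def)
next
  case (Suc n)
  let ?S = "rademacher_sum n (\<lambda>k. a (Suc k))"
  have "mass 2 (rademacher_sum (Suc n) a)
      = ennreal (1/2) * (\<integral>\<^sup>+s. ennreal ((a 0 + ?S s)\<^sup>2) + ennreal ((- a 0 + ?S s)\<^sup>2) \<partial>unit_measure)"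
    unfolding mass_2 by (rule nn_integral_rademacher_sum[of "\<lambda>t. ennreal (t\<^sup>2)"]) measurable
  also have "\<dots> = (\<integral>\<^sup>+s. ennreal (1/2) * (ennreal ((a 0 + ?S s)\<^sup>2) + ennreal ((- a 0 + ?S s)\<^sup>2)) \<partial>unit_measure)"
    by (rule nn_integral_cmult[symmetric]) measurable
  also have "\<dots> = (\<integral>\<^sup>+s. ennreal ((a 0)\<^sup>2) + ennreal ((?S s)\<^sup>2) \<partial>unit_measure)"
  proof (rule nn_integral_cong)
    fix s
    have "1/2 * ((a 0 + ?S s)\<^sup>2 + (- a 0 + ?S s)\<^sup>2) = (a 0)\<^sup>2 + (?S s)\<^sup>2"
      by (simp add: power2_eq_square algebra_simps)
    then show "ennreal (1/2) * (ennreal ((a 0 + ?S s)\<^sup>2) + ennreal ((- a 0 + ?S s)\<^sup>2))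
        = ennreal ((a 0)\<^sup>2) + ennreal ((?S s)\<^sup>2)"
      by (simp only: ennreal_plus[symmetric] ennreal_mult[symmetric] zero_le_power2 add_nonneg_nonneg
          zero_le_divide_1_iff zero_le_numeral)
  qed
  also have "\<dots> = ennreal ((a 0)\<^sup>2) + mass 2 ?S"
    unfolding mass_2 by (subst nn_integral_add, measurable, subst nn_integral_unit_const, rule refl)
  also have "\<dots> = ennreal (\<Sum>k<Suc n. (a k)\<^sup>2)"
    unfolding Suc.IH sum.lessThan_Suc_shift by (simp add: ennreal_plus sum_nonneg)
  finally show ?case .
qed

lemma mass_4: "mass 4 f = (\<integral>\<^sup>+x. ennreal ((f x) ^ 4) \<partial>unit_measure)"
proof -
  have "\<bar>t\<bar> powr 4 = t ^ 4" for t :: real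
    using powr_realpow'[of "\<bar>t\<bar>" 4] by (cases "t = 0") auto
  then show ?thesis by (simp add: mass_def)
qed

lemma mass_4_rademacher_sum: "mass 4 (rademacher_sum n a) \<le> ennreal (3 * (\<Sum>k<n. (a k)\<^sup>2)\<^sup>2)"
proof (induction n arbitrary: a)
  case 0
  then show ?case by (simp add: mass_4 rademacher_sum_def)
next
  case (Suc n)
  let ?S = "rademacher_sum n (\<lambda>k. a (Suc k))"
  let ?v = "\<Sum>k<n. (a (Suc k))\<^sup>2"
  have v: "?v \<ge> 0" by (intro sum_nonneg) auto
  have "mass 4 (rademacher_sum (Suc n) a)
      = ennreal (1/2) * (\<integral>\<^sup>+s. ennreal ((a 0 + ?S s) ^ 4) + ennreal ((- a 0 + ?S s) ^ 4) \<partial>unit_measure)"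
    unfolding mass_4 by (rule nn_integral_rademacher_sum[of "\<lambda>t. ennreal (t ^ 4)"]) measurable
  also have "\<dots> = (\<integral>\<^sup>+s. ennreal (1/2) * (ennreal ((a 0 + ?S s) ^ 4) + ennreal ((- a 0 + ?S s) ^ 4)) \<partial>unit_measure)"
    by (rule nn_integral_cmult[symmetric]) measurable
  also have "\<dots> = (\<integral>\<^sup>+s. ennreal ((a 0) ^ 4) + (ennreal (6 * (a 0)\<^sup>2) * ennreal ((?S s)\<^sup>2) + ennreal ((?S s) ^ 4)) \<partial>unit_measure)"
  proof (rule nn_integral_cong)
    fix s
    have n4: "0 \<le> z ^ 4" for z :: real by simp
    have "1/2 * ((a 0 + ?S s) ^ 4 + (- a 0 + ?S s) ^ 4) = (a 0) ^ 4 + (6 * (a 0)\<^sup>2 * (?S s)\<^sup>2 + (?S s) ^ 4)"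
      by (simp add: power4_eq_xxxx power2_eq_square algebra_simps)
    then show "ennreal (1/2) * (ennreal ((a 0 + ?S s) ^ 4) + ennreal ((- a 0 + ?S s) ^ 4))
        = ennreal ((a 0) ^ 4) + (ennreal (6 * (a 0)\<^sup>2) * ennreal ((?S s)\<^sup>2) + ennreal ((?S s) ^ 4))"
      by (simp only: ennreal_plus[symmetric] ennreal_mult[symmetric] n4 zero_le_power2
          mult_nonneg_nonneg add_nonneg_nonneg zero_le_numeral zero_le_divide_1_iff)
  qed
  also have "\<dots> = ennreal ((a 0) ^ 4) + (ennreal (6 * (a 0)\<^sup>2) * mass 2 ?S + mass 4 ?S)"
    unfolding mass_2 mass_4
    by (subst nn_integral_add, measurable, subst nn_integral_unit_const, subst nn_integral_add, measurable,
        subst nn_integral_cmult, measurable)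
  also have "\<dots> \<le> ennreal ((a 0) ^ 4) + (ennreal (6 * (a 0)\<^sup>2) * ennreal ?v + ennreal (3 * ?v\<^sup>2))"
    unfolding mass_2_rademacher_sum by (intro add_left_mono Suc.IH)
  also have "\<dots> = ennreal ((a 0) ^ 4 + (6 * (a 0)\<^sup>2 * ?v + 3 * ?v\<^sup>2))"
    using v by (simp add: ennreal_plus[symmetric] ennreal_mult[symmetric] del: ennreal_plus)
  also have "\<dots> \<le> ennreal (3 * (\<Sum>k<Suc n. (a k)\<^sup>2)\<^sup>2)"
  proof (rule ennreal_leI)
    have "0 \<le> (a 0) ^ 4" by simp
    then show "(a 0) ^ 4 + (6 * (a 0)\<^sup>2 * ?v + 3 * ?v\<^sup>2) \<le> 3 * (\<Sum>k<Suc n. (a k)\<^sup>2)\<^sup>2"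
      unfolding sum.lessThan_Suc_shift by (simp add: power2_eq_square power4_eq_xxxx algebra_simps)
  qed
  finally show ?case .
qed

text \<open>
  The lower bound in the inequality of Khintchine: the fourth moment is at most three times the square
  of the variance \<open>v\<close>, so the variance is controlled by the \<open>q\<close>-th moment.
\<close>

lemma khintchine_lower:
  assumes q: "0 < q" "q \<le> 2"
  shows "ennreal (1/2 * 6 powr ((q - 2) / 2) * (\<Sum>k<n. (a k)\<^sup>2) powr (q / 2)) \<le> mass q (rademacher_sum n a)"
proof (cases "(\<Sum>k<n. (a k)\<^sup>2) = 0")
  case True
  show ?thesis unfolding True by simp
next
  case False
  define v where "v = (\<Sum>k<n. (a k)\<^sup>2)"
  have "v \<ge> 0" unfolding v_def by (intro sum_nonneg) auto
  with False have v: "v > 0" by (simp add: v_def)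
  \<comment> \<open>with this choice the fourth moment accounts for at most half of the variance\<close>
  define l where "l = sqrt (6 * v)"
  have l: "l > 0" using v by (simp add: l_def)
  have l2: "l powr (-2) = 1 / (6 * v)"
    using l v by (simp add: powr_minus inverse_eq_divide l_def)
  show ?thesis
  proof (cases "mass q (rademacher_sum n a)")
    case top then show ?thesis by simp
  next
    case (real m)
    have "ennreal v \<le> ennreal (l powr (2 - q)) * ennreal m + ennreal (l powr (-2)) * mass 4 (rademacher_sum n a)"
      using mass_interpolation_lower[OF q l, of "rademacher_sum n a"]
      unfolding mass_2_rademacher_sum real(2) v_def by simp
    also have "\<dots> \<le> ennreal (l powr (2 - q)) * ennreal m + ennreal (l powr (-2)) * ennreal (3 * v\<^sup>2)"
      unfolding v_def by (intro add_left_mono mult_left_mono mass_4_rademacher_sum) auto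
    also have "\<dots> = ennreal (l powr (2 - q) * m + l powr (-2) * (3 * v\<^sup>2))"
      using real(1) by (simp add: ennreal_plus[symmetric] ennreal_mult[symmetric] del: ennreal_plus)
    finally have "v \<le> l powr (2 - q) * m + l powr (-2) * (3 * v\<^sup>2)"
      using real(1) by (subst (asm) ennreal_le_iff) auto
    also have "l powr (-2) * (3 * v\<^sup>2) = v / 2"
      unfolding l2 using v by (simp add: power2_eq_square)
    finally have "v / 2 \<le> l powr (2 - q) * m" by simp
    then have "l powr (q - 2) * (v / 2) \<le> l powr (q - 2) * (l powr (2 - q) * m)"
      by (intro mult_left_mono) auto
    also have "\<dots> = m" using l by (simp add: mult.assoc[symmetric] powr_add[symmetric])
    also have "l powr (q - 2) = 6 powr ((q - 2) / 2) * v powr ((q - 2) / 2)"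
      using v by (simp add: l_def powr_half_sqrt[symmetric] powr_powr powr_mult)
    also have "6 powr ((q - 2) / 2) * v powr ((q - 2) / 2) * (v / 2)
        = 1/2 * 6 powr ((q - 2) / 2) * (v powr ((q - 2) / 2) * v powr 1)"
      using v by simp
    also have "v powr ((q - 2) / 2) * v powr 1 = v powr (q / 2)"
      by (simp only: powr_add[symmetric]) (simp add: field_simps)
    finally show ?thesis unfolding real(2) v_def by (rule ennreal_leI)
  qed
qed

lemma rademacher_sum_diff: "rademacher_sum n (\<lambda>k. a k - b k) s = rademacher_sum n a s - rademacher_sum n b s"
  by (simp add: rademacher_sum_def sum_subtractf left_diff_distrib)

lemma mass_2_rademacher_sum_gap:
  assumes "m \<le> n"
  shows "mass 2 (\<lambda>s. rademacher_sum n a s - rademacher_sum m a s) = ennreal (\<Sum>k\<in>{m..<n}. (a k)\<^sup>2)"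
proof -
  let ?b = "\<lambda>k. if k < m then 0 else a k"
  have split: "{..<n} = {..<m} \<union> {m..<n}" using assms by auto
  have "rademacher_sum n a s - rademacher_sum m a s = rademacher_sum n ?b s" for s
    unfolding rademacher_sum_def split by (subst (1 2) sum.union_disjoint) auto
  moreover have "(\<Sum>k<n. (?b k)\<^sup>2) = (\<Sum>k\<in>{m..<n}. (a k)\<^sup>2)"
    unfolding split by (subst sum.union_disjoint) auto
  ultimately show ?thesis by (simp add: mass_2_rademacher_sum)
qed

lemma mass_1_le:
  assumes l: "l > 0" and [measurable]: "f \<in> borel_measurable borel" and f: "mass 2 f \<le> ennreal (l\<^sup>2)"
  shows "(\<integral>\<^sup>+x. ennreal \<bar>f x\<bar> \<partial>unit_measure) \<le> ennreal (2 * l)"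
proof -
  have "(\<integral>\<^sup>+x. ennreal \<bar>f x\<bar> \<partial>unit_measure) = mass 1 f" by (simp add: mass_def)
  also have "\<dots> \<le> ennreal (l powr 1) + ennreal (l powr (1 - 2)) * mass 2 f"
    using l by (intro mass_interpolation_upper) auto
  also have "\<dots> \<le> ennreal (l powr 1) + ennreal (l powr (1 - 2)) * ennreal (l\<^sup>2)"
    by (intro add_left_mono mult_left_mono f) auto
  also have "\<dots> = ennreal (2 * l)"
    using l by (simp add: ennreal_plus[symmetric] ennreal_mult[symmetric] powr_minus power2_eq_square del: ennreal_plus)
  finally show ?thesis .
qed

text \<open>
  Square summable Rademacher series converge in \<open>L_2\<close>: a subsequence of the partial sums
  converges almost everywhere, and the lemma of Fatou estimates the distance to its limit.
\<close>

lemma rademacher_series_exists: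
  assumes a: "summable (\<lambda>k. (a k)\<^sup>2)"
  shows "\<exists>t. t \<in> borel_measurable borel \<and>
    (\<forall>n. mass 2 (\<lambda>s. t s - rademacher_sum n a s) \<le> ennreal (\<Sum>k. (a (k + n))\<^sup>2))"
proof -
  define R where "R n = (\<Sum>k. (a (k + n))\<^sup>2)" for n
  have R0: "R \<longlonglongrightarrow> 0" unfolding R_def[abs_def] by (rule suminf_exist_split2[OF a])
  have tail: "(\<Sum>k\<in>{m..<n}. (a k)\<^sup>2) \<le> R m" for m n
  proof -
    have "(\<Sum>k\<in>{m..<n}. (a k)\<^sup>2) = (\<Sum>k<n - m. (a (k + m))\<^sup>2)"
      by (rule sum.reindex_bij_witness[where i = "\<lambda>k. k + m" and j = "\<lambda>k. k - m"]) auto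
    also have "\<dots> \<le> R m"
      unfolding R_def using a by (intro sum_le_suminf) (auto simp: summable_iff_shift[of "\<lambda>k. (a k)\<^sup>2" m])
    finally show ?thesis .
  qed
  have "\<exists>n. \<forall>m\<ge>n. R m \<le> (1/4) ^ j" for j
  proof -
    have "\<forall>\<^sub>F m in sequentially. R m < (1/4) ^ j" using R0 by (rule order_tendstoD) simp
    then show ?thesis by (auto simp: eventually_sequentially intro: less_imp_le)
  qed
  then obtain M where M: "\<And>j m. m \<ge> M j \<Longrightarrow> R m \<le> (1/4) ^ j" by metis
  \<comment> \<open>increasing, above \<open>M\<close>, and unbounded\<close>
  define L where "L j = j + (\<Sum>i\<le>j. M i)" for j
  have L: "M j \<le> L j" "L j \<le> L (Suc j)" "j \<le> L j" for j
    using member_le_sum[of j "{..j}" M] by (auto simp: L_def)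
  define S where "S j = rademacher_sum (L j) a" for j
  have [measurable]: "S j \<in> borel_measurable borel" for j unfolding S_def by measurable
  define t where "t s = lim (\<lambda>j. S j s)" for s
  have tm [measurable]: "t \<in> borel_measurable borel" unfolding t_def by measurable
  have "(\<integral>\<^sup>+s. ennreal \<bar>S (Suc j) s - S j s\<bar> \<partial>unit_measure) \<le> ennreal (2 * (1/2) ^ j)" for j
  proof (rule mass_1_le)
    have "mass 2 (\<lambda>s. S (Suc j) s - S j s) \<le> ennreal (R (L j))"
      unfolding S_def using L(2) tail by (subst mass_2_rademacher_sum_gap) (auto intro: ennreal_leI)
    also have "\<dots> \<le> ennreal ((1/4) ^ j)" using M[of j "L j"] L(1) by (intro ennreal_leI) auto
    also have "(1/4::real) ^ j = ((1/2) ^ j)\<^sup>2"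
      by (simp only: power2_eq_square power_mult_distrib[symmetric]) simp
    finally show "mass 2 (\<lambda>s. S (Suc j) s - S j s) \<le> ennreal (((1/2) ^ j)\<^sup>2)" .
  qed auto
  then have "(\<Sum>j. \<integral>\<^sup>+s. ennreal \<bar>S (Suc j) s - S j s\<bar> \<partial>unit_measure) \<le> (\<Sum>j. ennreal (2 * (1/2) ^ j))"
    by (intro suminf_le summableI)
  also have "\<dots> = ennreal (\<Sum>j. 2 * (1/2) ^ j)"
    by (intro suminf_ennreal2) (auto intro!: summable_mult summable_geometric)
  finally have "(\<Sum>j. \<integral>\<^sup>+s. ennreal \<bar>S (Suc j) s - S j s\<bar> \<partial>unit_measure) < \<infinity>"
    by (rule le_less_trans) simp
  also have "(\<Sum>j. \<integral>\<^sup>+s. ennreal \<bar>S (Suc j) s - S j s\<bar> \<partial>unit_measure)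
      = (\<integral>\<^sup>+s. (\<Sum>j. ennreal \<bar>S (Suc j) s - S j s\<bar>) \<partial>unit_measure)"
    by (rule nn_integral_suminf[symmetric]) measurable
  finally have "AE s in unit_measure. (\<Sum>j. ennreal \<bar>S (Suc j) s - S j s\<bar>) \<noteq> \<infinity>"
    by (intro nn_integral_PInf_AE) auto
  then have ae: "AE s in unit_measure. (\<lambda>j. S j s) \<longlonglongrightarrow> t s"
  proof eventually_elim
    case (elim s)
    then have "summable (\<lambda>j. \<bar>S (Suc j) s - S j s\<bar>)" by (intro summable_suminf_not_top) auto
    then have "summable (\<lambda>j. S (Suc j) s - S j s)" by (rule summable_rabs_cancel)
    then have "convergent (\<lambda>n. \<Sum>j<n. S (Suc j) s - S j s)" by (simp add: summable_iff_convergent)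
    then have "convergent (\<lambda>n. S n s - S 0 s)" 
      by (simp only: sum_lessThan_telescope[of "\<lambda>j. S j s"])
    then have "convergent (\<lambda>n. S n s)"
      using convergent_add[OF _ convergent_const[of "S 0 s"]] by force
    then show ?case unfolding t_def by (simp add: convergent_LIMSEQ_iff)
  qed
  have "mass 2 (\<lambda>s. t s - rademacher_sum n a s) \<le> ennreal (R n)" for n
  proof -
    have "mass 2 (\<lambda>s. t s - rademacher_sum n a s)
        = (\<integral>\<^sup>+s. liminf (\<lambda>j. ennreal ((S j s - rademacher_sum n a s)\<^sup>2)) \<partial>unit_measure)"
      unfolding mass_2
    proof (rule nn_integral_cong_AE, use ae in eventually_elim)
      case (elim s)
      have "(\<lambda>j. ennreal ((S j s - rademacher_sum n a s)\<^sup>2)) \<longlonglongrightarrow> ennreal ((t s - rademacher_sum n a s)\<^sup>2)"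
        by (intro tendsto_intros elim)
      from lim_imp_Liminf[OF _ this] show ?case by simp
    qed
    also have "\<dots> \<le> liminf (\<lambda>j. mass 2 (\<lambda>s. S j s - rademacher_sum n a s))"
      unfolding mass_2 by (rule nn_integral_liminf) measurable
    also have "\<dots> \<le> liminf (\<lambda>j. ennreal (R n))"
    proof (rule Liminf_mono, rule eventually_mono[OF eventually_ge_at_top[of n]])
      fix j assume "n \<le> j"
      then have "n \<le> L j" using L(3)[of j] by simp
      then show "mass 2 (\<lambda>s. S j s - rademacher_sum n a s) \<le> ennreal (R n)"
        unfolding S_def using tail by (subst mass_2_rademacher_sum_gap) (auto intro: ennreal_leI)
    qed
    also have "\<dots> = ennreal (R n)" by (simp add: Liminf_const)
    finally show ?thesis .
  qed
  then show ?thesis using tm unfolding R_def by blast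
qed

text \<open>
  A sum of the Rademacher series with square summable coefficients \<open>a\<close>. It is determined
  only up to a null set; some Borel function is chosen.
\<close>

definition rademacher_series :: "(nat \<Rightarrow> real) \<Rightarrow> real \<Rightarrow> real" where
  "rademacher_series a = (SOME t. t \<in> borel_measurable borel \<and>
    (\<forall>n. mass 2 (\<lambda>s. t s - rademacher_sum n a s) \<le> ennreal (\<Sum>k. (a (k + n))\<^sup>2)))"

lemma rademacher_series:
  assumes "summable (\<lambda>k. (a k)\<^sup>2)"
  shows "rademacher_series a \<in> borel_measurable borel"
    "mass 2 (\<lambda>s. rademacher_series a s - rademacher_sum n a s) \<le> ennreal (\<Sum>k. (a (k + n))\<^sup>2)"
  using someI_ex[OF rademacher_series_exists[OF assms], folded rademacher_series_def] by blast+

lemma summable_diff_power2: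
  fixes a b :: "nat \<Rightarrow> real"
  assumes "summable (\<lambda>k. (a k)\<^sup>2)" "summable (\<lambda>k. (b k)\<^sup>2)"
  shows "summable (\<lambda>k. (a k - b k)\<^sup>2)"
proof (rule summable_comparison_test)
  show "summable (\<lambda>k. 2 * (a k)\<^sup>2 + 2 * (b k)\<^sup>2)" using assms by (intro summable_add summable_mult)
  have "(x - y)\<^sup>2 \<le> 2 * x\<^sup>2 + 2 * y\<^sup>2" for x y :: real
    using zero_le_power2[of "x + y"] by (simp add: power2_eq_square algebra_simps)
  then show "\<exists>N. \<forall>n\<ge>N. norm ((a n - b n)\<^sup>2) \<le> 2 * (a n)\<^sup>2 + 2 * (b n)\<^sup>2" by simp
qed

lemma mass_le_of_mass_2_le:
  assumes q: "0 < q" "q \<le> 2" and v: "v > 0" and C: "C \<ge> 0"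
    and f: "f \<in> borel_measurable borel" "mass 2 f \<le> ennreal (C * v)"
  shows "mass q f \<le> ennreal ((1 + C) * v powr (q / 2))"
proof -
  define l where "l = sqrt v"
  have l: "l > 0" using v by (simp add: l_def)
  have "mass q f \<le> ennreal (l powr q) + ennreal (l powr (q - 2)) * mass 2 f"
    by (rule mass_interpolation_upper[OF q l f(1)])
  also have "\<dots> \<le> ennreal (l powr q) + ennreal (l powr (q - 2)) * ennreal (C * v)"
    by (intro add_left_mono mult_left_mono f(2)) auto
  also have "\<dots> = ennreal (l powr q + l powr (q - 2) * (C * v))"
    using C v by (simp add: ennreal_plus[symmetric] ennreal_mult[symmetric] del: ennreal_plus)
  also have "l powr q + l powr (q - 2) * (C * v) = (1 + C) * v powr (q / 2)"
  proof -
    have "l powr q = v powr (q / 2)" using v by (simp add: l_def powr_half_sqrt[symmetric] powr_powr)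
    moreover have "l powr (q - 2) * v = v powr (q / 2)"
    proof -
      have "l powr (q - 2) * v = v powr ((q - 2) / 2) * v powr 1"
        using v by (simp add: l_def powr_half_sqrt[symmetric] powr_powr)
      also have "\<dots> = v powr (q / 2)" by (simp only: powr_add[symmetric]) (simp add: field_simps)
      finally show ?thesis .
    qed
    ultimately show ?thesis by (simp add: algebra_simps)
  qed
  finally show ?thesis .
qed

text \<open>
  For \<open>q \<le> 2\<close> the Rademacher series embed \<open>\<ell>_2\<close> in
  \<open>L_q\<close>. The estimates for a long partial sum of the difference are transferred to the
  limit, the remainder \<open>E\<close> being small in \<open>L_2\<close>, hence in \<open>L_q\<close>.
\<close>

theorem rademacher_series_distance:
  assumes q: "0 < q" "q \<le> 2"
  obtains c C where "c > 0" "C > 0"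
    "\<And>a b. summable (\<lambda>k. (a k)\<^sup>2) \<Longrightarrow> summable (\<lambda>k. (b k)\<^sup>2) \<Longrightarrow>
      ennreal (c * (\<Sum>k. (a k - b k)\<^sup>2) powr (q / 2))
        \<le> mass q (\<lambda>s. rademacher_series a s - rademacher_series b s) \<and>
      mass q (\<lambda>s. rademacher_series a s - rademacher_series b s)
        \<le> ennreal (C * (\<Sum>k. (a k - b k)\<^sup>2) powr (q / 2))"
proof -
  define c0 where "c0 = 1/2 * 6 powr ((q - 2) / 2)"
  define \<kappa> where "\<kappa> = 2 powr (- q) * (c0 * 2 powr (- q / 2))"
  \<comment> \<open>the admissible size of the remainder relative to the variance\<close>
  define \<theta> where "\<theta> = min 1 ((\<kappa> / 4) powr (2 / q))"
  have c0: "c0 > 0" and \<kappa>: "\<kappa> > 0" by (simp_all add: c0_def \<kappa>_def)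
  have \<theta>: "0 < \<theta>" "\<theta> \<le> 1" using \<kappa> by (auto simp: \<theta>_def)
  have "\<theta> powr (q / 2) \<le> ((\<kappa> / 4) powr (2 / q)) powr (q / 2)"
    using \<theta> q by (intro powr_mono2) (auto simp: \<theta>_def)
  then have \<theta>q: "2 * \<theta> powr (q / 2) \<le> \<kappa> / 2" using \<kappa> q by (simp add: powr_powr)
  show ?thesis
  proof (rule that)
    show "\<kappa> / 2 > 0" "(9::real) > 0" using \<kappa> by auto
    fix a b :: "nat \<Rightarrow> real"
    assume a: "summable (\<lambda>k. (a k)\<^sup>2)" and b: "summable (\<lambda>k. (b k)\<^sup>2)"
    define v where "v = (\<Sum>k. (a k - b k)\<^sup>2)"
    have ab: "summable (\<lambda>k. (a k - b k)\<^sup>2)" by (rule summable_diff_power2[OF a b])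
    define D where "D s = rademacher_series a s - rademacher_series b s" for s
    note [measurable] = rademacher_series(1)[OF a] rademacher_series(1)[OF b]
    have Dm [measurable]: "D \<in> borel_measurable borel" unfolding D_def by measurable
    have "v \<ge> 0" unfolding v_def by (rule suminf_nonneg[OF ab]) simp
    have "ennreal (\<kappa> / 2 * v powr (q / 2)) \<le> mass q D \<and> mass q D \<le> ennreal (9 * v powr (q / 2))"
    proof (cases "v = 0")
      case True
      then have "(a k - b k)\<^sup>2 = 0" for k
        using suminf_eq_zero_iff[OF ab] unfolding v_def by simp
      then have "a = b" by auto
      then have "mass q D = 0" by (simp add: D_def mass_def)
      then show ?thesis using True by simp
    next
      case False
      then have v: "v > 0" using \<open>v \<ge> 0\<close> by simp
      define tl where "tl n = (\<Sum>k. (a (k + n))\<^sup>2) + (\<Sum>k. (b (k + n))\<^sup>2)" for n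
      have "tl \<longlonglongrightarrow> 0 + 0"
        unfolding tl_def by (intro tendsto_add suminf_exist_split2 a b)
      then have "tl \<longlonglongrightarrow> 0" by simp
      then have ev1: "\<forall>\<^sub>F n in sequentially. tl n < \<theta> * v / 4"
        by (rule order_tendstoD) (use \<theta> v in auto)
      have "(\<lambda>n. \<Sum>k<n. (a k - b k)\<^sup>2) \<longlonglongrightarrow> v"
        unfolding v_def by (rule summable_LIMSEQ[OF ab])
      then have ev2: "\<forall>\<^sub>F n in sequentially. v / 2 < (\<Sum>k<n. (a k - b k)\<^sup>2)"
        by (rule order_tendstoD) (use v in auto)
      obtain n where n: "tl n < \<theta> * v / 4" "v / 2 < (\<Sum>k<n. (a k - b k)\<^sup>2)"
        using eventually_happens[OF eventually_conj[OF ev1 ev2]] by auto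
      have nv: "(\<Sum>k<n. (a k - b k)\<^sup>2) \<le> v"
        unfolding v_def by (intro sum_le_suminf ab) auto
      define S where "S = rademacher_sum n (\<lambda>k. a k - b k)"
      have [measurable]: "S \<in> borel_measurable borel" unfolding S_def by measurable
      define E where "E s = D s - S s" for s
      have [measurable]: "E \<in> borel_measurable borel" unfolding E_def by measurable
      have E2: "mass 2 E \<le> ennreal (\<theta> * v)"
      proof -
        have "E = (\<lambda>s. (rademacher_series a s - rademacher_sum n a s)
            - (rademacher_series b s - rademacher_sum n b s))"
          by (simp add: E_def D_def S_def rademacher_sum_diff fun_eq_iff)
        then have "mass 2 E \<le> ennreal (2 powr 2) *
            (mass 2 (\<lambda>s. rademacher_series a s - rademacher_sum n a s)
              + mass 2 (\<lambda>s. rademacher_series b s - rademacher_sum n b s))"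
          by (simp only:) (rule mass_diff_le, simp, measurable)
        also have "\<dots> \<le> ennreal (2 powr 2) * (ennreal (\<Sum>k. (a (k + n))\<^sup>2) + ennreal (\<Sum>k. (b (k + n))\<^sup>2))"
          by (intro mult_left_mono add_mono rademacher_series a b) auto
        also have "\<dots> = ennreal (4 * tl n)"
        proof -
          have "0 \<le> (\<Sum>k. (a (k + n))\<^sup>2)" "0 \<le> (\<Sum>k. (b (k + n))\<^sup>2)"
            using a b summable_iff_shift[of "\<lambda>k. (a k)\<^sup>2" n] summable_iff_shift[of "\<lambda>k. (b k)\<^sup>2" n]
            by (auto intro!: suminf_nonneg)
          then show ?thesis unfolding tl_def
            by (simp only: ennreal_plus[symmetric] ennreal_mult[symmetric] add_nonneg_nonneg powr_ge_zero) simp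
        qed
        also have "\<dots> \<le> ennreal (\<theta> * v)" using n(1) by (intro ennreal_leI) auto
        finally show ?thesis .
      qed
      have "mass 2 D \<le> ennreal (8 * v)"
      proof -
        have "D = (\<lambda>s. S s + E s)" by (simp add: E_def fun_eq_iff)
        then have "mass 2 D \<le> ennreal (2 powr 2) * (mass 2 S + mass 2 E)"
          by (simp only:) (rule mass_add_le, simp, measurable)
        also have "\<dots> \<le> ennreal (2 powr 2) * (ennreal v + ennreal (1 * v))"
        proof (intro mult_left_mono add_mono)
          show "mass 2 S \<le> ennreal v" unfolding S_def mass_2_rademacher_sum by (rule ennreal_leI[OF nv])
          have "\<theta> * v \<le> 1 * v" using \<theta> v by (intro mult_right_mono) auto
          then show "mass 2 E \<le> ennreal (1 * v)" using E2 by (meson ennreal_leI order_trans)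
        qed auto
        also have "\<dots> = ennreal (8 * v)"
          using v by (simp only: ennreal_plus[symmetric] ennreal_mult[symmetric] add_nonneg_nonneg
              less_imp_le powr_ge_zero mult_1) simp
        finally show ?thesis .
      qed
      then have up: "mass q D \<le> ennreal (9 * v powr (q / 2))"
        using mass_le_of_mass_2_le[OF q v _ Dm, of 8] by simp
      obtain m where m: "mass q D = ennreal m" "m \<ge> 0"
        using up by (cases "mass q D") (auto simp: top_unique)
      have "mass 2 E \<le> ennreal (1 * (\<theta> * v))" using E2 by simp
      then have "mass q E \<le> ennreal ((1 + 1) * (\<theta> * v) powr (q / 2))"
        using \<theta> v by (intro mass_le_of_mass_2_le[OF q]) auto
      also have "\<dots> \<le> ennreal (\<kappa> / 2 * v powr (q / 2))"
        using mult_right_mono[OF \<theta>q, of "v powr (q / 2)"] by (intro ennreal_leI) (simp add: powr_mult)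
      finally have Eq: "mass q E \<le> ennreal (\<kappa> / 2 * v powr (q / 2))" .
      have "c0 * (v / 2) powr (q / 2) \<le> c0 * (\<Sum>k<n. (a k - b k)\<^sup>2) powr (q / 2)"
        using n(2) c0 v q by (intro mult_left_mono powr_mono2) auto
      then have "ennreal (c0 * (v / 2) powr (q / 2)) \<le> mass q S"
        unfolding S_def using khintchine_lower[OF q, of "\<lambda>k. a k - b k" n]
        unfolding c0_def by (meson ennreal_leI order_trans)
      also have "S = (\<lambda>s. D s - E s)" by (simp add: E_def fun_eq_iff)
      also have "mass q \<dots> \<le> ennreal (2 powr q) * (mass q D + mass q E)"
        using q by (intro mass_diff_le) auto
      also have "\<dots> \<le> ennreal (2 powr q) * (ennreal m + ennreal (\<kappa> / 2 * v powr (q / 2)))"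
        unfolding m(1) by (intro mult_left_mono add_left_mono Eq) auto
      also have "\<dots> = ennreal (2 powr q * (m + \<kappa> / 2 * v powr (q / 2)))"
        using m(2) \<kappa> by (simp add: ennreal_plus[symmetric] ennreal_mult[symmetric] del: ennreal_plus)
      finally have "c0 * (v / 2) powr (q / 2) \<le> 2 powr q * (m + \<kappa> / 2 * v powr (q / 2))"
        using m(2) \<kappa> by (subst (asm) ennreal_le_iff) auto
      then have "2 powr (- q) * (c0 * (v / 2) powr (q / 2))
          \<le> 2 powr (- q) * (2 powr q * (m + \<kappa> / 2 * v powr (q / 2)))"
        by (intro mult_left_mono) auto
      also have "\<dots> = m + \<kappa> / 2 * v powr (q / 2)"
        by (simp only: mult.assoc[symmetric] powr_add[symmetric]) simp
      also have "2 powr (- q) * (c0 * (v / 2) powr (q / 2)) = \<kappa> * v powr (q / 2)"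
      proof -
        have "(v / 2) powr (q / 2) = 2 powr (- q / 2) * v powr (q / 2)"
          using v by (simp add: powr_divide powr_minus_divide)
        then show ?thesis by (simp only: \<kappa>_def mult.assoc)
      qed
      finally have "\<kappa> / 2 * v powr (q / 2) \<le> m" by simp
      then show ?thesis using up unfolding m(1) by (auto intro: ennreal_leI)
    qed
    then show "ennreal (\<kappa> / 2 * (\<Sum>k. (a k - b k)\<^sup>2) powr (q / 2))
        \<le> mass q (\<lambda>s. rademacher_series a s - rademacher_series b s) \<and>
      mass q (\<lambda>s. rademacher_series a s - rademacher_series b s)
        \<le> ennreal (9 * (\<Sum>k. (a k - b k)\<^sup>2) powr (q / 2))"
      unfolding v_def D_def .
  qed
qed

section \<open>Haar coefficients and the embedding of \<open>L_2\<close>\<close>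

text \<open>
  The index of the dyadic interval of length \<open>2\<^sup>-\<^sup>N\<close> that contains the point.
\<close>

definition dyadic_index :: "nat \<Rightarrow> real \<Rightarrow> nat" where
  "dyadic_index N s = nat \<lfloor>2 ^ N * s\<rfloor>"

text \<open>
  The integral of \<open>f\<close> over the \<open>j\<close>-th dyadic interval of length
  \<open>2\<^sup>-\<^sup>N\<close>.
\<close>

definition cell_integral :: "(real \<Rightarrow> real) \<Rightarrow> nat \<Rightarrow> nat \<Rightarrow> real" where
  "cell_integral f N j = (LINT s|unit_measure. (if dyadic_index N s = j then f s else 0))"

text \<open>
  The coefficients of \<open>f\<close> in the Haar system. The index \<open>k = 2\<^sup>n + j\<close>
  with \<open>j < 2\<^sup>n\<close> belongs to the \<open>j\<close>-th dyadic interval of length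
  \<open>2\<^sup>-\<^sup>n\<close>, and \<open>k = 0\<close> to the constant function.
\<close>

definition haar :: "(real \<Rightarrow> real) \<Rightarrow> nat \<Rightarrow> real" where
  "haar f k = (if k = 0 then cell_integral f 0 0
     else let n = floor_log k; j = k - 2 ^ n
       in sqrt (2 ^ n) * (cell_integral f (Suc n) (2 * j) - cell_integral f (Suc n) (2 * j + 1)))"

lemma dyadic_index_measurable [measurable]: "dyadic_index N \<in> measurable borel (count_space UNIV)"
  unfolding dyadic_index_def by measurable

lemma dyadic_index_Suc:
  assumes "s \<ge> 0"
  shows "dyadic_index (Suc N) s div 2 = dyadic_index N s"
proof -
  have *: "\<lfloor>2 * x\<rfloor> div 2 = \<lfloor>x\<rfloor>" for x :: real
  proof -
    have "2 * \<lfloor>x\<rfloor> \<le> \<lfloor>2 * x\<rfloor>" "\<lfloor>2 * x\<rfloor> \<le> 2 * \<lfloor>x\<rfloor> + 1" by linarith+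
    then show ?thesis by linarith
  qed
  have "nat \<lfloor>2 * (2 ^ N * s)\<rfloor> div 2 = nat (\<lfloor>2 * (2 ^ N * s)\<rfloor> div 2)"
    using assms by (simp add: nat_div_distrib)
  then show ?thesis unfolding * by (simp add: dyadic_index_def mult.assoc)
qed

lemma dyadic_index_less:
  assumes "0 \<le> s" "s < 1"
  shows "dyadic_index N s < 2 ^ N"
proof -
  have "2 ^ N * s < 2 ^ N * 1" using assms by (intro mult_strict_left_mono) auto
  then have "\<lfloor>2 ^ N * s\<rfloor> < int (2 ^ N)" by (simp add: floor_less_iff)
  then show ?thesis unfolding dyadic_index_def using assms by (subst nat_less_iff) auto
qed

lemma integrable_cell:
  fixes f :: "real \<Rightarrow> real"
  assumes f: "integrable unit_measure f" and [measurable]: "f \<in> borel_measurable borel"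
  shows "integrable unit_measure (\<lambda>s. if dyadic_index N s = j then f s else 0)"
  by (rule Bochner_Integration.integrable_bound[OF f]) auto

lemma cell_integral_split:
  fixes f :: "real \<Rightarrow> real"
  assumes f: "integrable unit_measure f" and [measurable]: "f \<in> borel_measurable borel"
  shows "cell_integral f N j = cell_integral f (Suc N) (2 * j) + cell_integral f (Suc N) (2 * j + 1)"
proof -
  have "cell_integral f N j = (LINT s|unit_measure.
      (if dyadic_index (Suc N) s = 2 * j then f s else 0)
      + (if dyadic_index (Suc N) s = 2 * j + 1 then f s else 0))"
    unfolding cell_integral_def
  proof (rule integral_cong_AE)
    show "AE s in unit_measure. (if dyadic_index N s = j then f s else 0) =
        (if dyadic_index (Suc N) s = 2 * j then f s else 0)
        + (if dyadic_index (Suc N) s = 2 * j + 1 then f s else 0)"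
      using AE_unit_measure
    proof eventually_elim
      case (elim s)
      have "dyadic_index N s = j \<longleftrightarrow> dyadic_index (Suc N) s = 2 * j \<or> dyadic_index (Suc N) s = 2 * j + 1"
        using dyadic_index_Suc[of s N] elim by auto
      then show ?case by auto
    qed
  qed measurable
  also have "\<dots> = cell_integral f (Suc N) (2 * j) + cell_integral f (Suc N) (2 * j + 1)"
    unfolding cell_integral_def by (intro Bochner_Integration.integral_add integrable_cell assms)
  finally show ?thesis .
qed

text \<open>
  The first \<open>2\<^sup>N\<close> coefficients carry the square norm of the conditional expectation
  of \<open>f\<close> on the dyadic intervals of length \<open>2\<^sup>-\<^sup>N\<close>.
\<close>

lemma haar_partial_sum:
  fixes f :: "real \<Rightarrow> real"
  assumes f: "integrable unit_measure f" and fm: "f \<in> borel_measurable borel"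
  shows "(\<Sum>k<2 ^ N. (haar f k)\<^sup>2) = 2 ^ N * (\<Sum>j<2 ^ N. (cell_integral f N j)\<^sup>2)"
proof (induction N)
  case 0
  show ?case by (simp add: haar_def)
next
  case (Suc N)
  let ?I = "cell_integral f"
  have h: "haar f (2 ^ N + j) = sqrt (2 ^ N) * (?I (Suc N) (2 * j) - ?I (Suc N) (2 * j + 1))" if "j < 2 ^ N" for j
  proof -
    have "floor_log (2 ^ N + j) = N"
      using that by (intro floor_log_eqI) auto
    then show ?thesis by (simp add: haar_def Let_def)
  qed
  have split: "{..<2 ^ Suc N} = {..<2 ^ N} \<union> {2 ^ N..<2 ^ N + 2 ^ N::nat}" by auto
  have "(\<Sum>k<2 ^ Suc N. (haar f k)\<^sup>2)
      = (\<Sum>k<2 ^ N. (haar f k)\<^sup>2) + (\<Sum>k\<in>{2 ^ N..<2 ^ N + 2 ^ N}. (haar f k)\<^sup>2)"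
    unfolding split by (rule sum.union_disjoint) auto
  also have "(\<Sum>k\<in>{2 ^ N..<2 ^ N + 2 ^ N}. (haar f k)\<^sup>2) = (\<Sum>j<2 ^ N. (haar f (2 ^ N + j))\<^sup>2)"
    by (rule sum.reindex_bij_witness[where i = "\<lambda>j. 2 ^ N + j" and j = "\<lambda>k. k - 2 ^ N"]) auto
  also have "(\<Sum>k<2 ^ N. (haar f k)\<^sup>2) + (\<Sum>j<2 ^ N. (haar f (2 ^ N + j))\<^sup>2)
      = (\<Sum>j<2 ^ N. 2 ^ N * (?I N j)\<^sup>2 + 2 ^ N * (?I (Suc N) (2 * j) - ?I (Suc N) (2 * j + 1))\<^sup>2)"
    unfolding Suc.IH by (simp add: h sum.distrib sum_distrib_left power_mult_distrib)
  also have "\<dots> = (\<Sum>j<2 ^ N. 2 ^ Suc N * ((?I (Suc N) (2 * j))\<^sup>2 + (?I (Suc N) (2 * j + 1))\<^sup>2))"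
  proof -
    have "2 ^ N * (x + y)\<^sup>2 + 2 ^ N * (x - y)\<^sup>2 = 2 ^ Suc N * (x\<^sup>2 + y\<^sup>2)" for x y :: real
      by (simp add: power2_eq_square algebra_simps)
    then show ?thesis by (simp only: cell_integral_split[OF f fm, of N])
  qed
  also have "\<dots> = 2 ^ Suc N * (\<Sum>j<2 ^ N. (?I (Suc N) (2 * j))\<^sup>2 + (?I (Suc N) (2 * j + 1))\<^sup>2)"
    by (rule sum_distrib_left[symmetric])
  also have "(\<Sum>j<2 ^ N. (?I (Suc N) (2 * j))\<^sup>2 + (?I (Suc N) (2 * j + 1))\<^sup>2)
      = (\<Sum>j<2 ^ Suc N. (?I (Suc N) j)\<^sup>2)"
  proof -
    have "(\<Sum>j<2 ^ N. sum (\<lambda>j. (?I (Suc N) j)\<^sup>2) {j * 2..<j * 2 + 2}) = (\<Sum>j<2 ^ N * 2. (?I (Suc N) j)\<^sup>2)"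
      by (rule sum.nat_group)
    moreover have "{j * 2..<j * 2 + 2} = {2 * j, 2 * j + 1}" for j :: nat by auto
    ultimately show ?thesis by (simp add: mult.commute)
  qed
  finally show ?case .
qed

lemma haar_diff:
  fixes f g :: "real \<Rightarrow> real"
  assumes "integrable unit_measure f" "f \<in> borel_measurable borel"
    "integrable unit_measure g" "g \<in> borel_measurable borel"
  shows "haar (\<lambda>s. f s - g s) k = haar f k - haar g k"
proof -
  have d: "cell_integral (\<lambda>s. f s - g s) N j = cell_integral f N j - cell_integral g N j" for N j
  proof -
    have "cell_integral (\<lambda>s. f s - g s) N j = (LINT s|unit_measure.
        (if dyadic_index N s = j then f s else 0) - (if dyadic_index N s = j then g s else 0))"
      unfolding cell_integral_def by (rule Bochner_Integration.integral_cong) auto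
    also have "\<dots> = cell_integral f N j - cell_integral g N j"
      unfolding cell_integral_def by (intro Bochner_Integration.integral_diff integrable_cell assms)
    finally show ?thesis .
  qed
  show ?thesis unfolding haar_def Let_def d by (simp add: right_diff_distrib)
qed

lemma square_integrable:
  assumes [measurable]: "f \<in> borel_measurable borel" and f: "mass 2 f < \<infinity>"
  shows "integrable unit_measure (\<lambda>s. (f s)\<^sup>2)" "integrable unit_measure f"
    "(LINT s|unit_measure. (f s)\<^sup>2) = enn2real (mass 2 f)"
proof -
  show i: "integrable unit_measure (\<lambda>s. (f s)\<^sup>2)" "(LINT s|unit_measure. (f s)\<^sup>2) = enn2real (mass 2 f)"
    using f by (auto simp: integrable_iff_bounded mass_2 integral_eq_nn_integral)
  interpret finite_measure unit_measure by (rule finite_measure_unit)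
  show "integrable unit_measure f"
  proof (rule Bochner_Integration.integrable_bound)
    show "integrable unit_measure (\<lambda>s. 1 + (f s)\<^sup>2)" using i by simp
    have "\<bar>t\<bar> \<le> 1 + t\<^sup>2" for t :: real
      using zero_le_power2[of "\<bar>t\<bar> - 1"] zero_le_power2[of t] by (simp add: power2_eq_square algebra_simps)
    then show "AE s in unit_measure. norm (f s) \<le> norm (1 + (f s)\<^sup>2)" by (auto intro!: AE_I2)
  qed measurable
qed

lemma cell_measure:
  assumes j: "j < 2 ^ N"
  shows "(LINT s|unit_measure. (if dyadic_index N s = j then 1 else 0 :: real)) = 1 / 2 ^ N"
proof -
  define A where "A = {real j / 2 ^ N..<real (Suc j) / 2 ^ N}"
  have "(LINT s|unit_measure. (if dyadic_index N s = j then 1 else 0 :: real)) = (LINT s|unit_measure. indicator A s)"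
  proof (rule integral_cong_AE)
    show "AE s in unit_measure. (if dyadic_index N s = j then 1 else 0 :: real) = indicator A s"
      using AE_unit_measure
    proof eventually_elim
      case (elim s)
      have "dyadic_index N s = j \<longleftrightarrow> \<lfloor>2 ^ N * s\<rfloor> = int j"
        using elim by (auto simp: dyadic_index_def)
      also have "\<dots> \<longleftrightarrow> s \<in> A"
        by (auto simp: A_def floor_eq_iff field_simps)
      finally show ?case by (simp add: indicator_def)
    qed
    show "(\<lambda>s. indicator A s :: real) \<in> borel_measurable unit_measure"
      by (intro borel_imp_unit) (simp add: A_def)
  qed measurable
  also have "\<dots> = measure unit_measure (A \<inter> space unit_measure)"
    by simp
  also have "A \<subseteq> {0..1}"
  proof
    fix s assume s: "s \<in> A"
    have "real (Suc j) \<le> 2 ^ N" using j by (metis Suc_leI of_nat_le_iff of_nat_numeral of_nat_power)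
    then have "real (Suc j) / 2 ^ N \<le> 1" by simp
    moreover have "0 \<le> real j / 2 ^ N" by simp
    ultimately show "s \<in> {0..1}" using s unfolding A_def atLeastLessThan_iff atLeastAtMost_iff by linarith
  qed
  then have "measure unit_measure (A \<inter> space unit_measure) = measure lborel A"
    by (simp add: space_restrict_space measure_restrict_space Int_absorb2)
  also have "\<dots> = 1 / 2 ^ N" by (simp add: A_def divide_right_mono diff_divide_distrib[symmetric])
  finally show ?thesis .
qed

text \<open>
  The distance in \<open>L_2\<close> from \<open>f\<close> to a dyadic step function, by the theorem of
  Pythagoras: the last term measures how far the step function is from the conditional expectation of
  \<open>f\<close>.
\<close>

lemma haar_approximation:
  assumes fm [measurable]: "f \<in> borel_measurable borel" and f: "mass 2 f < \<infinity>"
  shows "(LINT s|unit_measure. (f s - b (dyadic_index N s))\<^sup>2)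
    = enn2real (mass 2 f) - (\<Sum>k<2 ^ N. (haar f k)\<^sup>2)
      + (\<Sum>j<2 ^ N. (b j - 2 ^ N * cell_integral f N j)\<^sup>2) / 2 ^ N"
proof -
  note fi = square_integrable[OF fm f]
  interpret finite_measure unit_measure by (rule finite_measure_unit)
  have ci: "integrable unit_measure (\<lambda>s. if dyadic_index N s = j then 1 else 0 :: real)" for j
    by (rule integrable_cell[where f = "\<lambda>_. 1"]) auto
  have "(LINT s|unit_measure. (f s - b (dyadic_index N s))\<^sup>2) = (LINT s|unit_measure.
      (f s)\<^sup>2 - (\<Sum>j<2 ^ N. 2 * b j * (if dyadic_index N s = j then f s else 0))
        + (\<Sum>j<2 ^ N. (b j)\<^sup>2 * (if dyadic_index N s = j then 1 else 0)))"
  proof (rule integral_cong_AE)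
    show "AE s in unit_measure. (f s - b (dyadic_index N s))\<^sup>2 =
      (f s)\<^sup>2 - (\<Sum>j<2 ^ N. 2 * b j * (if dyadic_index N s = j then f s else 0))
        + (\<Sum>j<2 ^ N. (b j)\<^sup>2 * (if dyadic_index N s = j then 1 else 0))"
      using AE_unit_measure
    proof eventually_elim
      case (elim s)
      then have "dyadic_index N s < 2 ^ N" by (intro dyadic_index_less) auto
      then show ?case by (simp add: if_distrib[of "\<lambda>x. _ * x"] power2_diff cong: if_cong)
    qed
  qed measurable
  also have "\<dots> = enn2real (mass 2 f) - (\<Sum>j<2 ^ N. 2 * b j * cell_integral f N j)
        + (\<Sum>j<2 ^ N. (b j)\<^sup>2 * (1 / 2 ^ N))"
    using fi integrable_cell[OF fi(2) fm] ci
    by (simp add: cell_integral_def[of f, symmetric] cell_measure)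
  also have "\<dots> = enn2real (mass 2 f) - (\<Sum>k<2 ^ N. (haar f k)\<^sup>2)
      + (\<Sum>j<2 ^ N. (b j - 2 ^ N * cell_integral f N j)\<^sup>2) / 2 ^ N"
  proof -
    have "(\<Sum>j<2 ^ N. (b j - 2 ^ N * cell_integral f N j)\<^sup>2) / 2 ^ N
        = (\<Sum>j<2 ^ N. (b j)\<^sup>2 * (1 / 2 ^ N) - 2 * b j * cell_integral f N j + 2 ^ N * (cell_integral f N j)\<^sup>2)"
      unfolding sum_divide_distrib
      by (intro sum.cong refl) (simp add: power2_eq_square field_simps)
    then show ?thesis
      unfolding haar_partial_sum[OF fi(2) fm] by (simp add: sum.distrib sum_subtractf sum_distrib_left)
  qed
  finally show ?thesis .
qed


text \<open>
  Dyadic step functions are dense in \<open>L_2\<close>: truncate \<open>f\<close>, replace it by a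
  truncated continuous function, and sample that function at the left end points of the dyadic
  intervals.
\<close>

lemma dyadic_step_dense:
  assumes fm [measurable]: "f \<in> borel_measurable borel" and f: "mass 2 f < \<infinity>" and e: "e > 0"
  shows "\<exists>N b. (LINT s|unit_measure. (f s - b (dyadic_index N s))\<^sup>2) < e"
proof -
  note fi = square_integrable[OF fm f]
  interpret finite_measure unit_measure by (rule finite_measure_unit)
  \<comment> \<open>truncation at level \<open>M\<close>\<close>
  define c where "c M t = max (- real M) (min (real M) t)" for M :: nat and t :: real
  have [measurable]: "c M \<in> borel_measurable borel" for M unfolding c_def by measurable
  have cb: "\<bar>c M t\<bar> \<le> real M" for M t by (auto simp: c_def)
  have cc: "isCont (c M) t" for M t unfolding c_def[abs_def] by (intro continuous_intros)
  have sq: "(x - y)\<^sup>2 \<le> (2 * r)\<^sup>2" if "\<bar>x\<bar> \<le> r" "\<bar>y\<bar> \<le> r" for x y r :: real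
    using that by (intro abs_le_square_iff[THEN iffD1]) auto
  have "(\<lambda>M. LINT s|unit_measure. (f s - c M (f s))\<^sup>2) \<longlonglongrightarrow> (LINT s|unit_measure. 0)"
  proof (rule integral_dominated_convergence[where w = "\<lambda>s. (f s)\<^sup>2"])
    show "AE s in unit_measure. (\<lambda>M. (f s - c M (f s))\<^sup>2) \<longlonglongrightarrow> 0"
    proof (rule AE_I2)
      fix s
      obtain M0 where "\<bar>f s\<bar> \<le> real M0" using real_arch_simple by blast
      then have "\<forall>\<^sub>F M in sequentially. (f s - c M (f s))\<^sup>2 = 0"
        by (intro eventually_mono[OF eventually_ge_at_top[of M0]]) (auto simp: c_def max_def min_def)
      then show "(\<lambda>M. (f s - c M (f s))\<^sup>2) \<longlonglongrightarrow> 0" by (rule tendsto_eventually)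
    qed
    have "(t - c M t)\<^sup>2 \<le> t\<^sup>2" for M t
      by (intro abs_le_square_iff[THEN iffD1]) (auto simp: c_def)
    then show "AE s in unit_measure. norm ((f s - c M (f s))\<^sup>2) \<le> (f s)\<^sup>2" for M by simp
  qed (use fi in measurable)
  then have "(\<lambda>M. LINT s|unit_measure. (f s - c M (f s))\<^sup>2) \<longlonglongrightarrow> 0" by simp
  then have "\<forall>\<^sub>F M in sequentially. (LINT s|unit_measure. (f s - c M (f s))\<^sup>2) < e / 9"
    by (rule order_tendstoD) (use e in simp)
  then obtain M where M: "(LINT s|unit_measure. (f s - c M (f s))\<^sup>2) < e / 9"
    by (auto dest: eventually_happens)
  have "f \<in> borel_measurable (lebesgue_on UNIV)"
    by (intro measurable_restrict_space1 measurable_completion) simp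
  then have "f measurable_on UNIV" by (subst measurable_on_iff_borel_measurable) auto
  then obtain Z g where Z: "negligible Z" and g: "\<And>n. continuous_on UNIV (g n)"
    and gf: "\<And>x. x \<notin> Z \<Longrightarrow> (\<lambda>n. g n x) \<longlonglongrightarrow> f x"
    unfolding measurable_on_def by auto
  have [measurable]: "g n \<in> borel_measurable borel" for n
    by (rule borel_measurable_continuous_onI[OF g])
  have "AE x in lebesgue. x \<notin> Z"
    using Z by (intro AE_not_in) (simp add: negligible_iff_null_sets)
  then have "AE x in lborel. x \<notin> Z" by (simp add: AE_completion_iff)
  then have aeZ: "AE x in unit_measure. x \<notin> Z"
    by (subst AE_restrict_space_iff) (auto elim!: eventually_mono)
  have "(\<lambda>n. LINT s|unit_measure. (c M (f s) - c M (g n s))\<^sup>2) \<longlonglongrightarrow> (LINT s|unit_measure. 0)"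
  proof (rule integral_dominated_convergence[where w = "\<lambda>s. (2 * real M)\<^sup>2"])
    show "AE s in unit_measure. (\<lambda>n. (c M (f s) - c M (g n s))\<^sup>2) \<longlonglongrightarrow> 0"
      using aeZ
    proof eventually_elim
      case (elim s)
      have "(\<lambda>n. c M (g n s)) \<longlonglongrightarrow> c M (f s)" by (rule isCont_tendsto_compose[OF cc gf[OF elim]])
      then have "(\<lambda>n. (c M (f s) - c M (g n s))\<^sup>2) \<longlonglongrightarrow> (c M (f s) - c M (f s))\<^sup>2"
        by (intro tendsto_intros)
      then show ?case by simp
    qed
    show "AE s in unit_measure. norm ((c M (f s) - c M (g n s))\<^sup>2) \<le> (2 * real M)\<^sup>2" for n
      using sq[OF cb cb] by simp
  qed auto
  then have "(\<lambda>n. LINT s|unit_measure. (c M (f s) - c M (g n s))\<^sup>2) \<longlonglongrightarrow> 0" by simp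
  then have "\<forall>\<^sub>F n in sequentially. (LINT s|unit_measure. (c M (f s) - c M (g n s))\<^sup>2) < e / 9"
    by (rule order_tendstoD) (use e in simp)
  then obtain n where n: "(LINT s|unit_measure. (c M (f s) - c M (g n s))\<^sup>2) < e / 9"
    by (auto dest: eventually_happens)
  define b where "b N j = c M (g n (real j / 2 ^ N))" for N j
  have bm [measurable]: "(\<lambda>s. b N (dyadic_index N s)) \<in> borel_measurable borel" for N
    by (rule measurable_compose[OF dyadic_index_measurable]) simp
  have "(\<lambda>N. LINT s|unit_measure. (c M (g n s) - b N (dyadic_index N s))\<^sup>2) \<longlonglongrightarrow> (LINT s|unit_measure. 0)"
  proof (rule integral_dominated_convergence[where w = "\<lambda>s. (2 * real M)\<^sup>2"])
    show "AE s in unit_measure. (\<lambda>N. (c M (g n s) - b N (dyadic_index N s))\<^sup>2) \<longlonglongrightarrow> 0"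
      using AE_unit_measure
    proof eventually_elim
      case (elim s)
      have d: "\<bar>real (dyadic_index N s) / 2 ^ N - s\<bar> \<le> (1 / 2) ^ N" for N
      proof -
        have "real (dyadic_index N s) = of_int \<lfloor>2 ^ N * s\<rfloor>" using elim by (simp add: dyadic_index_def)
        then have "\<bar>real (dyadic_index N s) - 2 ^ N * s\<bar> \<le> 1" by linarith
        then have "\<bar>real (dyadic_index N s) - 2 ^ N * s\<bar> / 2 ^ N \<le> 1 / 2 ^ N" by (simp add: divide_right_mono)
        moreover have "real (dyadic_index N s) / 2 ^ N - s = (real (dyadic_index N s) - 2 ^ N * s) / 2 ^ N"
          by (simp add: field_simps)
        ultimately show ?thesis by (simp add: power_one_over)
      qed
      have "(\<lambda>N. real (dyadic_index N s) / 2 ^ N - s) \<longlonglongrightarrow> 0"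
        by (rule Lim_null_comparison[of _ "\<lambda>N. (1 / 2) ^ N"]) (use d in \<open>auto intro!: LIMSEQ_power_zero\<close>)
      then have "(\<lambda>N. real (dyadic_index N s) / 2 ^ N) \<longlonglongrightarrow> s" by (simp add: LIM_zero_iff)
      moreover have "isCont (g n) s" using g[of n] by (simp add: continuous_on_eq_continuous_at)
      ultimately have "(\<lambda>N. c M (g n (real (dyadic_index N s) / 2 ^ N))) \<longlonglongrightarrow> c M (g n s)"
        by (intro isCont_tendsto_compose[OF cc] isCont_tendsto_compose[of s "g n"])
      then have "(\<lambda>N. (c M (g n s) - b N (dyadic_index N s))\<^sup>2) \<longlonglongrightarrow> (c M (g n s) - c M (g n s))\<^sup>2"
        unfolding b_def by (intro tendsto_intros)
      then show ?case by simp
    qed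
    show "AE s in unit_measure. norm ((c M (g n s) - b N (dyadic_index N s))\<^sup>2) \<le> (2 * real M)\<^sup>2" for N
      using sq[OF cb cb] by (simp add: b_def)
  qed auto
  then have "(\<lambda>N. LINT s|unit_measure. (c M (g n s) - b N (dyadic_index N s))\<^sup>2) \<longlonglongrightarrow> 0" by simp
  then have "\<forall>\<^sub>F N in sequentially. (LINT s|unit_measure. (c M (g n s) - b N (dyadic_index N s))\<^sup>2) < e / 9"
    by (rule order_tendstoD) (use e in simp)
  then obtain N where N: "(LINT s|unit_measure. (c M (g n s) - b N (dyadic_index N s))\<^sup>2) < e / 9"
    by (auto dest: eventually_happens)
  have bb: "\<bar>b N j\<bar> \<le> real M" for j unfolding b_def by (rule cb)
  have i1: "integrable unit_measure (\<lambda>s. (f s - c M (f s))\<^sup>2)"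
  proof (rule Bochner_Integration.integrable_bound[OF fi(1)])
    have "(t - c M t)\<^sup>2 \<le> t\<^sup>2" for t
      by (intro abs_le_square_iff[THEN iffD1]) (auto simp: c_def)
    then show "AE s in unit_measure. norm ((f s - c M (f s))\<^sup>2) \<le> norm ((f s)\<^sup>2)" by simp
  qed measurable
  have i2: "integrable unit_measure (\<lambda>s. (c M (f s) - c M (g n s))\<^sup>2)"
    using sq[OF cb cb] by (intro integrable_const_bound[of _ "(2 * real M)\<^sup>2"]) auto
  have i3: "integrable unit_measure (\<lambda>s. (c M (g n s) - b N (dyadic_index N s))\<^sup>2)"
    using sq[OF cb bb] by (intro integrable_const_bound[of _ "(2 * real M)\<^sup>2"]) auto
  have tri: "(x + y + z)\<^sup>2 \<le> 3 * x\<^sup>2 + 3 * y\<^sup>2 + 3 * z\<^sup>2" for x y z :: real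
    using zero_le_power2[of "x - y"] zero_le_power2[of "y - z"] zero_le_power2[of "x - z"]
    by (simp add: power2_eq_square algebra_simps)
  have pt: "(f s - b N (dyadic_index N s))\<^sup>2 \<le> 3 * (f s - c M (f s))\<^sup>2
      + 3 * (c M (f s) - c M (g n s))\<^sup>2 + 3 * (c M (g n s) - b N (dyadic_index N s))\<^sup>2" for s
    using tri[of "f s - c M (f s)" "c M (f s) - c M (g n s)" "c M (g n s) - b N (dyadic_index N s)"] by simp
  have "(LINT s|unit_measure. (f s - b N (dyadic_index N s))\<^sup>2)
      \<le> (LINT s|unit_measure. 3 * (f s - c M (f s))\<^sup>2
      + 3 * (c M (f s) - c M (g n s))\<^sup>2 + 3 * (c M (g n s) - b N (dyadic_index N s))\<^sup>2)"
    using i1 i2 i3 pt by (intro integral_mono') auto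
  also have "\<dots> = 3 * (LINT s|unit_measure. (f s - c M (f s))\<^sup>2)
      + 3 * (LINT s|unit_measure. (c M (f s) - c M (g n s))\<^sup>2)
      + 3 * (LINT s|unit_measure. (c M (g n s) - b N (dyadic_index N s))\<^sup>2)"
    using i1 i2 i3 by simp
  also have "\<dots> < e" using M n N by linarith
  finally show ?thesis by blast
qed

theorem haar_parseval:
  assumes fm: "f \<in> borel_measurable borel" and f: "mass 2 f < \<infinity>"
  shows "(\<lambda>k. (haar f k)\<^sup>2) sums enn2real (mass 2 f)"
proof -
  let ?Q = "\<lambda>n. \<Sum>k<n. (haar f k)\<^sup>2"
  have nn: "0 \<le> (LINT s|unit_measure. (f s - 2 ^ N * cell_integral f N (dyadic_index N s))\<^sup>2)" for N
    by (intro integral_nonneg_AE) simp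
  have le: "?Q (2 ^ N) \<le> enn2real (mass 2 f)" for N
    using haar_approximation[OF fm f, of "\<lambda>j. 2 ^ N * cell_integral f N j" N]
      nn[of N] by simp
  have mono: "?Q m \<le> ?Q n" if "m \<le> n" for m n
    using that by (intro sum_mono2) auto
  have le': "?Q n \<le> enn2real (mass 2 f)" for n
    using mono[of n "2 ^ n"] le[of n] less_exp[of n] by linarith
  have "?Q \<longlonglongrightarrow> enn2real (mass 2 f)"
  proof (rule LIMSEQ_I)
    fix e :: real assume e: "e > 0"
    obtain N b where "(LINT s|unit_measure. (f s - b (dyadic_index N s))\<^sup>2) < e"
      using dyadic_step_dense[OF fm f e] by blast
    moreover have "0 \<le> (\<Sum>j<2 ^ N. (b j - 2 ^ N * cell_integral f N j)\<^sup>2) / 2 ^ N"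
      by (intro divide_nonneg_nonneg sum_nonneg) auto
    ultimately have "enn2real (mass 2 f) - ?Q (2 ^ N) < e"
      unfolding haar_approximation[OF fm f] by linarith
    then have "norm (?Q n - enn2real (mass 2 f)) < e" if "n \<ge> 2 ^ N" for n
      using mono[OF that] le'[of n] by simp
    then show "\<exists>no. \<forall>n\<ge>no. norm (?Q n - enn2real (mass 2 f)) < e" by blast
  qed
  then show ?thesis by (simp add: sums_def)
qed

theorem L2_embeds_Lq:
  assumes q: "0 < q" "q \<le> 2"
  shows "embeds_quasisymmetrically (Lp 2) (Lp q)"
proof -
  obtain c C where c: "c > 0" and C: "C > 0"
    and bd: "\<And>a b. summable (\<lambda>k. (a k)\<^sup>2) \<Longrightarrow> summable (\<lambda>k. (b k)\<^sup>2) \<Longrightarrow>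
      ennreal (c * (\<Sum>k. (a k - b k)\<^sup>2) powr (q / 2))
        \<le> mass q (\<lambda>s. rademacher_series a s - rademacher_series b s) \<and>
      mass q (\<lambda>s. rademacher_series a s - rademacher_series b s)
        \<le> ennreal (C * (\<Sum>k. (a k - b k)\<^sup>2) powr (q / 2))"
    by (rule rademacher_series_distance[OF q]) blast
  show ?thesis
  proof (rule Lp_embeds_criterion[of 2 q c C "q / 2" "\<lambda>f. rademacher_series (haar f)"])
    fix f assume f: "f \<in> borel_measurable borel" "mass 2 f < \<infinity>"
    have sf: "summable (\<lambda>k. (haar f k)\<^sup>2)" using haar_parseval[OF f] by (rule sums_summable)
    have rm: "rademacher_series (haar f) \<in> borel_measurable borel" by (rule rademacher_series(1)[OF sf])
    have "mass 2 (rademacher_series (haar f)) \<le> ennreal (\<Sum>k. (haar f k)\<^sup>2)"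
      using rademacher_series(2)[OF sf, of 0] by (simp add: rademacher_sum_def)
    then have "mass 2 (rademacher_series (haar f)) \<le> ennreal ((\<Sum>k. (haar f k)\<^sup>2) * 1)" by simp
    then have "mass q (rademacher_series (haar f)) \<le> ennreal ((1 + (\<Sum>k. (haar f k)\<^sup>2)) * 1 powr (q / 2))"
      using suminf_nonneg[OF sf] rm by (intro mass_le_of_mass_2_le[OF q]) auto
    then have "mass q (rademacher_series (haar f)) < \<infinity>" by (rule le_less_trans) simp
    with rm show "rademacher_series (haar f) \<in> borel_measurable borel \<and> mass q (rademacher_series (haar f)) < \<infinity>"
      by blast
    fix g assume g: "g \<in> borel_measurable borel" "mass 2 g < \<infinity>"
    have sg: "summable (\<lambda>k. (haar g k)\<^sup>2)" using haar_parseval[OF g] by (rule sums_summable)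
    have fg: "(\<lambda>s. f s - g s) \<in> borel_measurable borel" using f g by measurable
    have fgm: "mass 2 (\<lambda>s. f s - g s) < \<infinity>" by (rule mass_diff_finite[OF _ f g]) simp
    have "(\<lambda>k. (haar f k - haar g k)\<^sup>2) sums enn2real (mass 2 (\<lambda>s. f s - g s))"
      using haar_parseval[OF fg fgm]
      unfolding haar_diff[OF square_integrable(2)[OF f] f(1) square_integrable(2)[OF g] g(1)] .
    then have e: "(\<Sum>k. (haar f k - haar g k)\<^sup>2) = enn2real (mass 2 (\<lambda>s. f s - g s))"
      by (rule sums_unique[symmetric])
    have b: "ennreal (c * enn2real (mass 2 (\<lambda>s. f s - g s)) powr (q / 2))
        \<le> mass q (\<lambda>s. rademacher_series (haar f) s - rademacher_series (haar g) s)"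
      "mass q (\<lambda>s. rademacher_series (haar f) s - rademacher_series (haar g) s)
        \<le> ennreal (C * enn2real (mass 2 (\<lambda>s. f s - g s)) powr (q / 2))"
      using bd[OF sf sg] unfolding e by auto
    obtain s where s: "mass q (\<lambda>s. rademacher_series (haar f) s - rademacher_series (haar g) s) = ennreal s" "s \<ge> 0"
      using b(2) by (cases "mass q (\<lambda>s. rademacher_series (haar f) s - rademacher_series (haar g) s)") (auto simp: top_unique)
    show "c * enn2real (mass 2 (\<lambda>s. f s - g s)) powr (q / 2)
        \<le> enn2real (mass q (\<lambda>s. rademacher_series (haar f) s - rademacher_series (haar g) s)) \<and>
      enn2real (mass q (\<lambda>s. rademacher_series (haar f) s - rademacher_series (haar g) s))
        \<le> C * enn2real (mass 2 (\<lambda>s. f s - g s)) powr (q / 2)"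
      using b s(2) C unfolding s(1) by (auto simp: ennreal_le_iff)
  qed (use q c C in auto)
qed

section \<open>Convexity inequalities for finite sums\<close>

lemma powr_sum_le:
  fixes a :: "'i \<Rightarrow> real"
  assumes I: "finite I" and r: "1 \<le> r" and a: "\<And>i. i \<in> I \<Longrightarrow> 0 \<le> a i"
  shows "(\<Sum>i\<in>I. a i) powr r \<le> real (card I) powr (r - 1) * (\<Sum>i\<in>I. a i powr r)"
proof (cases "I = {}")
  case False
  define N where "N = real (card I)"
  have N: "N > 0" using I False by (simp add: N_def card_gt_0_iff)
  have cv: "convex_on {0..} (\<lambda>x::real. x powr r)"
  proof (rule convex_onI)
    fix t x y :: real
    assume "0 < t" "t < 1" "x \<in> {0..}" "y \<in> {0..}"
    then show "((1 - t) *\<^sub>R x + t *\<^sub>R y) powr r \<le> (1 - t) * x powr r + t * y powr r"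
      using powr_convex_nonneg[OF r, of "1 - t" x y] by simp
  qed (rule convex_real_interval)
  have "(\<Sum>i\<in>I. (1 / N) *\<^sub>R a i) powr r \<le> (\<Sum>i\<in>I. (1 / N) * (a i powr r))"
    using I False N a by (intro convex_on_sum[OF _ _ cv]) (auto simp: N_def)
  then have "((1 / N) * (\<Sum>i\<in>I. a i)) powr r \<le> (1 / N) * (\<Sum>i\<in>I. a i powr r)"
    by (simp add: sum_distrib_left)
  moreover have "((1 / N) * (\<Sum>i\<in>I. a i)) powr r = (\<Sum>i\<in>I. a i) powr r / N powr r"
    using N a by (simp add: powr_divide sum_nonneg)
  ultimately have "(\<Sum>i\<in>I. a i) powr r \<le> N powr r * ((1 / N) * (\<Sum>i\<in>I. a i powr r))"
    using N by (simp add: divide_le_eq mult.commute)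
  also have "\<dots> = N powr (r - 1) * (\<Sum>i\<in>I. a i powr r)"
    using N by (simp add: powr_diff)
  finally show ?thesis by (simp add: N_def)
qed simp

lemma sum_powr_le_powr_sum:
  fixes a :: "'i \<Rightarrow> real"
  assumes I: "finite I" and r: "1 \<le> r" and a: "\<And>i. i \<in> I \<Longrightarrow> 0 \<le> a i"
  shows "(\<Sum>i\<in>I. a i powr r) \<le> (\<Sum>i\<in>I. a i) powr r"
proof -
  define S where "S = (\<Sum>i\<in>I. a i)"
  have split: "x powr r = x * x powr (r - 1)" if "0 \<le> x" for x :: real
    using that by (cases "x = 0") (simp_all add: powr_diff)
  have "(\<Sum>i\<in>I. a i powr r) \<le> (\<Sum>i\<in>I. a i * S powr (r - 1))"
  proof (rule sum_mono)
    fix i assume i: "i \<in> I"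
    then have "a i \<le> S" unfolding S_def using I a by (intro member_le_sum) auto
    then show "a i powr r \<le> a i * S powr (r - 1)"
      using i a r split by (auto intro!: mult_left_mono powr_mono2)
  qed
  also have "\<dots> = S powr r"
    using split[of S] a by (simp add: S_def sum_distrib_right sum_nonneg)
  finally show ?thesis by (simp add: S_def)
qed

section \<open>Metric cotype of the real line\<close>

text \<open>
  The discrete torus \<open>(\<int>/m)\<^sup>n\<close>, by representatives. A function on it is taken as
  a function of all integer vectors that is \<open>periodic\<close>, that is, depends only on the
  residues modulo \<open>m\<close> of the first \<open>n\<close> coordinates, so that translations need
  no reduction modulo \<open>m\<close>.
\<close>

definition torus :: "nat \<Rightarrow> int \<Rightarrow> (nat \<Rightarrow> int) set" where
  "torus n m = {..<n} \<rightarrow>\<^sub>E {0..<m}"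

definition periodic :: "nat \<Rightarrow> int \<Rightarrow> ((nat \<Rightarrow> int) \<Rightarrow> 'a) \<Rightarrow> bool" where
  "periodic n m H \<longleftrightarrow> (\<forall>x y. (\<forall>i<n. x i mod m = y i mod m) \<longrightarrow> H x = H y)"

lemma periodicD: "periodic n m H \<Longrightarrow> (\<And>i. i < n \<Longrightarrow> x i mod m = y i mod m) \<Longrightarrow> H x = H y"
  by (simp add: periodic_def)

lemma finite_torus [simp]: "finite (torus n m)"
  unfolding torus_def by (intro finite_PiE) auto

lemma sum_torus_shift:
  assumes m: "m > 0" and H: "periodic n m H"
  shows "(\<Sum>x\<in>torus n m. H (\<lambda>i. x i + v i)) = (\<Sum>x\<in>torus n m. H x)"
proof (rule sum.reindex_bij_witness[where
      i = "\<lambda>y. restrict (\<lambda>i. (y i - v i) mod m) {..<n}" and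
      j = "\<lambda>x. restrict (\<lambda>i. (x i + v i) mod m) {..<n}"])
  fix x assume x: "x \<in> torus n m"
  then have xm: "i < n \<Longrightarrow> x i mod m = x i" for i by (auto simp: torus_def PiE_iff)
  have ext: "x i = undefined" if "\<not> i < n" for i
    using x that by (auto simp: torus_def PiE_iff extensional_def)
  show "restrict (\<lambda>i. (x i + v i) mod m) {..<n} \<in> torus n m"
    "restrict (\<lambda>i. (x i - v i) mod m) {..<n} \<in> torus n m"
    using m by (auto simp: torus_def)
  show "restrict (\<lambda>i. (restrict (\<lambda>i. (x i + v i) mod m) {..<n} i - v i) mod m) {..<n} = x"
    "restrict (\<lambda>i. (restrict (\<lambda>i. (x i - v i) mod m) {..<n} i + v i) mod m) {..<n} = x"
    using xm ext by (auto simp: fun_eq_iff mod_simps)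
  show "H (restrict (\<lambda>i. (x i + v i) mod m) {..<n}) = H (\<lambda>i. x i + v i)"
    by (rule periodicD[OF H]) simp
qed

text \<open>
  The vertices of the cube \<open>{-1, 1}\<^sup>n\<close>.
\<close>

definition signs :: "nat \<Rightarrow> (nat \<Rightarrow> int) set" where
  "signs n = {..<n} \<rightarrow>\<^sub>E {-1, 1}"

lemma finite_signs [simp]: "finite (signs n)"
  unfolding signs_def by (intro finite_PiE) auto

lemma card_signs_pos: "card (signs n) > 0"
  by (simp add: signs_def card_PiE)

lemma signs_cases: "\<epsilon> \<in> signs n \<Longrightarrow> j < n \<Longrightarrow> \<epsilon> j = 1 \<or> \<epsilon> j = -1"
  by (auto simp: signs_def PiE_iff)

lemma sum_signs_flip:
  assumes j: "j < n"
  shows "(\<Sum>\<epsilon>\<in>signs n. G (\<epsilon>(j := - \<epsilon> j))) = (\<Sum>\<epsilon>\<in>signs n. G \<epsilon>)"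
proof (rule sum.reindex_bij_witness[where i = "\<lambda>\<epsilon>. \<epsilon>(j := - \<epsilon> j)" and j = "\<lambda>\<epsilon>. \<epsilon>(j := - \<epsilon> j)"])
  fix \<epsilon> assume "\<epsilon> \<in> signs n"
  then show "\<epsilon>(j := - \<epsilon> j) \<in> signs n"
    using j by (auto simp: signs_def PiE_iff extensional_def)
  then show "\<epsilon>(j := - \<epsilon> j) \<in> signs n" .
qed auto

lemma sum_signs_orthogonal:
  assumes "i < n" "j < n"
  shows "(\<Sum>\<epsilon>\<in>signs n. real_of_int (\<epsilon> i) * real_of_int (\<epsilon> j))
    = (if i = j then real (card (signs n)) else 0)"
proof (cases "i = j")
  case True
  have "real_of_int (\<epsilon> i) * real_of_int (\<epsilon> j) = 1" if "\<epsilon> \<in> signs n" for \<epsilon>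
    using signs_cases[OF that assms(1)] True by auto
  then show ?thesis using True by simp
next
  case False
  have "(\<Sum>\<epsilon>\<in>signs n. real_of_int (\<epsilon> i) * real_of_int (\<epsilon> j))
      = (\<Sum>\<epsilon>\<in>signs n. - (real_of_int (\<epsilon> i) * real_of_int (\<epsilon> j)))"
    using sum_signs_flip[OF assms(1), of "\<lambda>\<epsilon>. real_of_int (\<epsilon> i) * real_of_int (\<epsilon> j)"] False by simp
  then show ?thesis using False by (simp add: sum_negf)
qed

text \<open>
  The inequality of Bessel for the orthogonal coordinate functions on the cube.
\<close>

lemma bessel_signs:
  fixes g :: "(nat \<Rightarrow> int) \<Rightarrow> real" and n :: nat
  defines "N \<equiv> real (card (signs n))"
  defines "c \<equiv> \<lambda>j. (\<Sum>\<epsilon>\<in>signs n. real_of_int (\<epsilon> j) * g \<epsilon>) / N"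
  shows "(\<Sum>j<n. (c j)\<^sup>2) \<le> (\<Sum>\<epsilon>\<in>signs n. (g \<epsilon>)\<^sup>2) / N"
proof -
  have N: "N > 0" using card_signs_pos by (simp add: N_def)
  have "0 \<le> (\<Sum>\<epsilon>\<in>signs n. (g \<epsilon> - (\<Sum>j<n. c j * real_of_int (\<epsilon> j)))\<^sup>2)"
    by (intro sum_nonneg) auto
  also have "\<dots> = (\<Sum>\<epsilon>\<in>signs n. (g \<epsilon>)\<^sup>2)
      - 2 * (\<Sum>\<epsilon>\<in>signs n. \<Sum>j<n. c j * (real_of_int (\<epsilon> j) * g \<epsilon>))
      + (\<Sum>\<epsilon>\<in>signs n. (\<Sum>j<n. c j * real_of_int (\<epsilon> j))\<^sup>2)"
    by (simp add: power2_diff sum.distrib sum_subtractf sum_distrib_left algebra_simps)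
  also have "(\<Sum>\<epsilon>\<in>signs n. \<Sum>j<n. c j * (real_of_int (\<epsilon> j) * g \<epsilon>)) = (\<Sum>j<n. N * (c j)\<^sup>2)"
  proof -
    have "(\<Sum>\<epsilon>\<in>signs n. real_of_int (\<epsilon> j) * g \<epsilon>) = N * c j" for j
      using N by (simp add: c_def)
    then show ?thesis
      by (subst sum.swap) (simp add: sum_distrib_left[symmetric] power2_eq_square mult_ac)
  qed
  also have "(\<Sum>\<epsilon>\<in>signs n. (\<Sum>j<n. c j * real_of_int (\<epsilon> j))\<^sup>2)
      = (\<Sum>\<epsilon>\<in>signs n. \<Sum>i<n. \<Sum>j<n. c i * c j * (real_of_int (\<epsilon> i) * real_of_int (\<epsilon> j)))"
    by (simp add: power2_eq_square sum_product mult_ac)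
  also have "\<dots> = (\<Sum>i<n. \<Sum>j<n. c i * c j * (\<Sum>\<epsilon>\<in>signs n. real_of_int (\<epsilon> i) * real_of_int (\<epsilon> j)))"
    by (subst sum.swap, intro sum.cong refl, subst sum.swap) (simp add: sum_distrib_left)
  also have "\<dots> = (\<Sum>i<n. \<Sum>j<n. if i = j then N * (c i)\<^sup>2 else 0)"
    by (intro sum.cong refl) (auto simp: sum_signs_orthogonal N_def power2_eq_square)
  also have "\<dots> = (\<Sum>j<n. N * (c j)\<^sup>2)" by simp
  finally have "(\<Sum>j<n. N * (c j)\<^sup>2) \<le> (\<Sum>\<epsilon>\<in>signs n. (g \<epsilon>)\<^sup>2)" by linarith
  then have "N * (\<Sum>j<n. (c j)\<^sup>2) \<le> (\<Sum>\<epsilon>\<in>signs n. (g \<epsilon>)\<^sup>2)"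
    by (simp add: sum_distrib_left)
  then show ?thesis using N by (simp add: le_divide_eq mult.commute)
qed

text \<open>
  For \<open>q \<ge> 2\<close> the sum of the \<open>\<bar>c\<^sub>j\<bar>\<^sup>q\<close> is at most
  the power \<open>q / 2\<close> of the sum of the squares, and the power of the mean of
  \<open>g\<^sup>2\<close> is at most the mean of \<open>\<bar>g\<bar>\<^sup>q\<close>.
\<close>

lemma bessel_signs_powr:
  fixes g :: "(nat \<Rightarrow> int) \<Rightarrow> real" and n :: nat
  assumes q: "2 \<le> q"
  defines "N \<equiv> real (card (signs n))"
  defines "c \<equiv> \<lambda>j. (\<Sum>\<epsilon>\<in>signs n. real_of_int (\<epsilon> j) * g \<epsilon>) / N"
  shows "(\<Sum>j<n. \<bar>c j\<bar> powr q) \<le> (\<Sum>\<epsilon>\<in>signs n. \<bar>g \<epsilon>\<bar> powr q) / N"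
proof -
  have N: "N > 0" using card_signs_pos by (simp add: N_def)
  have sq: "\<bar>t\<bar> powr q = (t\<^sup>2) powr (q / 2)" for t :: real
  proof -
    have "t\<^sup>2 = \<bar>t\<bar> powr 2" by simp
    then show ?thesis by (simp only: powr_powr) simp
  qed
  have "(\<Sum>j<n. \<bar>c j\<bar> powr q) \<le> (\<Sum>j<n. (c j)\<^sup>2) powr (q / 2)"
    unfolding sq using q by (intro sum_powr_le_powr_sum) auto
  also have "\<dots> \<le> ((\<Sum>\<epsilon>\<in>signs n. (g \<epsilon>)\<^sup>2) / N) powr (q / 2)"
    using bessel_signs[of g n] q unfolding c_def N_def
    by (intro powr_mono2) (auto intro!: sum_nonneg)
  also have "\<dots> = (\<Sum>\<epsilon>\<in>signs n. (g \<epsilon>)\<^sup>2) powr (q / 2) / N powr (q / 2)"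
    using N by (simp add: powr_divide sum_nonneg)
  also have "\<dots> \<le> N powr (q / 2 - 1) * (\<Sum>\<epsilon>\<in>signs n. \<bar>g \<epsilon>\<bar> powr q) / N powr (q / 2)"
    unfolding sq N_def using q by (intro divide_right_mono powr_sum_le) auto
  also have "\<dots> = (\<Sum>\<epsilon>\<in>signs n. \<bar>g \<epsilon>\<bar> powr q) / N"
    using N by (simp add: powr_diff)
  finally show ?thesis .
qed

lemma abs_powr_sum_le:
  fixes a :: "'i \<Rightarrow> real"
  assumes I: "finite I" and r: "1 \<le> r"
  shows "\<bar>\<Sum>i\<in>I. a i\<bar> powr r \<le> real (card I) powr (r - 1) * (\<Sum>i\<in>I. \<bar>a i\<bar> powr r)"
proof -
  have "\<bar>\<Sum>i\<in>I. a i\<bar> powr r \<le> (\<Sum>i\<in>I. \<bar>a i\<bar>) powr r"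
    using r by (intro powr_mono2) auto
  also have "\<dots> \<le> real (card I) powr (r - 1) * (\<Sum>i\<in>I. \<bar>a i\<bar> powr r)"
    using I r by (intro powr_sum_le) auto
  finally show ?thesis .
qed

lemma abs_powr_sum3_le:
  fixes a b c :: real
  assumes r: "1 \<le> r"
  shows "\<bar>a + b + c\<bar> powr r \<le> 3 powr (r - 1) * (\<bar>a\<bar> powr r + \<bar>b\<bar> powr r + \<bar>c\<bar> powr r)"
  using abs_powr_sum_le[of "{0..<3::nat}" r "\<lambda>i. if i = 0 then a else if i = 1 then b else c"] r
  by (simp add: numeral_3_eq_3 add.assoc)

text \<open>
  The metric cotype \<open>q\<close> inequality for real-valued functions on the torus with \<open>m = 4
  k\<close>: half a turn \<open>2 k\<close> in single coordinates is controlled by diagonal steps. For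
  fixed \<open>j\<close>, let \<open>A j x\<close> be the sum of \<open>H (x + \<epsilon>)\<close> over
  all sign vectors, the \<open>j\<close>-th coordinate of \<open>\<epsilon>\<close> being replaced by 0.
  Up to a constant, the \<open>j\<close>-th coefficient \<open>c j x\<close> of \<open>\<epsilon>
  \<mapsto> H (x + \<epsilon>) - H x\<close> is the difference of \<open>A j\<close> at two points at
  distance 2, with \<open>x\<close> in the middle. So a half turn of \<open>A j\<close> telescopes into
  \<open>k\<close> such coefficients, which are bounded by the inequality of Bessel. The first sum on
  the right is the price for the passage from \<open>H\<close> to the average \<open>A j\<close>.
\<close>

theorem metric_cotype_real:
  fixes H :: "(nat \<Rightarrow> int) \<Rightarrow> real" and n k :: nat
  assumes k: "k > 0" and q: "2 \<le> q" and H: "periodic n (4 * int k) H"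
  defines "X \<equiv> torus n (4 * int k)" and "N \<equiv> real (card (signs n))"
  shows "(\<Sum>j<n. \<Sum>x\<in>X. \<bar>H (x(j := x j + 2 * int k)) - H x\<bar> powr q)
    \<le> 3 powr (q - 1) *
      (2 * (\<Sum>j<n. \<Sum>x\<in>X. \<Sum>\<epsilon>\<in>signs n. \<bar>H (\<lambda>i. x i + (\<epsilon>(j := 0)) i) - H x\<bar> powr q) / N
       + (2 * real k) powr q * (\<Sum>x\<in>X. \<Sum>\<epsilon>\<in>signs n. \<bar>H (\<lambda>i. x i + \<epsilon> i) - H x\<bar> powr q) / N)"
proof -
  let ?m = "4 * int k"
  have m: "?m > 0" using k by simp
  have N: "N > 0" using card_signs_pos by (simp add: N_def)
  define c where "c j x = (\<Sum>\<epsilon>\<in>signs n. real_of_int (\<epsilon> j) * (H (\<lambda>i. x i + \<epsilon> i) - H x)) / N" for j x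
  define A where "A j x = (\<Sum>\<epsilon>\<in>signs n. H (\<lambda>i. x i + (\<epsilon>(j := 0)) i))" for j x
  define D where "D x = (\<Sum>\<epsilon>\<in>signs n. \<bar>H (\<lambda>i. x i + \<epsilon> i) - H x\<bar> powr q)" for x
  define B where "B j x = (\<Sum>\<epsilon>\<in>signs n. \<bar>H (\<lambda>i. x i + (\<epsilon>(j := 0)) i) - H x\<bar> powr q)" for j x
  have Hshift: "periodic n ?m (\<lambda>x. H (\<lambda>i. x i + v i))" for v
    unfolding periodic_def by (intro allI impI periodicD[OF H]) (metis mod_add_left_eq)
  have HH: "H (\<lambda>i. x i + v i) = H (\<lambda>i. y i + v i)"
    if "\<And>i. i < n \<Longrightarrow> x i mod ?m = y i mod ?m" for x y v
    by (rule periodicD[OF Hshift]) (rule that)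
  have c_per: "periodic n ?m (\<lambda>x. \<bar>c j x\<bar> powr q)" for j
    unfolding periodic_def
  proof (intro allI impI)
    fix x y assume xy: "\<forall>i<n. x i mod ?m = y i mod ?m"
    have "H x = H y" using periodicD[OF H] xy by blast
    moreover have "H (\<lambda>i. x i + v i) = H (\<lambda>i. y i + v i)" for v by (rule HH) (use xy in blast)
    ultimately show "\<bar>c j x\<bar> powr q = \<bar>c j y\<bar> powr q" by (simp add: c_def)
  qed
  have B_per: "periodic n ?m (B j)" for j
    unfolding periodic_def
  proof (intro allI impI)
    fix x y assume xy: "\<forall>i<n. x i mod ?m = y i mod ?m"
    have "H x = H y" using periodicD[OF H] xy by blast
    moreover have "H (\<lambda>i. x i + v i) = H (\<lambda>i. y i + v i)" for v by (rule HH) (use xy in blast)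
    ultimately show "B j x = B j y" by (simp add: B_def)
  qed
  have upd: "x(j := x j + t) = (\<lambda>i. x i + ((\<lambda>_. 0)(j := t)) i)" for x :: "nat \<Rightarrow> int" and j t
    by auto
  have bessel: "(\<Sum>j<n. \<bar>c j x\<bar> powr q) \<le> D x / N" for x
    using bessel_signs_powr[OF q, of "\<lambda>\<epsilon>. H (\<lambda>i. x i + \<epsilon> i) - H x" n]
    by (simp add: c_def D_def N_def)
  have A_diff: "A j (x(j := x j + 1)) - A j (x(j := x j - 1)) = 2 * N * c j x" if j: "j < n" for j x
  proof -
    define G where "G \<epsilon> = real_of_int (\<epsilon> j) * (H (\<lambda>i. x i + \<epsilon> i) - H x)" for \<epsilon>
    have "2 * N * c j x = (\<Sum>\<epsilon>\<in>signs n. G \<epsilon>) + (\<Sum>\<epsilon>\<in>signs n. G (\<epsilon>(j := - \<epsilon> j)))"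
      using N unfolding sum_signs_flip[OF j] by (simp add: c_def G_def)
    also have "\<dots> = (\<Sum>\<epsilon>\<in>signs n. G \<epsilon> + G (\<epsilon>(j := - \<epsilon> j)))" by (simp add: sum.distrib)
    also have "\<dots> = (\<Sum>\<epsilon>\<in>signs n. H (\<lambda>i. (x(j := x j + 1)) i + (\<epsilon>(j := 0)) i)
        - H (\<lambda>i. (x(j := x j - 1)) i + (\<epsilon>(j := 0)) i))"
    proof (rule sum.cong[OF refl])
      fix \<epsilon> assume e: "\<epsilon> \<in> signs n"
      have p: "(\<lambda>i. (x(j := x j + 1)) i + (\<epsilon>(j := 0)) i) = (\<lambda>i. x i + (\<epsilon>(j := 1)) i)"
        "(\<lambda>i. (x(j := x j - 1)) i + (\<epsilon>(j := 0)) i) = (\<lambda>i. x i + (\<epsilon>(j := -1)) i)"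
        by auto
      consider "\<epsilon> = \<epsilon>(j := 1)" "\<epsilon> j = 1" | "\<epsilon> = \<epsilon>(j := -1)" "\<epsilon> j = -1"
        using signs_cases[OF e j] by (metis fun_upd_triv)
      then show "G \<epsilon> + G (\<epsilon>(j := - \<epsilon> j))
          = H (\<lambda>i. (x(j := x j + 1)) i + (\<epsilon>(j := 0)) i)
            - H (\<lambda>i. (x(j := x j - 1)) i + (\<epsilon>(j := 0)) i)"
      proof cases
        case 1
        have "G \<epsilon> = H (\<lambda>i. x i + (\<epsilon>(j := 1)) i) - H x"
          unfolding G_def 1(1)[symmetric] using 1(2) by simp
        then show ?thesis using 1(2) unfolding p by (simp add: G_def)
      next
        case 2
        have "G \<epsilon> = - (H (\<lambda>i. x i + (\<epsilon>(j := -1)) i) - H x)"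
          unfolding G_def 2(1)[symmetric] using 2(2) by simp
        then show ?thesis using 2(2) unfolding p by (simp add: G_def)
      qed
    qed
    finally show ?thesis by (simp add: A_def sum_subtractf)
  qed
  have tele: "(\<Sum>x\<in>X. \<bar>A j (x(j := x j + 2 * int k)) - A j x\<bar> powr q)
      \<le> (2 * real k * N) powr q * (\<Sum>x\<in>X. \<bar>c j x\<bar> powr q)" if j: "j < n" for j
  proof -
    have "\<bar>A j (x(j := x j + 2 * int k)) - A j x\<bar> powr q
        \<le> real k powr (q - 1) * (\<Sum>i<k. (2 * N) powr q * \<bar>c j (x(j := x j + (2 * int i + 1)))\<bar> powr q)" for x
    proof -
      have "A j (x(j := x j + 2 * int k)) - A j x
          = (\<Sum>i<k. A j (x(j := x j + 2 * int (Suc i))) - A j (x(j := x j + 2 * int i)))"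
        by (subst sum_lessThan_telescope) simp
      also have "\<dots> = (\<Sum>i<k. 2 * N * c j (x(j := x j + (2 * int i + 1))))"
      proof (rule sum.cong[OF refl])
        fix i
        show "A j (x(j := x j + 2 * int (Suc i))) - A j (x(j := x j + 2 * int i))
          = 2 * N * c j (x(j := x j + (2 * int i + 1)))"
          using A_diff[OF j, of "x(j := x j + (2 * int i + 1))"] by (simp add: algebra_simps)
      qed
      finally have e: "A j (x(j := x j + 2 * int k)) - A j x
          = (\<Sum>i<k. 2 * N * c j (x(j := x j + (2 * int i + 1))))" .
      show ?thesis
        unfolding e using abs_powr_sum_le[of "{..<k}" q "\<lambda>i. 2 * N * c j (x(j := x j + (2 * int i + 1)))"] q N
        by (simp add: abs_mult powr_mult)
    qed
    then have "(\<Sum>x\<in>X. \<bar>A j (x(j := x j + 2 * int k)) - A j x\<bar> powr q)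
        \<le> (\<Sum>x\<in>X. real k powr (q - 1) * (\<Sum>i<k. (2 * N) powr q * \<bar>c j (x(j := x j + (2 * int i + 1)))\<bar> powr q))"
      by (intro sum_mono)
    also have "\<dots> = real k powr (q - 1) * (\<Sum>i<k. (2 * N) powr q *
        (\<Sum>x\<in>X. \<bar>c j (x(j := x j + (2 * int i + 1)))\<bar> powr q))"
      unfolding sum_distrib_left by (subst sum.swap) (simp add: sum_distrib_left)
    also have "\<dots> = real k powr (q - 1) * (\<Sum>i<k. (2 * N) powr q * (\<Sum>x\<in>X. \<bar>c j x\<bar> powr q))"
      unfolding X_def upd by (subst sum_torus_shift[OF m c_per]) simp
    also have "\<dots> = (real k powr (q - 1) * real k) * (2 * N) powr q * (\<Sum>x\<in>X. \<bar>c j x\<bar> powr q)"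
      by simp
    also have "real k powr (q - 1) * real k = real k powr q"
      using k by (simp add: powr_diff)
    also have "real k powr q * (2 * N) powr q = (2 * real k * N) powr q"
      by (simp add: powr_mult mult_ac)
    finally show ?thesis .
  qed
  have one: "(\<Sum>x\<in>X. \<bar>H (x(j := x j + 2 * int k)) - H x\<bar> powr q)
      \<le> 3 powr (q - 1) * (2 * (\<Sum>x\<in>X. B j x) / N + (2 * real k) powr q * (\<Sum>x\<in>X. \<bar>c j x\<bar> powr q))"
    if j: "j < n" for j
  proof -
    have pt: "N powr q * \<bar>H x' - H x\<bar> powr q
        \<le> 3 powr (q - 1) * (N powr (q - 1) * B j x' + \<bar>A j x' - A j x\<bar> powr q + N powr (q - 1) * B j x)"
      for x x'
    proof -
      define b where "b y = (\<Sum>\<epsilon>\<in>signs n. H (\<lambda>i. y i + (\<epsilon>(j := 0)) i) - H y)" for y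
      have b: "\<bar>b y\<bar> powr q \<le> N powr (q - 1) * B j y" for y
        unfolding b_def B_def N_def using q by (intro abs_powr_sum_le) auto
      have bA: "b y = A j y - N * H y" for y by (simp add: b_def A_def N_def sum_subtractf)
      have "N powr q * \<bar>H x' - H x\<bar> powr q = \<bar>N * (H x' - H x)\<bar> powr q"
        using N by (simp add: abs_mult powr_mult)
      also have "N * (H x' - H x) = (- b x') + (A j x' - A j x) + b x"
        unfolding bA by (simp add: algebra_simps)
      also have "\<bar>\<dots>\<bar> powr q \<le> 3 powr (q - 1) * (\<bar>- b x'\<bar> powr q + \<bar>A j x' - A j x\<bar> powr q + \<bar>b x\<bar> powr q)"
        using q by (intro abs_powr_sum3_le) auto
      also have "\<dots> \<le> 3 powr (q - 1) * (N powr (q - 1) * B j x' + \<bar>A j x' - A j x\<bar> powr q + N powr (q - 1) * B j x)"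
        using b[of x] b[of x'] by (intro mult_left_mono) auto
      finally show ?thesis .
    qed
    have "N powr q * (\<Sum>x\<in>X. \<bar>H (x(j := x j + 2 * int k)) - H x\<bar> powr q)
        \<le> (\<Sum>x\<in>X. 3 powr (q - 1) * (N powr (q - 1) * B j (x(j := x j + 2 * int k))
          + \<bar>A j (x(j := x j + 2 * int k)) - A j x\<bar> powr q + N powr (q - 1) * B j x))"
      unfolding sum_distrib_left by (intro sum_mono pt)
    also have "\<dots> = 3 powr (q - 1) * (N powr (q - 1) * (\<Sum>x\<in>X. B j (x(j := x j + 2 * int k)))
          + (\<Sum>x\<in>X. \<bar>A j (x(j := x j + 2 * int k)) - A j x\<bar> powr q) + N powr (q - 1) * (\<Sum>x\<in>X. B j x))"
      by (simp add: sum_distrib_left[symmetric] sum.distrib)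
    also have "(\<Sum>x\<in>X. B j (x(j := x j + 2 * int k))) = (\<Sum>x\<in>X. B j x)"
      unfolding X_def upd by (rule sum_torus_shift[OF m B_per])
    also have "3 powr (q - 1) * (N powr (q - 1) * (\<Sum>x\<in>X. B j x)
          + (\<Sum>x\<in>X. \<bar>A j (x(j := x j + 2 * int k)) - A j x\<bar> powr q) + N powr (q - 1) * (\<Sum>x\<in>X. B j x))
        \<le> 3 powr (q - 1) * (N powr (q - 1) * (\<Sum>x\<in>X. B j x)
          + (2 * real k * N) powr q * (\<Sum>x\<in>X. \<bar>c j x\<bar> powr q) + N powr (q - 1) * (\<Sum>x\<in>X. B j x))"
      using tele[OF j] by (intro mult_left_mono add_mono) auto
    also have "\<dots> = N powr q * (3 powr (q - 1) * (2 * (\<Sum>x\<in>X. B j x) / N + (2 * real k) powr q * (\<Sum>x\<in>X. \<bar>c j x\<bar> powr q)))"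
      using N by (simp add: powr_mult powr_diff field_simps)
    finally show ?thesis by (rule mult_left_le_imp_le) (use N in simp)
  qed
  have "(\<Sum>j<n. \<Sum>x\<in>X. \<bar>H (x(j := x j + 2 * int k)) - H x\<bar> powr q)
      \<le> (\<Sum>j<n. 3 powr (q - 1) * (2 * (\<Sum>x\<in>X. B j x) / N + (2 * real k) powr q * (\<Sum>x\<in>X. \<bar>c j x\<bar> powr q)))"
    by (intro sum_mono one) auto
  also have "\<dots> = 3 powr (q - 1) * (2 * (\<Sum>j<n. \<Sum>x\<in>X. B j x) / N
      + (2 * real k) powr q * (\<Sum>x\<in>X. \<Sum>j<n. \<bar>c j x\<bar> powr q))"
    by (subst sum.swap[of _ "{..<n}" X]) (simp add: sum_distrib_left[symmetric] sum.distrib sum_divide_distrib[symmetric])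
  also have "\<dots> \<le> 3 powr (q - 1) * (2 * (\<Sum>j<n. \<Sum>x\<in>X. B j x) / N
      + (2 * real k) powr q * (\<Sum>x\<in>X. D x / N))"
    by (intro mult_left_mono add_left_mono sum_mono bessel) auto
  finally show ?thesis by (simp only: B_def D_def sum_divide_distrib[symmetric] times_divide_eq_right)
qed


section \<open>The torus in \<open>L_p\<close> and the obstruction to embeddings\<close>

text \<open>
  The torus in \<open>L_p\<close>: the unit interval is divided into \<open>2 n\<close> intervals of
  equal length, and on the two intervals that belong to the coordinate \<open>x\<^sub>j\<close> the
  function is the cosine and the sine of the angle \<open>2 \<pi> x\<^sub>j / (4 k)\<close>.
\<close>

definition torus_point :: "nat \<Rightarrow> nat \<Rightarrow> (nat \<Rightarrow> int) \<Rightarrow> real \<Rightarrow> real" where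
  "torus_point n k x s =
    (let i = nat \<lfloor>2 * real n * s\<rfloor>; t = 2 * pi * real_of_int (x (i div 2)) / (4 * real k)
     in if i < 2 * n then if even i then cos t else sin t else 0)"

lemma torus_point_measurable [measurable]: "torus_point n k x \<in> borel_measurable borel"
proof -
  have [measurable]: "(\<lambda>s::real. nat \<lfloor>2 * real n * s\<rfloor>) \<in> measurable borel (count_space UNIV)"
    by measurable
  have "(\<lambda>s. (\<lambda>i s. let t = 2 * pi * real_of_int (x (i div 2)) / (4 * real k)
      in if i < 2 * n then if even i then cos t else sin t else 0) (nat \<lfloor>2 * real n * s\<rfloor>) s)
      \<in> borel_measurable borel"
    by (rule measurable_compose_countable) measurable
  then show ?thesis by (simp add: torus_point_def[abs_def] Let_def)
qed

lemma mass_bounded: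
  assumes "p \<ge> 0" and [measurable]: "f \<in> borel_measurable borel" and "\<And>x. \<bar>f x\<bar> \<le> b"
  shows "mass p f \<le> ennreal (b powr p)"
proof -
  have "mass p f \<le> (\<integral>\<^sup>+x. ennreal (b powr p) \<partial>unit_measure)"
    unfolding mass_def using assms by (intro nn_integral_mono ennreal_leI powr_mono2) auto
  then show ?thesis by (simp only: nn_integral_unit_const)
qed

lemma mass_torus_point: "p \<ge> 0 \<Longrightarrow> mass p (torus_point n k x) < \<infinity>"
  by (rule le_less_trans[OF mass_bounded[of _ _ 1]]) (auto simp: torus_point_def Let_def)

lemma torus_point_periodic:
  assumes "k > 0"
  shows "periodic n (4 * int k) (torus_point n k)"
  unfolding periodic_def
proof (intro allI impI ext)
  fix x y :: "nat \<Rightarrow> int" and s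
  assume xy: "\<forall>i<n. x i mod (4 * int k) = y i mod (4 * int k)"
  have *: "cos (2 * pi * real_of_int (x i) / (4 * real k)) = cos (2 * pi * real_of_int (y i) / (4 * real k)) \<and>
      sin (2 * pi * real_of_int (x i) / (4 * real k)) = sin (2 * pi * real_of_int (y i) / (4 * real k))"
    if "i < n" for i
  proof -
    have "4 * int k dvd x i - y i" using xy that by (simp add: mod_eq_dvd_iff)
    then obtain z where "x i - y i = 4 * int k * z" by (elim dvdE)
    then have "x i = y i + 4 * int k * z" by simp
    then have "2 * pi * real_of_int (x i) / (4 * real k)
        = 2 * pi * real_of_int (y i) / (4 * real k) + of_int z * (2 * pi)"
      using assms by (simp add: field_simps)
    moreover have "cos (a + of_int z * (2 * pi)) = cos a" "sin (a + of_int z * (2 * pi)) = sin a" for a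
      using cos_int_2pin[of z] sin_int_2pin[of z] by (simp_all add: cos_add sin_add mult.commute)
    ultimately show ?thesis by simp
  qed
  have "nat \<lfloor>2 * real n * s\<rfloor> div 2 < n" if "nat \<lfloor>2 * real n * s\<rfloor> < 2 * n"
    using that by linarith
  from *[OF this] show "torus_point n k x s = torus_point n k y s"
    by (simp add: torus_point_def Let_def)
qed

lemma torus_point_near:
  assumes k: "k > 0" and xy: "\<And>i. i < n \<Longrightarrow> \<bar>x i - y i\<bar> \<le> 1"
  shows "\<bar>torus_point n k x s - torus_point n k y s\<bar> \<le> 2 * pi / (4 * real k)"
proof -
  define i where "i = nat \<lfloor>2 * real n * s\<rfloor>"
  define ta where "ta = 2 * pi * real_of_int (x (i div 2)) / (4 * real k)"
  define tb where "tb = 2 * pi * real_of_int (y (i div 2)) / (4 * real k)"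
  show ?thesis
  proof (cases "i < 2 * n")
    case True
    then have "i div 2 < n" by linarith
    then have "\<bar>x (i div 2) - y (i div 2)\<bar> \<le> 1" by (rule xy)
    then have d: "\<bar>real_of_int (x (i div 2)) - real_of_int (y (i div 2))\<bar> \<le> 1" by linarith
    have "\<bar>ta - tb\<bar> = 2 * pi / (4 * real k) * \<bar>real_of_int (x (i div 2)) - real_of_int (y (i div 2))\<bar>"
      unfolding ta_def tb_def using k
      by (simp add: diff_divide_distrib[symmetric] right_diff_distrib[symmetric] abs_mult)
    also have "\<dots> \<le> 2 * pi / (4 * real k) * 1" using d by (intro mult_left_mono) auto
    finally have "\<bar>ta - tb\<bar> \<le> 2 * pi / (4 * real k)" by simp
    moreover have "torus_point n k x s = (if even i then cos ta else sin ta)"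
      "torus_point n k y s = (if even i then cos tb else sin tb)"
      using True by (simp_all add: torus_point_def Let_def i_def ta_def tb_def)
    ultimately show ?thesis
      using abs_cos_diff_le[of ta tb] abs_sin_diff_le[of ta tb] by (cases "even i") (auto intro: order_trans)
  next
    case False
    then show ?thesis by (simp add: torus_point_def Let_def i_def[symmetric])
  qed
qed

lemma mass_torus_point_opposite:
  assumes k: "k > 0" and p: "p > 0" and j: "j < n"
  shows "ennreal (1 / (2 * real n)) \<le> mass p (\<lambda>s. torus_point n k x s - torus_point n k (x(j := x j + 2 * int k)) s)"
proof -
  let ?y = "x(j := x j + 2 * int k)"
  define t where "t = 2 * pi * real_of_int (x j) / (4 * real k)"
  have t': "2 * pi * real_of_int (?y j) / (4 * real k) = t + pi"
    using k by (simp add: t_def field_simps)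
  have "\<exists>i. i < 2 * n \<and> i div 2 = j \<and> (if even i then 1 \<le> \<bar>2 * cos t\<bar> else 1 \<le> \<bar>2 * sin t\<bar>)"
  proof (cases "1 \<le> \<bar>2 * cos t\<bar>")
    case True then show ?thesis using j by (intro exI[of _ "2 * j"]) auto
  next
    case False
    then have "\<bar>cos t\<bar> < 1 / 2" by simp
    then have "\<bar>cos t\<bar>\<^sup>2 < (1 / 2)\<^sup>2" by (intro power_strict_mono) auto
    then have "(1 / 2)\<^sup>2 \<le> \<bar>sin t\<bar>\<^sup>2" using sin_cos_squared_add[of t] by (simp add: power2_eq_square)
    then have "1 / 2 \<le> \<bar>sin t\<bar>" by (rule power2_le_imp_le) simp
    then show ?thesis using j by (intro exI[of _ "2 * j + 1"]) auto
  qed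
  then obtain i where i: "i < 2 * n" "i div 2 = j"
    "if even i then 1 \<le> \<bar>2 * cos t\<bar> else 1 \<le> \<bar>2 * sin t\<bar>" by (elim exE conjE)
  define I where "I = {real i / (2 * real n)..<real (Suc i) / (2 * real n)}"
  have n: "real n > 0" using j by simp
  have IU: "s \<in> {0..1}" if "s \<in> I" for s
  proof -
    have "real (Suc i) \<le> 2 * real n" using i(1) by linarith
    then have "real (Suc i) / (2 * real n) \<le> 1" using n by simp
    moreover have "0 \<le> real i / (2 * real n)" by simp
    ultimately show ?thesis using that unfolding I_def atLeastLessThan_iff atLeastAtMost_iff by linarith
  qed
  have big: "1 \<le> \<bar>torus_point n k x s - torus_point n k ?y s\<bar> powr p" if s: "s \<in> I" for s
  proof -
    have "real i \<le> 2 * real n * s" "2 * real n * s < real i + 1"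
      using s n by (simp_all add: I_def field_simps)
    then have "\<lfloor>2 * real n * s\<rfloor> = int i" by (intro floor_unique) auto
    then have e: "nat \<lfloor>2 * real n * s\<rfloor> = i" by simp
    have "1 \<le> \<bar>torus_point n k x s - torus_point n k ?y s\<bar>"
      using i t' unfolding torus_point_def e Let_def i(2) by (auto simp: t_def[symmetric] split: if_splits)
    then show ?thesis using p by (intro ge_one_powr_ge_zero) auto
  qed
  have "ennreal (1 / (2 * real n)) = emeasure lborel I"
    using n by (simp add: I_def divide_right_mono diff_divide_distrib[symmetric])
  also have "\<dots> = (\<integral>\<^sup>+s. indicator I s \<partial>lborel)" by (simp add: I_def)
  also have "\<dots> \<le> (\<integral>\<^sup>+s. ennreal (\<bar>torus_point n k x s - torus_point n k ?y s\<bar> powr p) * indicator {0..1} s \<partial>lborel)"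
    using IU big by (intro nn_integral_mono) (auto simp: indicator_def)
  finally show ?thesis by (simp add: mass_def nn_integral_unit_measure)
qed

lemma mass_LINT:
  assumes [measurable]: "f \<in> borel_measurable borel" and "mass q f < \<infinity>"
  shows "integrable unit_measure (\<lambda>s. \<bar>f s\<bar> powr q)"
    "(LINT s|unit_measure. \<bar>f s\<bar> powr q) = enn2real (mass q f)"
  using assms(2) by (auto simp: integrable_iff_bounded mass_def integral_eq_nn_integral)

text \<open>
  Only \<open>q\<close>-th powers of distances occur in the scalar inequality, so it may be integrated.
\<close>

theorem metric_cotype_Lq:
  fixes G :: "(nat \<Rightarrow> int) \<Rightarrow> real \<Rightarrow> real" and n k :: nat
  assumes k: "k > 0" and q: "2 \<le> q" and G: "periodic n (4 * int k) G"
    and Gm [measurable]: "\<And>x. G x \<in> borel_measurable borel" and Gf: "\<And>x. mass q (G x) < \<infinity>"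
  defines "X \<equiv> torus n (4 * int k)" and "N \<equiv> real (card (signs n))"
  defines "V \<equiv> \<lambda>x y. enn2real (mass q (\<lambda>s. G x s - G y s))"
  shows "(\<Sum>j<n. \<Sum>x\<in>X. V (x(j := x j + 2 * int k)) x)
    \<le> 3 powr (q - 1) *
      (2 * (\<Sum>j<n. \<Sum>x\<in>X. \<Sum>\<epsilon>\<in>signs n. V (\<lambda>i. x i + (\<epsilon>(j := 0)) i) x) / N
       + (2 * real k) powr q * (\<Sum>x\<in>X. \<Sum>\<epsilon>\<in>signs n. V (\<lambda>i. x i + \<epsilon> i) x) / N)"
proof -
  define W where "W x y s = \<bar>G x s - G y s\<bar> powr q" for x y s
  have fin: "mass q (\<lambda>s. G x s - G y s) < \<infinity>" for x y
    using q by (intro mass_diff_finite Gm Gf) auto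
  have WI: "integrable unit_measure (W x y)" and WL: "(LINT s|unit_measure. W x y s) = V x y" for x y
    using mass_LINT[OF _ fin, of x y] by (simp_all add: W_def[abs_def] V_def)
  define L where "L s = (\<Sum>j<n. \<Sum>x\<in>X. W (x(j := x j + 2 * int k)) x s)" for s
  define R where "R s = 3 powr (q - 1) *
      (2 * (\<Sum>j<n. \<Sum>x\<in>X. \<Sum>\<epsilon>\<in>signs n. W (\<lambda>i. x i + (\<epsilon>(j := 0)) i) x s) / N
       + (2 * real k) powr q * (\<Sum>x\<in>X. \<Sum>\<epsilon>\<in>signs n. W (\<lambda>i. x i + \<epsilon> i) x s) / N)" for s
  have "L s \<le> R s" for s
    unfolding L_def R_def W_def X_def N_def
    by (rule metric_cotype_real[OF k q]) (use G in \<open>simp add: periodic_def, metis\<close>)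
  moreover have "integrable unit_measure L" "(LINT s|unit_measure. L s) = (\<Sum>j<n. \<Sum>x\<in>X. V (x(j := x j + 2 * int k)) x)"
    unfolding L_def using WI by (simp_all add: WL)
  moreover have "integrable unit_measure R" "(LINT s|unit_measure. R s) = 3 powr (q - 1) *
      (2 * (\<Sum>j<n. \<Sum>x\<in>X. \<Sum>\<epsilon>\<in>signs n. V (\<lambda>i. x i + (\<epsilon>(j := 0)) i) x) / N
       + (2 * real k) powr q * (\<Sum>x\<in>X. \<Sum>\<epsilon>\<in>signs n. V (\<lambda>i. x i + \<epsilon> i) x) / N)"
    unfolding R_def using WI by (simp_all del: fun_upd_apply add: WL)
  ultimately show ?thesis using integral_mono[of unit_measure L R] by simp
qed

text \<open>
  With \<open>n\<close> about \<open>k\<^sup>q\<close>, a diagonal step has length at most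
  \<open>\<beta>\<close> in \<open>L_p\<close> and a half turn in one coordinate at least
  \<open>\<gamma>\<close>, where \<open>\<beta> / \<gamma>\<close> is of order
  \<open>k\<^sup>q\<^sup>/\<^sup>p\<^sup>-\<^sup>1\<close> and so tends to 0. A quasisymmetric embedding
  makes the diagonal steps small compared to the half turns also in \<open>L_q\<close>, against metric
  cotype \<open>q\<close>.
\<close>

theorem Lp_not_embeds_Lq:
  assumes q: "2 \<le> q" and p: "q < p"
  shows "\<not> embeds_quasisymmetrically (Lp p) (Lp q)"
proof
  assume "embeds_quasisymmetrically (Lp p) (Lp q)"
  then obtain \<eta> F where F: "F \<in> mspace (Lp p) \<rightarrow> mspace (Lp q)" "inj_on F (mspace (Lp p))"
    and \<eta>: "qs_modulus \<eta>"
    and qs: "\<And>x y z. x \<in> mspace (Lp p) \<Longrightarrow> y \<in> mspace (Lp p) \<Longrightarrow> z \<in> mspace (Lp p) \<Longrightarrow>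
      x \<noteq> y \<Longrightarrow> y \<noteq> z \<Longrightarrow> x \<noteq> z \<Longrightarrow>
      mdist (Lp q) (F x) (F y) / mdist (Lp q) (F x) (F z) \<le> \<eta> (mdist (Lp p) x y / mdist (Lp p) x z)"
    by (rule embeds_quasisymmetricallyE) blast
  have pq: "p > 0" "q > 0" "p \<ge> 1" "q \<ge> 1" using p q by auto
  \<comment> \<open>an upper bound for \<open>\<beta> / \<gamma>\<close>\<close>
  define \<rho> where "\<rho> k = (pi / 2) * 4 powr (1 / p) * real k powr (q / p - 1)" for k :: nat
  have "q / p - 1 < 0" using p pq by simp
  then have "(\<lambda>k. real k powr (q / p - 1)) \<longlonglongrightarrow> 0"
    by (intro tendsto_neg_powr filterlim_real_sequentially)
  then have "(\<lambda>k. (pi / 2) * 4 powr (1 / p) * real k powr (q / p - 1)) \<longlonglongrightarrow> (pi / 2) * 4 powr (1 / p) * 0"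
    by (intro tendsto_mult tendsto_const)
  then have \<rho>0: "\<rho> \<longlonglongrightarrow> 0" by (simp add: \<rho>_def[abs_def])
  have \<rho>pos: "\<rho> k > 0" if "k > 0" for k using that by (simp add: \<rho>_def)
  have \<rho>right: "filterlim \<rho> (at_right 0) sequentially"
    unfolding filterlim_at using \<rho>0
    by (auto intro!: eventually_mono[OF eventually_gt_at_top[of 0]] \<rho>pos less_imp_neq[THEN not_sym])
  have "(\<eta> \<longlongrightarrow> 0) (at_right 0)" using \<eta> by (simp add: qs_modulus_def)
  then have \<eta>0: "(\<lambda>k. \<eta> (\<rho> k)) \<longlonglongrightarrow> 0" using \<rho>right by (rule filterlim_compose)
  define K where "K = 3 powr (q - 1) * (2 + 2 powr q)"
  have "(\<lambda>k. K * \<eta> (\<rho> k) powr q) \<longlonglongrightarrow> K * 0 powr q"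
    using pq \<eta>0 \<eta> by (intro tendsto_mult tendsto_const tendsto_powr')
      (auto intro!: eventually_mono[OF eventually_gt_at_top[of 0]] less_imp_le simp: qs_modulus_def \<rho>pos)
  then have "(\<lambda>k. K * \<eta> (\<rho> k) powr q) \<longlonglongrightarrow> 0" using pq by simp
  then have ev: "\<forall>\<^sub>F k in sequentially. K * \<eta> (\<rho> k) powr q < 1" by (rule order_tendstoD) simp
  have "\<forall>\<^sub>F k in sequentially. \<rho> k < 1" using \<rho>0 by (rule order_tendstoD) simp
  with ev have "\<forall>\<^sub>F k in sequentially. K * \<eta> (\<rho> k) powr q < 1 \<and> \<rho> k < 1 \<and> k > 0"
    using eventually_gt_at_top[of 0] by eventually_elim auto
  then obtain k where k: "K * \<eta> (\<rho> k) powr q < 1" "\<rho> k < 1" "k > 0"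
    by (auto dest: eventually_happens)
  define n where "n = nat \<lceil>real k powr q\<rceil>"
  have kq: "real k powr q \<ge> 1" using k(3) pq by (intro ge_one_powr_ge_zero) auto
  have n: "real k powr q \<le> real n" "real n \<le> 2 * real k powr q" "n > 0"
    using kq unfolding n_def by linarith+
  define \<beta> where "\<beta> = 2 * pi / (4 * real k)"
  define \<gamma> where "\<gamma> = (1 / (2 * real n)) powr (1 / p)"
  have \<beta>: "\<beta> > 0" using k(3) by (simp add: \<beta>_def)
  have \<gamma>: "\<gamma> > 0" using n(3) by (simp add: \<gamma>_def)
  have \<beta>\<gamma>: "\<beta> / \<gamma> \<le> \<rho> k"
  proof -
    have "\<beta> / \<gamma> = \<beta> * (2 * real n) powr (1 / p)" by (simp add: \<gamma>_def powr_divide)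
    also have "\<dots> \<le> \<beta> * (4 * real k powr q) powr (1 / p)"
      using n(2) \<beta> pq by (intro mult_left_mono powr_mono2) auto
    also have "\<dots> = \<rho> k"
      using k(3) pq by (simp add: \<beta>_def \<rho>_def powr_mult powr_powr powr_diff)
    finally show ?thesis .
  qed
  define u where "u x = Lp_class p (torus_point n k x)" for x
  have um: "u x \<in> mspace (Lp p)" for x
    unfolding u_def using pq by (intro Lp_class mass_torus_point) auto
  have ud: "mdist (Lp p) (u x) (u y)
      = enn2real (mass p (\<lambda>s. torus_point n k x s - torus_point n k y s)) powr (1 / p)" for x y
  proof -
    have "mass p (torus_point n k x) < \<infinity>" for x using pq by (intro mass_torus_point) simp
    then show ?thesis
      unfolding u_def using pq
      by (simp add: mdist_Lp_class_borel[OF pq(1)] dist_exponent_def)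
  qed
  have tfin: "mass p (\<lambda>s. torus_point n k x s - torus_point n k y s) < \<infinity>" for x y
    using pq by (intro mass_diff_finite mass_torus_point) auto
  have near: "mdist (Lp p) (u x) (u y) \<le> \<beta>" if "\<And>i. i < n \<Longrightarrow> \<bar>x i - y i\<bar> \<le> 1" for x y
  proof -
    have "mass p (\<lambda>s. torus_point n k x s - torus_point n k y s) \<le> ennreal (\<beta> powr p)"
      unfolding \<beta>_def using pq torus_point_near[OF k(3) that] by (intro mass_bounded) auto
    then have "enn2real (mass p (\<lambda>s. torus_point n k x s - torus_point n k y s)) \<le> \<beta> powr p"
      by (rule enn2real_leI[rotated]) simp
    then have "mdist (Lp p) (u x) (u y) \<le> (\<beta> powr p) powr (1 / p)"
      unfolding ud using pq by (intro powr_mono2) auto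
    then show ?thesis using pq \<beta> by (simp add: powr_powr)
  qed
  have far: "\<gamma> \<le> mdist (Lp p) (u x) (u (x(j := x j + 2 * int k)))" if "j < n" for x j
  proof -
    have "1 / (2 * real n) \<le> enn2real (mass p (\<lambda>s. torus_point n k x s - torus_point n k (x(j := x j + 2 * int k)) s))"
      using enn2real_mono[OF mass_torus_point_opposite[OF k(3) pq(1) that]] tfin by simp
    then show ?thesis unfolding \<gamma>_def ud using pq by (intro powr_mono2) auto
  qed
  define G where "G x = borel_rep (F (u x))" for x
  have Fm: "F (u x) \<in> mspace (Lp q)" for x using F(1) um by auto
  note Gm = borel_rep(2)[OF pq(2) Fm, folded G_def] and Gf = borel_rep(3)[OF pq(2) Fm, folded G_def]
  have Gp: "periodic n (4 * int k) G"
    using torus_point_periodic[OF k(3), of n] unfolding periodic_def G_def u_def by metis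
  define V where "V x y = enn2real (mass q (\<lambda>s. G x s - G y s))" for x y
  have Fd: "mdist (Lp q) (F (u x)) (F (u y)) = V x y powr (1 / q)" for x y
    unfolding V_def G_def using mdist_borel_rep[OF pq(2) Fm Fm] pq by (simp add: dist_exponent_def)
  have Vpos: "V x y > 0" if "u x \<noteq> u y" for x y
  proof -
    have "F (u x) \<noteq> F (u y)" using that F(2) um by (auto dest: inj_onD)
    then have "0 < V x y powr (1 / q)"
      using Metric_space.mdist_pos_less[OF Metric_space_mspace_mdist _ Fm Fm] unfolding Fd[symmetric] by blast
    then show ?thesis by (auto simp: V_def less_le)
  qed
  have Vc: "V x y = V y x" for x y
    unfolding V_def mass_def by (simp add: abs_minus_commute)
  define \<tau> where "\<tau> = \<eta> (\<rho> k) powr q"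
  have \<eta>pos: "\<eta> (\<rho> k) > 0" using \<eta> \<rho>pos k(3) by (simp add: qs_modulus_def)
  have farne: "u x \<noteq> u (x(j := x j + 2 * int k))" if "j < n" for x j
  proof
    assume e: "u x = u (x(j := x j + 2 * int k))"
    have "mdist (Lp p) (u x) (u x) = 0" using um by simp
    then show False using far[OF that, of x] \<gamma> e by simp
  qed
  have step: "V z x \<le> \<tau> * V (x(j := x j + 2 * int k)) x"
    if j: "j < n" and z: "\<And>i. i < n \<Longrightarrow> \<bar>x i - z i\<bar> \<le> 1" for x z j
  proof (cases "u x = u z")
    case True
    then have "G x = G z" by (simp add: G_def)
    then show ?thesis by (simp add: V_def mass_def \<tau>_def)
  next
    case False
    define y where "y = x(j := x j + 2 * int k)"
    have dz: "mdist (Lp p) (u x) (u z) \<le> \<beta>" using z by (rule near)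
    have dy: "\<gamma> \<le> mdist (Lp p) (u x) (u y)" unfolding y_def by (rule far[OF j])
    have "\<beta> / \<gamma> < 1" using \<beta>\<gamma> k(2) by linarith
    then have "\<beta> < \<gamma>" using \<gamma> by simp
    then have zy: "u z \<noteq> u y" using dz dy by auto
    have xy: "u x \<noteq> u y" unfolding y_def by (rule farne[OF j])
    have r0: "0 < mdist (Lp p) (u x) (u z)"
      using Metric_space.mdist_pos_less[OF Metric_space_mspace_mdist False um um] .
    have "mdist (Lp p) (u x) (u z) / mdist (Lp p) (u x) (u y) \<le> \<beta> / \<gamma>"
      using dz dy \<gamma> \<beta> by (intro frac_le) auto
    then have r: "mdist (Lp p) (u x) (u z) / mdist (Lp p) (u x) (u y) \<le> \<rho> k" using \<beta>\<gamma> by linarith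
    have "\<eta> (mdist (Lp p) (u x) (u z) / mdist (Lp p) (u x) (u y)) \<le> \<eta> (\<rho> k)"
      using \<eta> r r0 dy \<gamma> \<rho>pos[OF k(3)]
      by (intro strict_mono_on_leD[of "{0<..}" \<eta>]) (simp_all add: qs_modulus_def)
    with qs[OF um um um False zy xy]
    have "mdist (Lp q) (F (u x)) (F (u z)) / mdist (Lp q) (F (u x)) (F (u y)) \<le> \<eta> (\<rho> k)"
      by (rule order_trans)
    then have "V x z powr (1 / q) \<le> \<eta> (\<rho> k) * V x y powr (1 / q)"
      using Vpos[OF xy] unfolding Fd by (simp add: divide_le_eq)
    then have "(V x z powr (1 / q)) powr q \<le> (\<eta> (\<rho> k) * V x y powr (1 / q)) powr q"
      using pq by (intro powr_mono2) auto
    then show ?thesis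
      using pq by (simp add: powr_mult powr_powr \<tau>_def V_def[symmetric] y_def Vc)
        (simp add: V_def)
  qed
  define X where "X = torus n (4 * int k)"
  define N where "N = real (card (signs n))"
  have N: "N > 0" using card_signs_pos by (simp add: N_def)
  define S where "S = (\<Sum>j<n. \<Sum>x\<in>X. V (x(j := x j + 2 * int k)) x)"
  define S1 where "S1 = (\<Sum>j<n. \<Sum>x\<in>X. \<Sum>\<epsilon>\<in>signs n. V (\<lambda>i. x i + (\<epsilon>(j := 0)) i) x)"
  define S2 where "S2 = (\<Sum>x\<in>X. \<Sum>\<epsilon>\<in>signs n. V (\<lambda>i. x i + \<epsilon> i) x)"
  have main: "S \<le> 3 powr (q - 1) * (2 * S1 / N + (2 * real k) powr q * S2 / N)"
    unfolding S_def S1_def S2_def V_def X_def N_def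
    by (rule metric_cotype_Lq[OF k(3) q Gp Gm Gf])
  have TS: "(\<Sum>j<n. \<Sum>x\<in>X. \<Sum>\<epsilon>\<in>signs n. \<tau> * V (x(j := x j + 2 * int k)) x) = N * \<tau> * S"
    by (simp add: S_def N_def sum_distrib_left mult_ac)
  have S1: "S1 \<le> N * \<tau> * S"
    unfolding TS[symmetric] S1_def
  proof (intro sum_mono step)
    fix j x \<epsilon> i assume "\<epsilon> \<in> signs n" "i < n"
    then show "\<bar>x i - (x i + (\<epsilon>(j := 0)) i)\<bar> \<le> 1" using signs_cases[of \<epsilon> n i] by auto
  qed auto
  have "real n * S2 = (\<Sum>j<n. \<Sum>x\<in>X. \<Sum>\<epsilon>\<in>signs n. V (\<lambda>i. x i + \<epsilon> i) x)"
    by (simp add: S2_def)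
  also have "\<dots> \<le> N * \<tau> * S"
    unfolding TS[symmetric]
  proof (intro sum_mono step)
    fix j x \<epsilon> i assume "\<epsilon> \<in> signs n" "i < n"
    then show "\<bar>x i - (x i + \<epsilon> i)\<bar> \<le> 1" using signs_cases[of \<epsilon> n i] by auto
  qed auto
  finally have S2: "S2 \<le> N * \<tau> * S / real n" using n(3) by (simp add: le_divide_eq mult.commute)
  have Spos: "S > 0"
  proof -
    have "(\<lambda>i\<in>{..<n}. 0) \<in> X" using k(3) by (auto simp: X_def torus_def)
    then have ne: "X \<noteq> {}" by auto
    have fX: "finite X" by (simp add: X_def)
    show ?thesis
      unfolding S_def using n(3) ne fX farne
      by (intro sum_pos Vpos) (auto dest: not_sym)
  qed
  have "(2 * real k) powr q / real n \<le> 2 powr q"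
    using n(1,3) by (simp add: powr_mult divide_le_eq mult_left_mono)
  then have fr: "(2 * real k) powr q * (\<tau> * S) / real n \<le> 2 powr q * (\<tau> * S)"
    using Spos mult_right_mono[of "(2 * real k) powr q / real n" "2 powr q" "\<tau> * S"] by (simp add: \<tau>_def)
  have "S \<le> 3 powr (q - 1) * (2 * (N * \<tau> * S) / N + (2 * real k) powr q * (N * \<tau> * S / real n) / N)"
    using S1 S2 N by (intro order_trans[OF main] mult_left_mono add_mono divide_right_mono) auto
  also have "\<dots> = 3 powr (q - 1) * (2 * (\<tau> * S) + (2 * real k) powr q * (\<tau> * S) / real n)"
    using N by (simp add: field_simps)
  also have "\<dots> \<le> 3 powr (q - 1) * (2 * (\<tau> * S) + 2 powr q * (\<tau> * S))"
    using fr by (intro mult_left_mono add_left_mono) auto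
  also have "\<dots> = K * \<tau> * S" by (simp add: K_def algebra_simps)
  finally have "1 \<le> K * \<tau>" using Spos by simp
  then show False using k(1) by (simp add: \<tau>_def)
qed

section \<open>The characterization\<close>

theorem corollary2:
  fixes p q :: real
  assumes "p > 0" and "q > 0"
  shows "embeds_quasisymmetrically (Lp p) (Lp q) \<longleftrightarrow> p \<le> q \<or> (q \<le> p \<and> p \<le> 2)"
proof -
  have le: "embeds_quasisymmetrically (Lp r) (Lp s)" if "0 < r" "r \<le> s" for r s :: real
    using that Lp_embeds_Lq_of_less[of r s] embeds_quasisymmetrically_refl[of "Lp r"]
    by (cases "r = s") auto
  show ?thesis
  proof
    assume "p \<le> q \<or> (q \<le> p \<and> p \<le> 2)"
    then show "embeds_quasisymmetrically (Lp p) (Lp q)"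
    proof
      assume "p \<le> q"
      then show ?thesis using assms(1) by (intro le)
    next
      assume pq: "q \<le> p \<and> p \<le> 2"
      then have "embeds_quasisymmetrically (Lp p) (Lp 2)" using assms(1) by (intro le) auto
      moreover have "embeds_quasisymmetrically (Lp 2) (Lp q)"
        using pq assms(2) by (intro L2_embeds_Lq) auto
      ultimately show ?thesis by (rule embeds_quasisymmetrically_trans)
    qed
  next
    assume e: "embeds_quasisymmetrically (Lp p) (Lp q)"
    show "p \<le> q \<or> (q \<le> p \<and> p \<le> 2)"
    proof (rule ccontr)
      assume "\<not> (p \<le> q \<or> (q \<le> p \<and> p \<le> 2))"
      then have "2 \<le> max q 2" "max q 2 < p" by auto
      moreover have "embeds_quasisymmetrically (Lp q) (Lp (max q 2))"
        using assms(2) by (intro le) auto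
      with e have "embeds_quasisymmetrically (Lp p) (Lp (max q 2))"
        by (rule embeds_quasisymmetrically_trans)
      ultimately show False using Lp_not_embeds_Lq by blast
    qed
  qed
qed

end
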